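(* Consider the quadcopter system $$\dot R=R\hat\Omega,\qquad\mathbb I\dot\Omega=\mathbb I\Omega\times\Omega+\tau,\qquad\ddot x=-ge_3+fRe_3,$$ with $R\in\operatorname{SO}(3)$, $\Omega,x\in\mathbb R^3$, control torque $\tau\in\mathbb R^3$ and control thrust (per mass) $f$. Let $(R_0,\Omega_0,x_0,\dot x_0,f_0,\dot f_0)(t)$, $R_0(t)\in\operatorname{SO}(3)$, and $(u_0,q_0)(t)$, $t\ge0$, be a smooth reference trajectory and reference control with $$\dot R_0=R_0\hat\Omega_0,\quad\dot\Omega_0=u_0,\quad\ddot x_0=-ge_3+f_0R_0e_3,\quad\ddot f_0=q_0,$$ such that $\Omega_0,\dot\Omega_0,f_0,\dot f_0,\ddot f_0$ are bounded on $[0,\infty)$ and, for some constant $\delta>0$, $f_0(t)\ge\delta$ for all $t\ge0$. Then the controller $(\tau,f)$ constructed in the context (for any fixed $k_e>0$ and any choice of gains as described there) enables the quadcopter system to exponentially track the reference trajectory $(R_0(t),\Omega_0(t),x_0(t),\dot x_0(t))$.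
   Context: Notation: $e_3=(0,0,1)$, $g>0$ is the gravitational acceleration, $\mathbb I$ the (symmetric positive definite) $3\times3$ moment of inertia matrix; $\hat\Omega$ is the $3\times3$ skew-symmetric matrix with $\hat\Omega v=\Omega\times v$, $\vee$ is the inverse of the hat map; $[A,B]=AB-BA$; $\operatorname{Sym}(A)=\frac12(A+A^T)$, $\operatorname{Skew}(A)=\frac12(A-A^T)$. Norms are Frobenius/Euclidean. A polynomial is Hurwitz if all its roots have negative real part. Construction of the controller. The torque is $\tau=-\mathbb I\Omega\times\Omega+\mathbb Iu$ with $u=u_0(t)+\Delta u$, and the thrust $f$ is generated by the dynamic extension $\ddot f=q$ with $q=q_0(t)+\Delta q$ (so $f,\dot f$ are controller states). Put $\Delta\Omega=\Omega-\Omega_0$, $\Delta x=x-x_0$, $\Delta\dot x=\dot x-\dot x_0$, $\Delta f=f-f_0$, $\Delta\dot f=\dot f-\dot f_0$, $Z=R_0^T(R-R_0)$, $Z_s=\operatorname{Sym}(Z)$, $Z_k=\operatorname{Skew}(Z)$, $(z_{k1},z_{k2},z_{k3})=Z_k^\vee$, $A_0=f_0R_0$, $B_0=\operatorname{diag}[f_0,-f_0,1]$. In all formulas below, the symbols $\dot Z_s$, $\dot Z_k^\vee$ (and correspondingly $\dot Z_k$, $\dot z_{k3}$), $\Delta\ddot x$, $\Delta\dddot x$ stand for the expressions $\dot Z_s:=[Z_s,\hat\Omega_0]-2k_eZ_s$, $\ \dot Z_k^\vee:=Z_k^\vee\times\Omega_0+\Delta\Omega$, $\ \Delta\ddot x:=(\Delta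 fR_0+A_0Z_k+A_0Z_s)e_3$, $\ \Delta\dddot x:=(\Delta\dot fR_0+A_0\dot Z_k+\Delta f\dot R_0+\dot A_0(Z_s+Z_k)+A_0\dot Z_s)e_3$. Choose $(v,w)\in\mathbb R^3\times\mathbb R$ in one of two ways: (a) $v=-K_3\Delta\dddot x-K_2\Delta\ddot x-K_1\Delta\dot x-K_0\Delta x$, $w=-a_1\dot z_{k3}-a_0z_{k3}$, where $K_i\in\mathbb R^{3\times3}$, $\det(\lambda^4I+\lambda^3K_3+\lambda^2K_2+\lambda K_1+K_0)$ is Hurwitz, and $a_0,a_1>0$; or (b) $v=-K_3\Delta\dddot x-K_2\Delta\ddot x-K_1\Delta\dot x-K_0\Delta x-K_I\int_0^t\Delta x\,d\tau$, $w=-a_1\dot z_{k3}-a_0z_{k3}-a_I\int_0^tz_{k3}\,d\tau$, where $\det(\lambda^5I+\lambda^4K_3+\lambda^3K_2+\lambda^2K_1+\lambda K_0+K_I)$ and $\lambda^3+a_1\lambda^2+a_0\lambda+a_I$ are Hurwitz. Then set $\tilde u_3=w$, $[\tilde u_2,\tilde u_1,\Delta q]^T=B_0^{-1}R_0^T(v-Ce_3)$ with $C=2\Delta\dot f\dot R_0+2\dot A_0(\dot Z_s+\dot Z_k)+\Delta f\ddot R_0+\ddot A_0(Z_s+Z_k)+A_0([\dot Z_s,\hat\Omega_0]+[Z_s,\hat{\dot\Omega}_0]-2k_e\dot Z_s)$, and $\Delta u=-(Z_k^\vee\times\Omega_0+\Delta\Omega)\times\Omega_0-Z_k^\vee\times\dot\Omega_0+\tilde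 u$. Tracking is understood locally: "exponentially tracks" means there are constants $\rho,c,\alpha>0$ such that, if the initial error $E_0=\|R(0)-R_0(0)\|+\|\Omega(0)-\Omega_0(0)\|+\|x(0)-x_0(0)\|+\|\dot x(0)-\dot x_0(0)\|+|f(0)-f_0(0)|+|\dot f(0)-\dot f_0(0)|$ is less than $\rho$, then $\|R(t)-R_0(t)\|+\|\Omega(t)-\Omega_0(t)\|+\|x(t)-x_0(t)\|+\|\dot x(t)-\dot x_0(t)\|\le c\,e^{-\alpha t}E_0$ for all $t\ge0$. *)

theory Defs
  imports "HOL-Analysis.Analysis" "HOL-Computational_Algebra.Polynomial"
begin

definition e3 :: "real^3" where
  "e3 = vector [0, 0, 1]"

definition hat :: "real^3 \<Rightarrow> real^3^3" where
  "hat w = matrix (cross3 w)"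

definition vee :: "real^3^3 \<Rightarrow> real^3" where
  "vee A = vector [A$3$2, A$1$3, A$2$1]"

lemma hat_mult_vec: "hat w *v v = cross3 w v"
  by (simp add: hat_def cross3_def matrix_vector_mult_def matrix_def vec_eq_iff sum_3 forall_3
        axis_def)

lemma vee_hat: "vee (hat w) = w"
  by (simp add: hat_def vee_def cross3_def matrix_def vec_eq_iff forall_3 axis_def)

lemma hat_vee:
  assumes "transpose A = - A"
  shows "hat (vee A) = A"
proof -
  have "A$j$i = - A$i$j" for i j
    using arg_cong[OF assms, of "\<lambda>M. M$i$j"] by (simp add: transpose_def)
  from this[of 1 1] this[of 2 2] this[of 3 3] this[of 1 2] this[of 1 3] this[of 2 3]
  show ?thesis
    by (simp add: hat_def vee_def cross3_def matrix_def vec_eq_iff forall_3 axis_def)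
qed

definition commutator :: "real^3^3 \<Rightarrow> real^3^3 \<Rightarrow> real^3^3" where
  "commutator A B = A ** B - B ** A"

definition sym_part :: "real^3^3 \<Rightarrow> real^3^3" where
  "sym_part A = (1/2) *\<^sub>R (A + transpose A)"

definition skew_part :: "real^3^3 \<Rightarrow> real^3^3" where
  "skew_part A = (1/2) *\<^sub>R (A - transpose A)"

definition sym_pos_def :: "real^3^3 \<Rightarrow> bool" where
  "sym_pos_def A \<longleftrightarrow> transpose A = A \<and> (\<forall>x. x \<noteq> 0 \<longrightarrow> x \<bullet> (A *v x) > 0)"

definition hurwitz :: "real poly \<Rightarrow> bool" where
  "hurwitz p \<longleftrightarrow> (\<forall>z::complex. poly (map_poly complex_of_real p) z = 0 \<longrightarrow> Re z < 0)"

text \<open>Time runs over \<open>[0, \<infinity>)\<close>; at time 0 all derivatives are one-sided. Values of functions at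
  negative times never matter.\<close>

definition ddt :: "(real \<Rightarrow> 'a::real_normed_vector) \<Rightarrow> real \<Rightarrow> 'a" where
  "ddt F t = vector_derivative F (at t within {0..})"

definition smooth :: "(real \<Rightarrow> 'a::real_normed_vector) \<Rightarrow> bool" where
  "smooth F \<longleftrightarrow> (\<forall>n. \<forall>t\<ge>0. (ddt ^^ n) F differentiable (at t within {0..}))"

text \<open>The thrust and its rate are states because of the dynamic extension.\<close>

record qstate =
  att :: "real^3^3"
  angvel :: "real^3"
  pos :: "real^3"
  vel :: "real^3"
  thrust :: real
  thrust_rate :: real

definition reference ::
    "real \<Rightarrow> (real \<Rightarrow> qstate) \<Rightarrow> (real \<Rightarrow> real^3) \<Rightarrow> (real \<Rightarrow> real) \<Rightarrow> bool" where
  "reference g r u0 q0 \<longleftrightarrow>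
     smooth (\<lambda>t. att (r t)) \<and> smooth (\<lambda>t. angvel (r t)) \<and>
     smooth (\<lambda>t. pos (r t)) \<and> smooth (\<lambda>t. vel (r t)) \<and>
     smooth (\<lambda>t. thrust (r t)) \<and> smooth (\<lambda>t. thrust_rate (r t)) \<and>
     smooth u0 \<and> smooth q0 \<and>
     (\<forall>t\<ge>0. rotation_matrix (att (r t)) \<and>
        ((\<lambda>s. att (r s)) has_vector_derivative att (r t) ** hat (angvel (r t)))
           (at t within {0..}) \<and>
        ((\<lambda>s. angvel (r s)) has_vector_derivative u0 t) (at t within {0..}) \<and>
        ((\<lambda>s. pos (r s)) has_vector_derivative vel (r t)) (at t within {0..}) \<and>
        ((\<lambda>s. vel (r s)) has_vector_derivative
            - (g *\<^sub>R e3) + thrust (r t) *\<^sub>R (att (r t) *v e3)) (at t within {0..}) \<and>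
        ((\<lambda>s. thrust (r s)) has_vector_derivative thrust_rate (r t)) (at t within {0..}) \<and>
        ((\<lambda>s. thrust_rate (r s)) has_vector_derivative q0 t) (at t within {0..}))"

definition tracking_error :: "qstate \<Rightarrow> qstate \<Rightarrow> real" where
  "tracking_error s s0 =
     norm (att s - att s0) + norm (angvel s - angvel s0) +
     norm (pos s - pos s0) + norm (vel s - vel s0)"

definition full_error :: "qstate \<Rightarrow> qstate \<Rightarrow> real" where
  "full_error s s0 = tracking_error s s0 +
     \<bar>thrust s - thrust s0\<bar> + \<bar>thrust_rate s - thrust_rate s0\<bar>"

text \<open>Throughout, \<open>r\<close> is the reference and \<open>S\<close> the actual trajectory. The functions whose names
  end in \<open>_dot\<close> and the functions \<open>pos_err_2\<close> and \<open>pos_err_3\<close> are formulas used in the feedback;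
  along a trajectory they agree with the derivatives suggested by their names only to first order
  in the error.\<close>

definition A0 :: "(real \<Rightarrow> qstate) \<Rightarrow> real \<Rightarrow> real^3^3" where
  "A0 r t = thrust (r t) *\<^sub>R att (r t)"

definition B0 :: "(real \<Rightarrow> qstate) \<Rightarrow> real \<Rightarrow> real^3^3" where
  "B0 r t = vector [vector [thrust (r t), 0, 0],
                    vector [0, - thrust (r t), 0],
                    vector [0, 0, 1]]"

definition Z :: "(real \<Rightarrow> qstate) \<Rightarrow> (real \<Rightarrow> qstate) \<Rightarrow> real \<Rightarrow> real^3^3" where
  "Z r S t = transpose (att (r t)) ** (att (S t) - att (r t))"

definition Zs :: "(real \<Rightarrow> qstate) \<Rightarrow> (real \<Rightarrow> qstate) \<Rightarrow> real \<Rightarrow> real^3^3" where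
  "Zs r S t = sym_part (Z r S t)"

definition Zk :: "(real \<Rightarrow> qstate) \<Rightarrow> (real \<Rightarrow> qstate) \<Rightarrow> real \<Rightarrow> real^3^3" where
  "Zk r S t = skew_part (Z r S t)"

definition zk :: "(real \<Rightarrow> qstate) \<Rightarrow> (real \<Rightarrow> qstate) \<Rightarrow> real \<Rightarrow> real^3" where
  "zk r S t = vee (Zk r S t)"

definition Zs_dot :: "real \<Rightarrow> (real \<Rightarrow> qstate) \<Rightarrow> (real \<Rightarrow> qstate) \<Rightarrow> real \<Rightarrow> real^3^3" where
  "Zs_dot ke r S t =
     commutator (Zs r S t) (hat (angvel (r t))) - (2 * ke) *\<^sub>R Zs r S t"

definition zk_dot :: "(real \<Rightarrow> qstate) \<Rightarrow> (real \<Rightarrow> qstate) \<Rightarrow> real \<Rightarrow> real^3" where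
  "zk_dot r S t = cross3 (zk r S t) (angvel (r t)) + (angvel (S t) - angvel (r t))"

definition Zk_dot :: "(real \<Rightarrow> qstate) \<Rightarrow> (real \<Rightarrow> qstate) \<Rightarrow> real \<Rightarrow> real^3^3" where
  "Zk_dot r S t = hat (zk_dot r S t)"

definition pos_err_2 :: "(real \<Rightarrow> qstate) \<Rightarrow> (real \<Rightarrow> qstate) \<Rightarrow> real \<Rightarrow> real^3" where
  "pos_err_2 r S t =
     ((thrust (S t) - thrust (r t)) *\<^sub>R att (r t)
      + A0 r t ** Zk r S t + A0 r t ** Zs r S t) *v e3"

definition pos_err_3 :: "real \<Rightarrow> (real \<Rightarrow> qstate) \<Rightarrow> (real \<Rightarrow> qstate) \<Rightarrow> real \<Rightarrow> real^3" where
  "pos_err_3 ke r S t =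
     ((thrust_rate (S t) - thrust_rate (r t)) *\<^sub>R att (r t)
      + A0 r t ** Zk_dot r S t
      + (thrust (S t) - thrust (r t)) *\<^sub>R ddt (\<lambda>s. att (r s)) t
      + ddt (A0 r) t ** (Zs r S t + Zk r S t)
      + A0 r t ** Zs_dot ke r S t) *v e3"

datatype gains =
    PD "real^3^3" "real^3^3" "real^3^3" "real^3^3" real real
  | PID "real^3^3" "real^3^3" "real^3^3" "real^3^3" "real^3^3" real real real

text \<open>The determinants below are determinants of matrices of polynomials in \<open>\<lambda>\<close>, whose
  entries are given by their coefficient lists, constant term first.\<close>

fun admissible :: "gains \<Rightarrow> bool" where
  "admissible (PD K0 K1 K2 K3 a0 a1) \<longleftrightarrow>
     hurwitz (det (\<chi> i j. [:K0$i$j, K1$i$j, K2$i$j, K3$i$j, (mat 1 :: real^3^3)$i$j:])) \<and>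
     a0 > 0 \<and> a1 > 0"
| "admissible (PID K0 K1 K2 K3 KI a0 a1 aI) \<longleftrightarrow>
     hurwitz (det (\<chi> i j.
       [:KI$i$j, K0$i$j, K1$i$j, K2$i$j, K3$i$j, (mat 1 :: real^3^3)$i$j:])) \<and>
     hurwitz [:aI, a0, a1, 1:]"

fun v_feedback ::
    "gains \<Rightarrow> real \<Rightarrow> (real \<Rightarrow> qstate) \<Rightarrow> (real \<Rightarrow> qstate) \<Rightarrow> real \<Rightarrow> real^3" where
  "v_feedback (PD K0 K1 K2 K3 a0 a1) ke r S t =
     - (K3 *v pos_err_3 ke r S t) - K2 *v pos_err_2 r S t
     - K1 *v (vel (S t) - vel (r t)) - K0 *v (pos (S t) - pos (r t))"
| "v_feedback (PID K0 K1 K2 K3 KI a0 a1 aI) ke r S t =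
     - (K3 *v pos_err_3 ke r S t) - K2 *v pos_err_2 r S t
     - K1 *v (vel (S t) - vel (r t)) - K0 *v (pos (S t) - pos (r t))
     - KI *v integral {0..t} (\<lambda>s. pos (S s) - pos (r s))"

fun w_feedback ::
    "gains \<Rightarrow> (real \<Rightarrow> qstate) \<Rightarrow> (real \<Rightarrow> qstate) \<Rightarrow> real \<Rightarrow> real" where
  "w_feedback (PD K0 K1 K2 K3 a0 a1) r S t =
     - a1 * zk_dot r S t $ 3 - a0 * zk r S t $ 3"
| "w_feedback (PID K0 K1 K2 K3 KI a0 a1 aI) r S t =
     - a1 * zk_dot r S t $ 3 - a0 * zk r S t $ 3
     - aI * integral {0..t} (\<lambda>s. zk r S s $ 3)"

definition C_mat :: "real \<Rightarrow> (real \<Rightarrow> qstate) \<Rightarrow> (real \<Rightarrow> qstate) \<Rightarrow> real \<Rightarrow> real^3^3" where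
  "C_mat ke r S t =
     (2 * (thrust_rate (S t) - thrust_rate (r t))) *\<^sub>R ddt (\<lambda>s. att (r s)) t
     + 2 *\<^sub>R (ddt (A0 r) t ** (Zs_dot ke r S t + Zk_dot r S t))
     + (thrust (S t) - thrust (r t)) *\<^sub>R ddt (ddt (\<lambda>s. att (r s))) t
     + ddt (ddt (A0 r)) t ** (Zs r S t + Zk r S t)
     + A0 r t ** (commutator (Zs_dot ke r S t) (hat (angvel (r t)))
                  + commutator (Zs r S t) (hat (ddt (\<lambda>s. angvel (r s)) t))
                  - (2 * ke) *\<^sub>R Zs_dot ke r S t)"

text \<open>The vector with components \<open>u\<^sub>2\<close>, \<open>u\<^sub>1\<close> (in this order) of the auxiliary input
  followed by the increment of \<open>q\<close>.\<close>

definition decoupled_input ::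
    "gains \<Rightarrow> real \<Rightarrow> (real \<Rightarrow> qstate) \<Rightarrow> (real \<Rightarrow> qstate) \<Rightarrow> real \<Rightarrow> real^3" where
  "decoupled_input G ke r S t =
     matrix_inv (B0 r t) *v
       (transpose (att (r t)) *v (v_feedback G ke r S t - C_mat ke r S t *v e3))"

definition u_tilde ::
    "gains \<Rightarrow> real \<Rightarrow> (real \<Rightarrow> qstate) \<Rightarrow> (real \<Rightarrow> qstate) \<Rightarrow> real \<Rightarrow> real^3" where
  "u_tilde G ke r S t =
     vector [decoupled_input G ke r S t $ 2, decoupled_input G ke r S t $ 1,
             w_feedback G r S t]"

definition delta_q ::
    "gains \<Rightarrow> real \<Rightarrow> (real \<Rightarrow> qstate) \<Rightarrow> (real \<Rightarrow> qstate) \<Rightarrow> real \<Rightarrow> real" where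
  "delta_q G ke r S t = decoupled_input G ke r S t $ 3"

definition delta_u ::
    "gains \<Rightarrow> real \<Rightarrow> (real \<Rightarrow> qstate) \<Rightarrow> (real \<Rightarrow> qstate) \<Rightarrow> real \<Rightarrow> real^3" where
  "delta_u G ke r S t =
     - cross3 (cross3 (zk r S t) (angvel (r t)) + (angvel (S t) - angvel (r t))) (angvel (r t))
     - cross3 (zk r S t) (ddt (\<lambda>s. angvel (r s)) t)
     + u_tilde G ke r S t"

definition torque ::
    "real^3^3 \<Rightarrow> gains \<Rightarrow> real \<Rightarrow> (real \<Rightarrow> qstate) \<Rightarrow> (real \<Rightarrow> real^3) \<Rightarrow>
     (real \<Rightarrow> qstate) \<Rightarrow> real \<Rightarrow> real^3" where
  "torque J G ke r u0 S t =
     - cross3 (J *v angvel (S t)) (angvel (S t)) + J *v (u0 t + delta_u G ke r S t)"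

definition closed_loop ::
    "real \<Rightarrow> real^3^3 \<Rightarrow> gains \<Rightarrow> real \<Rightarrow> (real \<Rightarrow> qstate) \<Rightarrow> (real \<Rightarrow> real^3) \<Rightarrow>
     (real \<Rightarrow> real) \<Rightarrow> (real \<Rightarrow> qstate) \<Rightarrow> bool" where
  "closed_loop g J G ke r u0 q0 S \<longleftrightarrow>
     (\<forall>t\<ge>0. rotation_matrix (att (S t)) \<and>
        ((\<lambda>s. att (S s)) has_vector_derivative att (S t) ** hat (angvel (S t)))
           (at t within {0..}) \<and>
        (\<exists>W. ((\<lambda>s. angvel (S s)) has_vector_derivative W) (at t within {0..}) \<and>
             J *v W = cross3 (J *v angvel (S t)) (angvel (S t)) + torque J G ke r u0 S t) \<and>
        ((\<lambda>s. pos (S s)) has_vector_derivative vel (S t)) (at t within {0..}) \<and>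
        ((\<lambda>s. vel (S s)) has_vector_derivative
            - (g *\<^sub>R e3) + thrust (S t) *\<^sub>R (att (S t) *v e3)) (at t within {0..}) \<and>
        ((\<lambda>s. thrust (S s)) has_vector_derivative thrust_rate (S t)) (at t within {0..}) \<and>
        ((\<lambda>s. thrust_rate (S s)) has_vector_derivative q0 t + delta_q G ke r S t)
           (at t within {0..}))"

text \<open>\<open>sol\<close> is the set of solutions of the controlled system on \<open>[0, \<infinity>)\<close>. Besides the
  decay estimate for all solutions, every initial state near the reference is required to start
  a solution that exists for all times, so that the estimate is not vacuous.\<close>

definition exponentially_tracks ::
    "((real \<Rightarrow> qstate) \<Rightarrow> bool) \<Rightarrow> (real \<Rightarrow> qstate) \<Rightarrow> bool" where
  "exponentially_tracks sol r \<longleftrightarrow>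
     (\<exists>\<rho>>0. \<exists>c>0. \<exists>\<alpha>>0. \<forall>s.
        rotation_matrix (att s) \<and> full_error s (r 0) < \<rho> \<longrightarrow>
          (\<exists>S. sol S \<and> S 0 = s) \<and>
          (\<forall>S. sol S \<and> S 0 = s \<longrightarrow>
             (\<forall>t\<ge>0. tracking_error (S t) (r t) \<le> c * exp (- \<alpha> * t) * full_error s (r 0))))"

end

theory Submission
  imports Defs "HOL-Computational_Algebra.Fundamental_Theorem_Algebra"
begin

text \<open>Why tracking holds. In the body frame of the reference the attitude error is
\<open>Z = R\<^sub>0\<^sup>T (R - R\<^sub>0)\<close>. Orthogonality of \<open>1 + Z\<close> gives \<open>Z + Z\<^sup>T = - Z\<^sup>T Z\<close>, so the symmetric part of
\<open>Z\<close> is of second order in the error, and every term of the feedback that contains it is a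
perturbation. The skew part obeys, up to products of errors, the linear equation that the feedback
uses as its derivative.

The position error, its velocity, and the expressions \<open>acc_err\<close> and \<open>jerk_err\<close> (which imitate the
second and third derivative of the position error), together with the third component of the skew
part, its formal derivative, and the integrals of a PID law, are coordinates \<open>Y\<close> of the error. The
input of the feedback is chosen such that \<open>Y' = M Y + N\<close>, where \<open>M\<close> is the constant companion
matrix of the gains and \<open>N\<close> is quadratic in the error (\<open>normal_coords_deriv\<close>). Since the
reference thrust stays above a positive constant, the error is bounded by a multiple of \<open>Y\<close>
near zero (\<open>normal_coords_inj\<close>).

The determinant in the gain condition annihilates \<open>M\<close>, by multiplying the companion relation with
the adjugate (\<open>shift_act_det\<close>). Splitting this polynomial into complex linear factors yields a
chain of functionals in which \<open>M\<close> acts as multiplication by a root of negative real part plus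
a step along the chain; suitably weighted, their squares add up to a quadratic Lyapunov form
(\<open>hurwitz_annihilator_imp_lyapunov_form\<close>).
Along \<open>Y\<close> this form dominates the quadratic perturbation as long as the error is small, and so the
error decays exponentially while it stays small (\<open>local_decay\<close>); a continuity argument shows that it
never stops being small (\<open>decay_bound_global\<close>).

All constants have to be uniform in time. The coefficients of the error equations are continuous
functions of the current reference data, which range over a compact set, and the equations are
linear in the error except for two products; so all bounds come from compactness
(\<open>uniform_bound_homogeneous\<close>, \<open>uniform_lower_bound_homogeneous\<close>).

Solutions exist because cutting the two products off outside a ball makes the error equations globally
Lipschitz; a fixed point in an exponentially weighted space of bounded functions gives a global
solution (\<open>global_picard\<close>). As long as this solution stays in the ball it solves the true
equations and keeps the attitude orthogonal, so the decay estimate applies to it and it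
never reaches the boundary (\<open>exists_small_error_motion\<close>). Both kinds of feedback law are treated at
once: for a PD law the integrals are replaced by two states that decay on their own.\<close>

section \<open>Matrices acting on three-space\<close>

lemma bounded_bilinear_matrix_mult:
  "bounded_bilinear ((**) :: real^'n^'m \<Rightarrow> real^'p^'n \<Rightarrow> real^'p^'m)"
proof -
  have "bilinear ((**) :: real^'n^'m \<Rightarrow> real^'p^'n \<Rightarrow> real^'p^'m)"
    unfolding bilinear_def
    by (intro conjI allI linearI)
      (simp_all add: matrix_matrix_mult_def vec_eq_iff distrib_left distrib_right sum.distrib
        sum_distrib_left mult_ac)
  then show ?thesis
    by (simp add: bilinear_conv_bounded_bilinear)
qed

lemma bounded_bilinear_matrix_vector_mult:
  "bounded_bilinear ((*v) :: real^'n^'m \<Rightarrow> real^'n \<Rightarrow> real^'m)"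
proof -
  have "bilinear ((*v) :: real^'n^'m \<Rightarrow> real^'n \<Rightarrow> real^'m)"
    unfolding bilinear_def
    by (intro conjI allI linearI)
      (simp_all add: matrix_vector_mult_def vec_eq_iff distrib_left distrib_right sum.distrib
        sum_distrib_left mult_ac)
  then show ?thesis
    by (simp add: bilinear_conv_bounded_bilinear)
qed

lemma bounded_bilinear_cross: "bounded_bilinear cross3"
  using bilinear_cross by (simp add: bilinear_conv_bounded_bilinear)

lemma linear_hat: "linear hat"
  by (auto intro!: linearI simp: hat_def matrix_def cross3_def vec_eq_iff forall_3 axis_def)

lemma linear_vee: "linear vee"
  by (auto intro!: linearI simp: vee_def vec_eq_iff forall_3)

lemma linear_transpose: "linear (transpose :: real^'n^'m \<Rightarrow> real^'m^'n)"
  by (auto intro!: linearI simp: transpose_def vec_eq_iff)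

lemma linear_sym_part: "linear sym_part"
  by (auto intro!: linearI simp: sym_part_def transpose_def vec_eq_iff algebra_simps)

lemma linear_skew_part: "linear skew_part"
  by (auto intro!: linearI simp: skew_part_def transpose_def vec_eq_iff algebra_simps)

lemma bounded_bilinear_commutator: "bounded_bilinear commutator"
proof -
  interpret m: bounded_bilinear "(**) :: real^3^3 \<Rightarrow> real^3^3 \<Rightarrow> real^3^3"
    by (rule bounded_bilinear_matrix_mult)
  have "bilinear commutator"
    unfolding bilinear_def commutator_def
    by (auto intro!: linearI simp: m.add_left m.add_right m.scaleR_left m.scaleR_right algebra_simps)
  then show ?thesis
    by (simp add: bilinear_conv_bounded_bilinear)
qed

lemmas linear_parts = linear_hat linear_vee linear_transpose linear_sym_part linear_skew_part

lemmas continuous_on_parts [continuous_intros] =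
  bounded_bilinear.continuous_on[OF bounded_bilinear_matrix_mult]
  bounded_bilinear.continuous_on[OF bounded_bilinear_matrix_vector_mult]
  bounded_bilinear.continuous_on[OF bounded_bilinear_cross]
  bounded_bilinear.continuous_on[OF bounded_bilinear_commutator]
  linear_parts[unfolded linear_conv_bounded_linear, THEN bounded_linear.continuous_on]

lemmas has_vector_derivative_parts [derivative_intros] =
  bounded_bilinear.has_vector_derivative[OF bounded_bilinear_matrix_mult]
  bounded_bilinear.has_vector_derivative[OF bounded_bilinear_matrix_vector_mult]
  bounded_bilinear.has_vector_derivative[OF bounded_bilinear_cross]
  bounded_bilinear.has_vector_derivative[OF bounded_bilinear_commutator]
  linear_parts[unfolded linear_conv_bounded_linear, THEN bounded_linear.has_vector_derivative]

lemmas bilinear_parts = bounded_bilinear_matrix_mult bounded_bilinear_matrix_vector_mult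
  bounded_bilinear_cross bounded_bilinear_commutator

text \<open>Distributes every matrix operation over sums and scalar multiples. Identities between feedback
terms become identities in a vector space after rewriting with these rules.\<close>

lemmas parts_linear_simps =
  linear_parts[THEN linear_add] linear_parts[THEN linear_scale] linear_parts[THEN linear_diff]
  linear_parts[THEN linear_0]  linear_parts[THEN linear_neg]
  bilinear_parts[THEN bounded_bilinear.add_left] bilinear_parts[THEN bounded_bilinear.add_right]
  bilinear_parts[THEN bounded_bilinear.scaleR_left] bilinear_parts[THEN bounded_bilinear.scaleR_right]
  bilinear_parts[THEN bounded_bilinear.diff_left] bilinear_parts[THEN bounded_bilinear.diff_right]
  bilinear_parts[THEN bounded_bilinear.zero_left] bilinear_parts[THEN bounded_bilinear.zero_right]
  bilinear_parts[THEN bounded_bilinear.minus_left] bilinear_parts[THEN bounded_bilinear.minus_right]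

lemma continuous_on_vector_3 [continuous_intros]:
  assumes "continuous_on S a" "continuous_on S b" "continuous_on S c"
  shows "continuous_on S (\<lambda>x. vector [a x, b x, c x] :: real^3)"
proof (rule continuous_on_vec_lambda[where f = "\<lambda>i x. (vector [a x, b x, c x] :: real^3) $ i", simplified])
  show "continuous_on S (\<lambda>x. (vector [a x, b x, c x] :: real^3) $ i)" for i
    using assms exhaust_3[of i] by auto
qed

lemma has_vector_derivative_eq_rhs:
  "(f has_vector_derivative a) F \<Longrightarrow> a = b \<Longrightarrow> (f has_vector_derivative b) F"
  by simp

text \<open>Used with \<open>has_vector_derivative_eq_rhs\<close>: applying these rules backwards computes a derivative,
whose comparison with the intended expression is then a separate algebraic goal.\<close>

lemmas vector_derivative_rules = has_vector_derivative_add has_vector_derivative_diff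
  bounded_bilinear.has_vector_derivative[OF bounded_bilinear_scaleR] has_vector_derivative_parts
  has_vector_derivative_const

lemma hat_eq: "hat w = vector [vector [0, - (w$3), w$2], vector [w$3, 0, - (w$1)], vector [- (w$2), w$1, 0]]"
  by (simp add: hat_def matrix_def cross3_def vec_eq_iff forall_3 axis_def)

lemmas matrix_3_simps = hat_eq vee_def sym_part_def skew_part_def commutator_def cross3_def
  matrix_matrix_mult_def transpose_def vec_eq_iff forall_3 sum_3

lemma sym_part_hat: "sym_part (hat a) = 0"
  and skew_part_hat: "skew_part (hat a) = hat a"
  by (simp_all add: matrix_3_simps)

lemma skew_part_commutator_hat: "skew_part (commutator A (hat w)) = commutator (skew_part A) (hat w)"
  by (simp add: matrix_3_simps field_simps)

lemma sym_part_commutator_hat: "sym_part (commutator A (hat w)) = commutator (sym_part A) (hat w)"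
  by (simp add: matrix_3_simps field_simps)

lemma hat_vee_skew_part: "hat (vee (skew_part A)) = skew_part A"
  by (rule hat_vee) (simp add: matrix_3_simps field_simps)

lemma hat_cross3: "hat (cross3 a b) = commutator (hat a) (hat b)"
  by (simp add: matrix_3_simps algebra_simps)

lemma sym_part_plus_skew_part: "sym_part A + skew_part A = A"
  by (simp add: matrix_3_simps field_simps)

lemma double_scaleR: "(2 * a) *\<^sub>R x = a *\<^sub>R x + a *\<^sub>R x" for x :: "'a::real_vector"
  by (simp flip: scaleR_left_distrib)

lemmas matrix_zero_right = bilinear_parts[THEN bounded_bilinear.zero_right]

lemma norm_orthogonal_matrix_3:
  fixes R :: "real^3^3"
  assumes "orthogonal_matrix R"
  shows "norm R = sqrt 3"
proof -
  have "(transpose R ** R) $ j $ j = 1" for j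
    using assms by (simp add: orthogonal_matrix mat_def)
  from this[of 1] this[of 2] this[of 3] have "R \<bullet> R = 3"
    by (simp add: inner_vec_def matrix_matrix_mult_def transpose_def sum_3 algebra_simps)
  then show ?thesis by (simp add: norm_eq_sqrt_inner)
qed

lemma compact_orthogonal_matrices: "compact {R :: real^3^3. orthogonal_matrix R}"
proof -
  have "closed {R :: real^3^3. transpose R ** R = mat 1}"
    by (intro closed_Collect_eq continuous_intros)
  moreover have "bounded {R :: real^3^3. orthogonal_matrix R}"
    by (auto intro!: boundedI[where B = "sqrt 3"] simp: norm_orthogonal_matrix_3)
  ultimately show ?thesis by (simp add: compact_eq_bounded_closed orthogonal_matrix)
qed

lemma orthogonal_mult_bound:
  "\<exists>K\<ge>1. \<forall>R A :: real^3^3. orthogonal_matrix R \<longrightarrow> norm (R ** A) \<le> K * norm A"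
proof -
  obtain Km where Km: "Km > 0" "\<And>(A :: real^3^3) (B :: real^3^3). norm (A ** B) \<le> norm A * norm B * Km"
    using bounded_bilinear.pos_bounded[OF bounded_bilinear_matrix_mult] by blast
  have "norm (R ** A) \<le> max 1 (sqrt 3 * Km) * norm A" if "orthogonal_matrix R" for R A :: "real^3^3"
  proof -
    have "norm (R ** A) \<le> (sqrt 3 * Km) * norm A"
      using Km(2)[of R A] that by (simp add: norm_orthogonal_matrix_3 mult_ac)
    also have "\<dots> \<le> max 1 (sqrt 3 * Km) * norm A" by (intro mult_right_mono) auto
    finally show ?thesis .
  qed
  then show ?thesis by (intro exI[of _ "max 1 (sqrt 3 * Km)"]) auto
qed

lemma transpose_hat: "transpose (hat w) = - hat w"
  by (simp add: matrix_3_simps)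

lemma orthogonal_matrix_mul_cancel:
  fixes R A :: "real^'n^'n"
  assumes "orthogonal_matrix R" "orthogonal_matrix (R ** A)"
  shows "orthogonal_matrix A"
proof -
  have "orthogonal_matrix (transpose R ** (R ** A))"
    using assms by (intro orthogonal_matrix_mul[OF _ assms(2)]) simp
  moreover have "transpose R ** (R ** A) = A"
    using assms(1) by (simp add: matrix_mul_assoc orthogonal_matrix)
  ultimately show ?thesis by simp
qed

text \<open>For skew \<open>\<Omega>\<close> the product \<open>R R\<^sup>T\<close> has derivative \<open>R (\<Omega> + \<Omega>\<^sup>T) R\<^sup>T = 0\<close>.\<close>

lemma orthogonal_matrix_preserved:
  fixes R :: "real \<Rightarrow> real^3^3"
  assumes deriv: "\<And>t. t \<in> {0..T} \<Longrightarrow> (R has_vector_derivative R t ** hat (W t)) (at t within {0..})"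
    and init: "orthogonal_matrix (R 0)" and "t \<in> {0..T}"
  shows "orthogonal_matrix (R t)"
proof -
  have "((\<lambda>s. R s ** transpose (R s)) has_vector_derivative 0) (at s within {0..T})" if "s \<in> {0..T}" for s
  proof -
    have "((\<lambda>s. R s ** transpose (R s)) has_vector_derivative 0) (at s within {0..})"
      by (rule has_vector_derivative_eq_rhs, (rule deriv[OF that] vector_derivative_rules)+)
        (simp add: matrix_transpose_mul transpose_hat parts_linear_simps matrix_mul_assoc)
    then show ?thesis by (rule has_vector_derivative_within_subset) auto
  qed
  then obtain E where E: "\<And>s. s \<in> {0..T} \<Longrightarrow> R s ** transpose (R s) = E"
    using has_vector_derivative_zero_constant[of "{0..T}" "\<lambda>s. R s ** transpose (R s)"] by auto
  have "E = mat 1" using E[of 0] init assms(3) by (simp add: orthogonal_matrix_def)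
  then have "R t ** transpose (R t) = mat 1" using E[OF assms(3)] by simp
  then show ?thesis
    by (simp add: orthogonal_matrix_def matrix_left_right_inverse)
qed

text \<open>The determinant is continuous along the curve and takes only the values \<open>1\<close> and \<open>- 1\<close>.\<close>

lemma rotation_matrix_preserved:
  fixes R :: "real \<Rightarrow> real^3^3"
  assumes cont: "continuous_on {0..} R" and orth: "\<And>t. t \<ge> 0 \<Longrightarrow> orthogonal_matrix (R t)"
    and init: "rotation_matrix (R 0)" and "t \<ge> 0"
  shows "rotation_matrix (R t)"
proof (rule ccontr)
  assume "\<not> rotation_matrix (R t)"
  then have "det (R t) = -1"
    using orth[OF \<open>t \<ge> 0\<close>] det_orthogonal_matrix by (auto simp: rotation_matrix_def)
  moreover have "continuous_on {0..t} (\<lambda>s. det (R s))"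
    unfolding det_3 by (intro continuous_intros continuous_on_subset[OF cont]) auto
  ultimately obtain s where "0 \<le> s" "det (R s) = 0"
    using IVT2'[of "\<lambda>s. det (R s)" t 0 0] init \<open>t \<ge> 0\<close> by (auto simp: rotation_matrix_def)
  then show False using det_orthogonal_matrix[OF orth[of s]] by auto
qed

section \<open>Bounds that are uniform over a compact parameter set\<close>

text \<open>By homogeneity it suffices to bound the map on the unit sphere, where compactness applies. In the
applications \<open>c\<close> is the reference data at one instant, so that the bound is uniform in time.\<close>

lemma uniform_bound_homogeneous:
  fixes \<Phi> :: "'c::euclidean_space \<Rightarrow> 'a::euclidean_space \<Rightarrow> 'b::euclidean_space"
  assumes K: "compact K"
    and cont: "continuous_on (K \<times> UNIV) (\<lambda>p. \<Phi> (fst p) (snd p))"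
    and hom: "\<And>c s x. \<Phi> c (s *\<^sub>R x) = s *\<^sub>R \<Phi> c x"
  shows "\<exists>C>0. \<forall>c\<in>K. \<forall>x. norm (\<Phi> c x) \<le> C * norm x"
proof -
  have "compact ((\<lambda>p. \<Phi> (fst p) (snd p)) ` (K \<times> sphere 0 1))"
    by (intro compact_continuous_image compact_Times K compact_sphere
        continuous_on_subset[OF cont]) auto
  then obtain C where C: "C > 0" "\<And>c x. c \<in> K \<Longrightarrow> norm x = 1 \<Longrightarrow> norm (\<Phi> c x) \<le> C"
    unfolding compact_eq_bounded_closed bounded_pos by (fastforce simp: image_iff)
  have "norm (\<Phi> c x) \<le> C * norm x" if "c \<in> K" for c x
  proof (cases "x = 0")
    case True
    then show ?thesis using hom[of c 0 0] by simp
  next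
    case False
    have "norm (\<Phi> c (inverse (norm x) *\<^sub>R x)) \<le> C"
      using C(2)[OF that, of "inverse (norm x) *\<^sub>R x"] False by simp
    then show ?thesis using False by (simp add: hom field_simps)
  qed
  then show ?thesis using C(1) by blast
qed

text \<open>The norm of the image has a positive minimum over the compact set of parameters and unit vectors.
This inverts a family of injective linear maps with a uniform constant, without computing any
inverse.\<close>

lemma uniform_lower_bound_homogeneous:
  fixes \<Phi> :: "'c::euclidean_space \<Rightarrow> 'a::euclidean_space \<Rightarrow> 'b::euclidean_space"
  assumes K: "compact K"
    and cont: "continuous_on (K \<times> UNIV) (\<lambda>p. \<Phi> (fst p) (snd p))"
    and hom: "\<And>c s x. \<Phi> c (s *\<^sub>R x) = s *\<^sub>R \<Phi> c x"
    and inj: "\<And>c x. c \<in> K \<Longrightarrow> \<Phi> c x = 0 \<Longrightarrow> x = 0"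
  shows "\<exists>C>0. \<forall>c\<in>K. \<forall>x. norm x \<le> C * norm (\<Phi> c x)"
proof -
  have "compact ((\<lambda>p. inverse (norm (\<Phi> (fst p) (snd p)))) ` (K \<times> sphere 0 1))"
  proof (intro compact_continuous_image compact_Times K compact_sphere continuous_intros
        continuous_on_subset[OF cont] ballI Sigma_mono order_refl subset_UNIV)
    fix p assume "p \<in> K \<times> sphere (0::'a) 1"
    then show "norm (\<Phi> (fst p) (snd p)) \<noteq> 0"
      using inj[of "fst p" "snd p"] by auto
  qed
  then have "bounded ((\<lambda>p. inverse (norm (\<Phi> (fst p) (snd p)))) ` (K \<times> sphere 0 1))"
    by (rule compact_imp_bounded)
  then obtain C where C: "C > 0"
    "\<And>c x. c \<in> K \<Longrightarrow> norm x = 1 \<Longrightarrow> inverse (norm (\<Phi> c x)) \<le> C"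
    unfolding bounded_pos by (fastforce simp: image_iff)
  have "norm x \<le> C * norm (\<Phi> c x)" if c: "c \<in> K" for c x
  proof (cases "x = 0")
    case False
    let ?e = "inverse (norm x) *\<^sub>R x"
    have e: "norm ?e = 1" using False by simp
    then have "norm (\<Phi> c ?e) > 0" using inj[OF c, of ?e] by (metis norm_zero zero_less_norm_iff zero_neq_one)
    then have "1 \<le> C * norm (\<Phi> c ?e)"
      using C(2)[OF c e] by (simp add: field_simps)
    then show ?thesis using False by (simp add: hom field_simps)
  qed (use C(1) in simp)
  then show ?thesis using C(1) by blast
qed

section \<open>Differential equations on the half line\<close>

lemma at_within_atLeast_interval:
  fixes t :: real
  assumes "0 \<le> t" "t < b"
  shows "at t within {0..b} = at t within {0..}"
  by (rule at_within_nhd[where S = "{..<b}"]) (use assms in auto)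

lemma integral_has_vector_derivative_half_line:
  fixes f :: "real \<Rightarrow> 'a::banach"
  assumes "continuous_on {0..} f" "t \<ge> 0"
  shows "((\<lambda>t. integral {0..t} f) has_vector_derivative f t) (at t within {0..})"
proof -
  have "((\<lambda>t. integral {0..t} f) has_vector_derivative f t) (at t within {0..t+1})"
    using assms by (intro integral_has_vector_derivative continuous_on_subset[OF assms(1)]) auto
  then show ?thesis
    using assms(2) by (simp add: at_within_atLeast_interval)
qed

lemma has_vector_derivative_half_line_continuous_on:
  assumes "\<And>t. t \<ge> 0 \<Longrightarrow> (f has_vector_derivative f' t) (at t within {0..})"
  shows "continuous_on {0..} (f :: real \<Rightarrow> 'a::real_normed_vector)"
  using assms by (auto simp: continuous_on_eq_continuous_within intro: has_vector_derivative_continuous)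

text \<open>With \<open>y t = exp (L t) u t\<close> the integral equation becomes a fixed point problem for the bounded
continuous function \<open>u\<close>. For \<open>L\<close> larger than twice the Lipschitz constant the integral operator
contracts by one half on the whole half line, so no continuation argument is needed.\<close>

lemma global_picard:
  fixes F :: "real \<Rightarrow> 'a::euclidean_space \<Rightarrow> 'a"
  assumes cont: "\<And>y. continuous_on {0..} y \<Longrightarrow> continuous_on {0..} (\<lambda>t. F t (y t))"
    and lip: "\<And>t x y. t \<ge> 0 \<Longrightarrow> norm (F t x - F t y) \<le> K * norm (x - y)"
    and zero: "\<And>t. t \<ge> 0 \<Longrightarrow> F t 0 = 0"
  shows "\<exists>y. y 0 = y0 \<and> (\<forall>t\<ge>0. (y has_vector_derivative F t (y t)) (at t within {0..}))"
proof -
  (* The summand 1 keeps L positive when K vanishes. *)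
  define L where "L = 2 * \<bar>K\<bar> + 1"
  have L: "L > 0" "\<bar>K\<bar> \<le> L / 2" by (auto simp: L_def)
  define h where "h u s = F s (exp (L * s) *\<^sub>R apply_bcontfun u s)" for u :: "real \<Rightarrow>\<^sub>C 'a" and s
  define P where "P u t = y0 + integral {0..t} (h u)" for u t
  define Q where "Q u t = exp (- L * max 0 t) *\<^sub>R P u (max 0 t)" for u t
  have cont_h: "continuous_on {0..} (h u)" for u
    unfolding h_def by (intro cont continuous_intros continuous_on_apply_bcontfun)
  have deriv_P: "(P u has_vector_derivative h u t) (at t within {0..})" if "t \<ge> 0" for u t
    unfolding P_def
    using integral_has_vector_derivative_half_line[OF cont_h that]
    by (auto intro!: derivative_eq_intros)
  have int_h: "h u integrable_on {0..t}" for u t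
    by (intro integrable_continuous_real continuous_on_subset[OF cont_h]) auto
  have diff_bound: "norm (integral {0..t} (\<lambda>s. h u s - h v s)) \<le> exp (L * t) * (norm (u - v) / 2)"
    if t: "t \<ge> 0" for u v t
  proof -
    let ?d = "norm (u - v)"
    have I: "((\<lambda>s. (L / 2 * ?d) * exp (L * s)) has_integral
        (?d / 2) * exp (L * t) - (?d / 2) * exp (L * 0)) {0..t}"
      using L(1) t
      by (intro fundamental_theorem_of_calculus)
        (auto intro!: derivative_eq_intros simp: has_real_derivative_iff_has_vector_derivative[symmetric])
    have "norm (integral {0..t} (\<lambda>s. h u s - h v s)) \<le> integral {0..t} (\<lambda>s. (L / 2 * ?d) * exp (L * s))"
    proof (rule integral_norm_bound_integral)
      show "(\<lambda>s. h u s - h v s) integrable_on {0..t}"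
        by (intro integrable_diff int_h)
      show "(\<lambda>s. (L / 2 * ?d) * exp (L * s)) integrable_on {0..t}"
        using I by (rule has_integral_integrable)
      fix s assume "s \<in> {0..t}"
      then have "norm (h u s - h v s) \<le> K * norm (exp (L * s) *\<^sub>R (u s - v s))"
        unfolding h_def using lip[of s] by (metis atLeastAtMost_iff scaleR_diff_right)
      also have "\<dots> \<le> (L / 2) * (exp (L * s) * ?d)"
        using norm_bounded[of "u - v" s] L
        by (intro mult_mono) (auto simp: intro: order_trans[OF abs_ge_self])
      finally show "norm (h u s - h v s) \<le> (L / 2 * ?d) * exp (L * s)"
        by (simp add: mult_ac)
    qed
    also have "\<dots> = (?d / 2) * exp (L * t) - ?d / 2"
      using integral_unique[OF I] by simp
    also have "\<dots> \<le> exp (L * t) * (?d / 2)" by simp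
    finally show ?thesis .
  qed
  have Q_diff: "norm (Q u t - Q v t) \<le> norm (u - v) / 2" for u v t
  proof -
    let ?t = "max 0 t"
    have "Q u t - Q v t = exp (- L * ?t) *\<^sub>R integral {0..?t} (\<lambda>s. h u s - h v s)"
      unfolding Q_def P_def by (simp add: integral_diff[OF int_h int_h] scaleR_diff_right[symmetric])
    also have "norm \<dots> \<le> exp (- L * ?t) * (exp (L * ?t) * (norm (u - v) / 2))"
      using diff_bound[of ?t u v] by (simp del: exp_le_cancel_iff)
    also have "\<dots> = norm (u - v) / 2"
      by (simp add: exp_minus)
    finally show ?thesis .
  qed
  have Q0: "norm (Q 0 t) \<le> norm y0" for t
  proof -
    have "integral {0..max 0 t} (h 0) = integral {0..max 0 t} (\<lambda>s. 0)"
      by (rule integral_cong) (auto simp: h_def zero)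
    then have "norm (Q 0 t) = exp (- L * max 0 t) * norm y0"
      by (simp add: Q_def P_def)
    also have "\<dots> \<le> 1 * norm y0"
      using L by (intro mult_right_mono) auto
    finally show ?thesis by simp
  qed
  have Q_bcont: "Q u \<in> bcontfun" for u
  proof (rule bcontfun_normI)
    have "continuous_on {0..} (P u)"
      using deriv_P by (rule has_vector_derivative_half_line_continuous_on)
    then have "continuous_on UNIV (\<lambda>t. P u (max 0 t))"
      by (rule continuous_on_compose2) (intro continuous_intros, auto)
    then show "continuous_on UNIV (Q u)"
      unfolding Q_def by (intro continuous_intros)
    show "norm (Q u t) \<le> norm y0 + norm u / 2" for t
      using norm_triangle_sub[of "Q u t" "Q 0 t"] Q_diff[of u t 0] Q0[of t] by simp
  qed
  have "\<exists>!u. Bcontfun (Q u) = u"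
  proof (rule banach_fix_type[of "1/2"])
    show "\<forall>u v. dist (Bcontfun (Q u)) (Bcontfun (Q v)) \<le> 1 / 2 * dist u v"
    proof (intro allI)
      fix u v
      show "dist (Bcontfun (Q u)) (Bcontfun (Q v)) \<le> 1 / 2 * dist u v"
        unfolding dist_norm
        by (rule norm_bound) (use Q_diff in \<open>simp add: Bcontfun_inverse[OF Q_bcont]\<close>)
    qed
  qed auto
  then obtain u where u: "Bcontfun (Q u) = u" by blast
  have fp: "apply_bcontfun u t = Q u t" for t
    using Bcontfun_inverse[OF Q_bcont, of u] u by simp
  have "exp (L * t) *\<^sub>R apply_bcontfun u t = P u t" if "t \<ge> 0" for t
    using that by (simp add: fp Q_def exp_minus)
  then have "h u t = F t (P u t)" if "t \<ge> 0" for t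
    using that by (simp add: h_def)
  then have "\<forall>t\<ge>0. (P u has_vector_derivative F t (P u t)) (at t within {0..})"
    using deriv_P by metis
  moreover have "P u 0 = y0" by (simp add: P_def)
  ultimately show ?thesis by blast
qed

text \<open>At the first time at which \<open>\<phi>\<close> reaches \<open>\<rho>\<close>, the weak bound holds on the whole interval before it, and
the hypothesis turns it into the strict one.\<close>

lemma continuity_bootstrap:
  fixes \<phi> :: "real \<Rightarrow> real"
  assumes cont: "continuous_on {0..} \<phi>" and init: "\<phi> 0 < \<rho>"
    and step: "\<And>T. T \<ge> 0 \<Longrightarrow> (\<And>t. 0 \<le> t \<Longrightarrow> t \<le> T \<Longrightarrow> \<phi> t \<le> \<rho>) \<Longrightarrow> \<phi> T < \<rho>"
    and "t \<ge> 0"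
  shows "\<phi> t < \<rho>"
proof (rule ccontr)
  assume neg: "\<not> \<phi> t < \<rho>"
  (* The times at which the bound fails form a closed set; its infimum is the first such time. *)
  define S where "S = {s\<in>{0..t}. \<rho> \<le> \<phi> s}"
  have "closed S"
    unfolding S_def
    by (intro continuous_on_closed_Collect_le continuous_intros continuous_on_subset[OF cont]) auto
  moreover have "S \<noteq> {}" "bdd_below S"
    using neg \<open>t \<ge> 0\<close> by (auto simp: S_def intro: bdd_belowI[of _ 0])
  ultimately have "Inf S \<in> S" by (intro closed_contains_Inf)
  define T where "T = Inf S"
  have T: "0 \<le> T" "T \<le> t" "\<rho> \<le> \<phi> T" using \<open>Inf S \<in> S\<close> by (auto simp: S_def T_def)
  have below: "\<phi> s < \<rho>" if "0 \<le> s" "s < T" for s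
  proof (rule ccontr)
    assume "\<not> \<phi> s < \<rho>"
    then have "s \<in> S" using that T by (auto simp: S_def)
    then show False using that cInf_lower[OF _ \<open>bdd_below S\<close>, of s] by (auto simp: T_def)
  qed
  have "T > 0" using T init by (cases "T = 0") auto
  have "\<phi> T \<le> \<rho>"
  proof (rule continuous_le_on_closure[of "{0..<T}" \<phi>])
    show "continuous_on (closure {0..<T}) \<phi>" using \<open>T > 0\<close> by (auto intro: continuous_on_subset[OF cont])
    show "T \<in> closure {0..<T}" using \<open>T > 0\<close> by auto
  qed (use below in \<open>auto intro: less_imp_le\<close>)
  then have "\<phi> T < \<rho>"
    using below T by (intro step) (auto simp: order_le_less)
  with T show False by simp
qed

text \<open>The function \<open>exp (a t) V t\<close> is nonincreasing.\<close>

lemma exponential_decay: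
  fixes V :: "real \<Rightarrow> real"
  assumes "T \<ge> 0"
    and V: "\<And>t. 0 \<le> t \<Longrightarrow> t \<le> T \<Longrightarrow> (V has_vector_derivative V' t) (at t within {0..})"
    and le: "\<And>t. 0 \<le> t \<Longrightarrow> t \<le> T \<Longrightarrow> V' t \<le> - a * V t"
  shows "V T \<le> exp (- a * T) * V 0"
proof (cases "T = 0")
  case False
  then have "T > 0" using assms by simp
  let ?W = "\<lambda>t. exp (a * t) * V t" and ?W' = "\<lambda>t. exp (a * t) * (a * V t + V' t)"
  have "(?W has_derivative (\<lambda>h. h * ?W' t)) (at t within {0..T})" if t: "0 \<le> t" "t \<le> T" for t
  proof -
    have "(V has_real_derivative V' t) (at t within {0..})"
      using V[OF t] by (simp add: has_real_derivative_iff_has_vector_derivative)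
    then have "(?W has_real_derivative ?W' t) (at t within {0..})"
      by (auto intro!: derivative_eq_intros simp: algebra_simps)
    then have "(?W has_real_derivative ?W' t) (at t within {0..T})"
      by (rule has_field_derivative_subset) auto
    then show ?thesis by (simp add: has_field_derivative_def mult.commute[of _ "?W' t"])
  qed
  then obtain t where t: "t \<in> {0<..<T}" "?W T - ?W 0 = (T - 0) * ?W' t"
    using mvt_simple[OF \<open>T > 0\<close>, of ?W "\<lambda>t h. h * ?W' t"] by auto
  have "?W' t \<le> 0" using le[of t] t(1) by (auto simp: mult_nonneg_nonpos)
  with \<open>T > 0\<close> have "(T - 0) * ?W' t \<le> 0"
    by (intro mult_nonneg_nonpos[of "T - 0" "?W' t"]) (simp, assumption)
  then have "?W T \<le> V 0" using t(2) by simp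
  then have "exp (- a * T) * ?W T \<le> exp (- a * T) * V 0"
    by (intro mult_left_mono) auto
  moreover have "exp (- a * T) * ?W T = V T"
    by (simp add: exp_minus field_simps)
  ultimately show ?thesis by (simp only:)
qed simp

section \<open>Lyapunov forms from Hurwitz polynomials\<close>

text \<open>The action of a polynomial in the shift operator on sequences. For the sequence
\<open>n \<mapsto> M\<^sup>n v \<bullet> b\<close> it evaluates a component of \<open>p(M) v\<close>, so that a polynomial calculus is available
without speaking about algebras of operators.\<close>

definition shift_act :: "'a::comm_ring_1 poly \<Rightarrow> (nat \<Rightarrow> 'a) \<Rightarrow> nat \<Rightarrow> 'a" where
  "shift_act p a n = (\<Sum>i\<le>degree p. coeff p i * a (n + i))"

lemma shift_act_0 [simp]: "shift_act 0 a n = 0"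
  by (simp add: shift_act_def)

lemma shift_act_pCons: "shift_act (pCons c p) a n = c * a n + shift_act p a (Suc n)"
  by (cases "p = 0") (simp_all add: shift_act_def sum.atMost_Suc_shift del: sum.atMost_Suc)

lemma shift_act_add: "shift_act (p + q) a n = shift_act p a n + shift_act q a n"
  by (induction p q arbitrary: n rule: poly_induct2) (simp_all add: shift_act_pCons algebra_simps)

lemma shift_act_smult: "shift_act (smult c p) a n = c * shift_act p a n"
  by (induction p arbitrary: n) (simp_all add: shift_act_pCons algebra_simps)

lemma shift_act_mult: "shift_act (p * q) a n = shift_act p (shift_act q a) n"
  by (induction p arbitrary: n) (simp_all add: shift_act_pCons shift_act_add shift_act_smult)

lemma shift_act_seq_add: "shift_act p (\<lambda>n. a n + b n) n = shift_act p a n + shift_act p b n"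
  by (simp add: shift_act_def algebra_simps sum.distrib)

lemma shift_act_seq_mult: "shift_act p (\<lambda>n. c * a n) n = c * shift_act p a n"
  by (simp add: shift_act_def sum_distrib_left mult_ac)

lemma shift_act_seq_zero: "(\<And>n. a n = 0) \<Longrightarrow> shift_act p a n = 0"
  by (simp add: shift_act_def)

lemma shift_act_seq_sum: "shift_act p (\<lambda>n. \<Sum>x\<in>X. a x n) n = (\<Sum>x\<in>X. shift_act p (a x) n)"
  by (induction X rule: infinite_finite_induct) (simp_all add: shift_act_seq_zero shift_act_seq_add)

lemma shift_act_seq_Suc: "shift_act p (\<lambda>n. a (Suc n)) n = shift_act p a (Suc n)"
  by (simp add: shift_act_def)

lemma shift_act_poly_sum: "shift_act (\<Sum>x\<in>X. p x) a n = (\<Sum>x\<in>X. shift_act (p x) a n)"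
  by (induction X rule: infinite_finite_induct) (simp_all add: shift_act_add)

lemma shift_act_of_real:
  "shift_act (map_poly complex_of_real p) (\<lambda>n. complex_of_real (a n)) n = of_real (shift_act p a n)"
  by (simp add: shift_act_def coeff_map_poly degree_map_poly)

lemma shift_act_dvd_zero:
  assumes "p dvd q" "\<And>n. shift_act p a n = 0"
  shows "shift_act q a n = 0"
proof -
  obtain s where "q = s * p" using assms(1) by (auto simp: dvd_def mult.commute)
  then show ?thesis by (simp add: shift_act_mult shift_act_seq_zero assms(2))
qed

text \<open>Stated for commutative rings since the entries will be polynomials, whose matrices have no inverse in
general.\<close>

lemma exists_adjugate_3:
  fixes P :: "'a::comm_ring_1^3^3"
  shows "\<exists>Q :: 'a^3^3. \<forall>k l. (\<Sum>j\<in>UNIV. Q$k$j * P$j$l) = (if k = l then det P else 0)"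
proof -
  let ?Q = "vector [
    vector [P$2$2 * P$3$3 - P$2$3 * P$3$2, P$1$3 * P$3$2 - P$1$2 * P$3$3, P$1$2 * P$2$3 - P$1$3 * P$2$2],
    vector [P$2$3 * P$3$1 - P$2$1 * P$3$3, P$1$1 * P$3$3 - P$1$3 * P$3$1, P$1$3 * P$2$1 - P$1$1 * P$2$3],
    vector [P$2$1 * P$3$2 - P$2$2 * P$3$1, P$1$2 * P$3$1 - P$1$1 * P$3$2, P$1$1 * P$2$2 - P$1$2 * P$2$1]]
    :: 'a^3^3"
  show ?thesis
    by (rule exI[of _ ?Q]) (simp add: forall_3 sum_3 det_3 algebra_simps)
qed

text \<open>A Cayley-Hamilton argument: if the matrix polynomial kills a vector of sequences, then
multiplication by its adjugate shows that the determinant kills each of them.\<close>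

lemma shift_act_det:
  fixes P :: "'a::comm_ring_1 poly^3^3"
  assumes "\<And>j n. (\<Sum>l\<in>UNIV. shift_act (P$j$l) (a l) n) = 0"
  shows "shift_act (det P) (a k) n = 0"
proof -
  obtain Q :: "'a poly^3^3" where Q: "\<And>k l. (\<Sum>j\<in>UNIV. Q$k$j * P$j$l) = (if k = l then det P else 0)"
    using exists_adjugate_3[of P] by blast
  have "shift_act (det P) (a k) n
      = (\<Sum>l\<in>UNIV. shift_act (if k = l then det P else 0) (a l) n)"
    by (subst sum.remove[of _ k]) auto
  also have "\<dots> = (\<Sum>l\<in>UNIV. \<Sum>j\<in>UNIV. shift_act (Q$k$j) (shift_act (P$j$l) (a l)) n)"
    by (simp only: Q[symmetric] shift_act_poly_sum shift_act_mult)
  also have "\<dots> = (\<Sum>j\<in>UNIV. shift_act (Q$k$j) (\<lambda>n. \<Sum>l\<in>UNIV. shift_act (P$j$l) (a l) n) n)"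
    by (subst sum.swap) (simp add: shift_act_seq_sum)
  also have "\<dots> = 0" by (simp add: assms shift_act_seq_zero)
  finally show ?thesis .
qed

lemma hurwitz_nonzero: "hurwitz p \<Longrightarrow> p \<noteq> 0"
  unfolding hurwitz_def by (auto dest: spec[of _ 1])

lemma map_poly_of_real_mult:
  "map_poly complex_of_real (p * q) = map_poly complex_of_real p * map_poly complex_of_real q"
  by (simp add: poly_eq_iff coeff_map_poly coeff_mult)

lemma hurwitz_mult: "hurwitz p \<Longrightarrow> hurwitz q \<Longrightarrow> hurwitz (p * q)"
  unfolding hurwitz_def by (auto simp: map_poly_of_real_mult)

lemma hurwitz_linear: "hurwitz [:1, 1:]"
  unfolding hurwitz_def by (auto simp: map_poly_pCons add_eq_0_iff)

lemma hurwitz_quadratic: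
  assumes "a0 > 0" "a1 > 0"
  shows "hurwitz [:a0, a1, 1:]"
  unfolding hurwitz_def
proof (intro allI impI)
  fix z :: complex
  assume "poly (map_poly complex_of_real [:a0, a1, 1:]) z = 0"
  then have eq: "of_real a0 + z * (of_real a1 + z) = 0" by (simp add: map_poly_pCons)
  have im: "Im z * (a1 + 2 * Re z) = 0" using arg_cong[OF eq, of Im] by (simp add: algebra_simps)
  have re: "a0 + a1 * Re z + (Re z)\<^sup>2 - (Im z)\<^sup>2 = 0"
    using arg_cong[OF eq, of Re] by (simp add: algebra_simps power2_eq_square)
  show "Re z < 0"
  proof (cases "Im z = 0")
    case True
    show ?thesis
    proof (rule ccontr)
      assume "\<not> Re z < 0"
      then have "a1 * Re z \<ge> 0" using assms by simp
      then show False using re True assms by (smt (verit) zero_le_power2 power_zero_numeral)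
    qed
  qed (use im assms in auto)
qed

definition lyapunov_form :: "('a::real_normed_vector \<Rightarrow> 'a) \<Rightarrow> ('a \<Rightarrow> 'a \<Rightarrow> real) \<Rightarrow> real \<Rightarrow> bool" where
  "lyapunov_form M B \<alpha> \<longleftrightarrow> bounded_bilinear B \<and> \<alpha> > 0 \<and> (\<forall>u v. B u v = B v u) \<and>
     (\<forall>v. (norm v)\<^sup>2 \<le> B v v) \<and> (\<forall>v. B v (M v) \<le> - \<alpha> * B v v)"

text \<open>Let \<open>l\<^sub>0, \<dots>, l\<^sub>n\<^sub>-\<^sub>1\<close> be the complex roots of \<open>p\<close> and let \<open>\<zeta>\<^sub>k(v)\<close> be a component of
\<open>(\<Prod>i<k. M - l\<^sub>i) v\<close>. Then \<open>\<zeta>\<^sub>k(M v) = l\<^sub>k \<zeta>\<^sub>k(v) + \<zeta>\<^sub>k\<^sub>+\<^sub>1(v)\<close>, the chain starts with the components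
of \<open>v\<close> itself and ends with \<open>\<zeta>\<^sub>n = 0\<close>. In \<open>\<Sum>k. \<gamma>\<^sup>k |\<zeta>\<^sub>k|\<^sup>2\<close> the negative real parts of the roots absorb the
coupling to the next member of the chain once the weight \<open>\<gamma>\<close> is large.\<close>

lemma hurwitz_annihilator_imp_lyapunov_form:
  fixes M :: "'a::euclidean_space \<Rightarrow> 'a"
  assumes M: "linear M" and p: "hurwitz p"
    and ann: "\<And>v b. b \<in> Basis \<Longrightarrow> shift_act p (\<lambda>n. (M ^^ n) v \<bullet> b) 0 = 0"
  shows "\<exists>B \<alpha>. lyapunov_form M B \<alpha>"
proof -
  define pc where "pc = map_poly complex_of_real p"
  have "pc \<noteq> 0" using hurwitz_nonzero[OF p] by (auto simp: pc_def poly_eq_iff coeff_map_poly)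
  then obtain A where A: "pc = smult (lead_coeff pc) (\<Prod>x\<in>#A. [:-x, 1:])"
    using alg_closed_imp_factorization[of pc] by blast
  obtain ls where ls: "A = mset ls" using ex_mset by metis
  define n where "n = length ls"
  define q where "q k = (\<Prod>i<k. [:- (ls ! i), 1:])" for k
  have qn: "pc = smult (lead_coeff pc) (q n)"
  proof -
    have "(\<Prod>x\<in>#A. [:- x, 1:]) = prod_list (map (\<lambda>x. [:- x, 1:]) ls)"
      by (simp only: ls flip: mset_map prod_mset_prod_list)
    then have "(\<Prod>x\<in>#A. [:- x, 1:]) = q n"
      by (simp add: q_def n_def prod.list_conv_set_nth atLeast0LessThan)
    with A show ?thesis by simp
  qed
  have Re_neg: "Re (ls ! k) < 0" if "k < n" for k
  proof -
    have "poly (q n) (ls ! k) = 0" using that by (auto simp: q_def poly_prod)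
    then have "poly pc (ls ! k) = 0" by (subst qn) simp
    then show ?thesis using p by (auto simp: hurwitz_def pc_def)
  qed
  (* A common spectral gap of all roots. *)
  obtain a where a: "a > 0" "\<And>k. k < n \<Longrightarrow> Re (ls ! k) \<le> - a"
  proof
    let ?m = "Min (insert 1 ((\<lambda>k. - Re (ls ! k)) ` {..<n}))"
    show "?m > 0" using Re_neg by (subst Min_gr_iff) auto
    show "Re (ls ! k) \<le> - ?m" if "k < n" for k
    proof -
      have "?m \<le> - Re (ls ! k)" using that by (intro Min_le) auto
      then show ?thesis by linarith
    qed
  qed
  define \<zeta> where "\<zeta> k b v = shift_act (q k) (\<lambda>n. complex_of_real ((M ^^ n) v \<bullet> b)) 0" for k b v
  have lin_pow: "linear (M ^^ k)" for k
    by (induction k) (simp_all only: funpow.simps linear_id linear_compose M)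
  have \<zeta>_add: "\<zeta> k b (u + v) = \<zeta> k b u + \<zeta> k b v" for k b u v
    by (simp add: \<zeta>_def linear_add[OF lin_pow] inner_add_left shift_act_seq_add)
  have \<zeta>_scale: "\<zeta> k b (c *\<^sub>R v) = c *\<^sub>R \<zeta> k b v" for k b c v
    by (simp add: \<zeta>_def linear_scale[OF lin_pow] shift_act_seq_mult scaleR_conv_of_real)
  have \<zeta>_0: "\<zeta> 0 b v = of_real (v \<bullet> b)" for b v
    by (simp add: \<zeta>_def q_def shift_act_def)
  have \<zeta>_step: "\<zeta> k b (M v) = \<zeta> (Suc k) b v + ls ! k * \<zeta> k b v" for k b v
  proof -
    let ?a = "\<lambda>n. complex_of_real ((M ^^ n) v \<bullet> b)"
    have "\<zeta> k b (M v) = shift_act (q k) (\<lambda>n. ?a (Suc n)) 0"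
      by (simp add: \<zeta>_def funpow_swap1)
    also have "\<dots> = shift_act (pCons 0 (q k)) ?a 0"
      by (subst shift_act_seq_Suc) (simp add: shift_act_pCons)
    also have "pCons 0 (q k) = q (Suc k) + smult (ls ! k) (q k)"
      by (simp add: q_def algebra_simps)
    finally show ?thesis by (simp add: \<zeta>_def shift_act_add shift_act_smult)
  qed
  have \<zeta>_n: "\<zeta> n b v = 0" if "b \<in> Basis" for b v
  proof -
    have "lead_coeff pc * \<zeta> n b v = shift_act pc (\<lambda>n. complex_of_real ((M ^^ n) v \<bullet> b)) 0"
      by (subst (2) qn) (simp add: \<zeta>_def shift_act_smult)
    also have "\<dots> = 0" by (simp add: pc_def shift_act_of_real ann[OF that])
    finally show ?thesis using \<open>pc \<noteq> 0\<close> by simp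
  qed
  (* Without roots the chain would consist of zero only, although it starts with the components of v. *)
  have "n > 0"
  proof (rule ccontr)
    assume "\<not> n > 0"
    moreover obtain b :: 'a where "b \<in> Basis" using nonempty_Basis by blast
    ultimately show False using \<zeta>_n[of b b] \<zeta>_0[of b b] by (simp add: inner_Basis)
  qed
  (* With this weight the coupling terms cost at most half of the decay rate a / 2 that is left
     after Young's inequality. *)
  define \<gamma> where "\<gamma> = 2 / a\<^sup>2"
  have "\<gamma> > 0" using a by (simp add: \<gamma>_def)
  define D where "D k v = (\<Sum>b\<in>Basis. (norm (\<zeta> k b v))\<^sup>2)" for k v
  have D_nonneg: "D k v \<ge> 0" for k v by (auto simp: D_def intro: sum_nonneg)
  have D_n: "D n v = 0" for v by (simp add: D_def \<zeta>_n)
  define B where "B u v = (\<Sum>k<n. \<gamma> ^ k * (\<Sum>b\<in>Basis. \<zeta> k b u \<bullet> \<zeta> k b v))" for u v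
  have B_D: "B v v = (\<Sum>k<n. \<gamma> ^ k * D k v)" for v
    by (simp add: B_def D_def dot_square_norm)
  have "bilinear B"
    unfolding bilinear_def
    by (auto intro!: linearI simp: B_def \<zeta>_add \<zeta>_scale inner_add_left inner_add_right
        sum.distrib distrib_left sum_distrib_left mult_ac)
  then have "bounded_bilinear B" by (simp add: bilinear_conv_bounded_bilinear)
  moreover have "B u v = B v u" for u v by (simp add: B_def inner_commute)
  moreover have "(norm v)\<^sup>2 \<le> B v v" for v
  proof -
    have "(norm v)\<^sup>2 = D 0 v"
      by (simp add: D_def \<zeta>_0 euclidean_inner[of v v] flip: dot_square_norm power2_eq_square)
    also have "\<dots> = (\<Sum>k\<in>{0}. \<gamma> ^ k * D k v)" by simp
    also have "\<dots> \<le> (\<Sum>k<n. \<gamma> ^ k * D k v)"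
      using \<open>n > 0\<close> \<open>\<gamma> > 0\<close> D_nonneg by (intro sum_mono2) auto
    finally show ?thesis by (simp add: B_D)
  qed
  moreover have "B v (M v) \<le> - (a / 4) * B v v" for v
  proof -
    have pointwise: "\<zeta> k b v \<bullet> \<zeta> k b (M v) \<le> - (a / 2) * (norm (\<zeta> k b v))\<^sup>2 + (norm (\<zeta> (Suc k) b v))\<^sup>2 / (2 * a)"
      if "k < n" for k b
    proof -
      let ?x = "\<zeta> k b v" and ?y = "\<zeta> (Suc k) b v"
      have "?x \<bullet> (ls ! k * ?x) = Re (ls ! k) * (norm ?x)\<^sup>2"
        unfolding cmod_power2 by (simp add: inner_complex_def algebra_simps power2_eq_square)
      also have "\<dots> \<le> - a * (norm ?x)\<^sup>2"
        using a(2)[OF that] by (intro mult_right_mono) auto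
      finally have 1: "?x \<bullet> (ls ! k * ?x) \<le> - a * (norm ?x)\<^sup>2" .
      have "0 \<le> (a * norm ?x - norm ?y)\<^sup>2 / (2 * a)" using a(1) by simp
      also have "\<dots> = (a / 2) * (norm ?x)\<^sup>2 + (norm ?y)\<^sup>2 / (2 * a) - norm ?x * norm ?y"
        using a(1) by (simp add: power2_eq_square field_simps)
      finally have 2: "?x \<bullet> ?y \<le> (a / 2) * (norm ?x)\<^sup>2 + (norm ?y)\<^sup>2 / (2 * a)"
        using norm_cauchy_schwarz[of ?x ?y] by simp
      show ?thesis using 1 2 by (simp add: \<zeta>_step inner_add_right)
    qed
    have "B v (M v) \<le> (\<Sum>k<n. \<gamma> ^ k * (- (a / 2) * D k v + D (Suc k) v / (2 * a)))"
      unfolding B_def D_def sum_divide_distrib sum_distrib_left sum.distrib[symmetric]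
      using \<open>\<gamma> > 0\<close> pointwise
      by (intro sum_mono) (auto simp: sum_distrib_left[symmetric] intro!: mult_left_mono sum_mono)
    also have "\<dots> = - (a / 2) * B v v + (\<Sum>k<n. \<gamma> ^ Suc k * D (Suc k) v) / (2 * a * \<gamma>)"
      using \<open>\<gamma> > 0\<close> a(1)
      by (simp add: B_D distrib_left right_diff_distrib sum_subtractf sum.distrib sum_distrib_left
          sum_divide_distrib sum_negf mult_ac)
    also have "(\<Sum>k<n. \<gamma> ^ Suc k * D (Suc k) v) \<le> B v v"
    proof -
      have "(\<Sum>k<n. \<gamma> ^ Suc k * D (Suc k) v) = (\<Sum>k<Suc n. \<gamma> ^ k * D k v) - D 0 v"
        by (subst sum.lessThan_Suc_shift) simp
      also have "\<dots> \<le> B v v" using D_nonneg[of 0 v] by (simp add: B_D D_n)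
      finally show ?thesis .
    qed
    also have "- (a / 2) * B v v + B v v / (2 * a * \<gamma>) = - (a / 4) * B v v"
      using a(1) by (simp add: \<gamma>_def power2_eq_square field_simps)
    finally show ?thesis using a(1) \<open>\<gamma> > 0\<close> by (simp add: divide_right_mono)
  qed
  ultimately show ?thesis
    unfolding lyapunov_form_def using a(1) by (intro exI[of _ B] exI[of _ "a / 4"]) auto
qed

section \<open>The error system\<close>

text \<open>Attitude, angular velocity, angular acceleration, thrust and its first two derivatives of the
reference at one instant, as a point of a Euclidean space, so that boundedness of the reference
becomes membership in a compact set.\<close>

type_synonym reference_data =
  "(real^3^3) \<times> (real^3) \<times> (real^3) \<times> real \<times> real \<times> real"

abbreviation "ref_att c \<equiv> fst (c :: reference_data)"
abbreviation "ref_angvel c \<equiv> fst (snd (c :: reference_data))"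
abbreviation "ref_angacc c \<equiv> fst (snd (snd (c :: reference_data)))"
abbreviation "ref_thrust c \<equiv> fst (snd (snd (snd (c :: reference_data))))"
abbreviation "ref_thrust_rate c \<equiv> fst (snd (snd (snd (snd (c :: reference_data)))))"
abbreviation "ref_thrust_acc c \<equiv> snd (snd (snd (snd (snd (c :: reference_data)))))"

text \<open>The attitude error \<open>Z\<close>, the errors of angular velocity, position, velocity, thrust and thrust
rate, and two controller states for the integrals in a PID law.\<close>

type_synonym error_state =
  "(real^3^3) \<times> (real^3) \<times> (real^3) \<times> (real^3) \<times> real \<times> real \<times> (real^3) \<times> real"

abbreviation "err_att y \<equiv> fst (y :: error_state)"
abbreviation "err_angvel y \<equiv> fst (snd (y :: error_state))"
abbreviation "err_pos y \<equiv> fst (snd (snd (y :: error_state)))"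
abbreviation "err_vel y \<equiv> fst (snd (snd (snd (y :: error_state))))"
abbreviation "err_thrust y \<equiv> fst (snd (snd (snd (snd (y :: error_state)))))"
abbreviation "err_thrust_rate y \<equiv> fst (snd (snd (snd (snd (snd (y :: error_state))))))"
abbreviation "int_pos y \<equiv> fst (snd (snd (snd (snd (snd (snd (y :: error_state)))))))"
abbreviation "int_yaw y \<equiv> snd (snd (snd (snd (snd (snd (snd (y :: error_state)))))))"

text \<open>Along a reference motion these are the attitude \<open>R\<^sub>0\<close> and the product \<open>A\<^sub>0 = f\<^sub>0 R\<^sub>0\<close> with their
first and second derivatives, expressed through the current reference data.\<close>

definition "att_d c = ref_att c ** hat (ref_angvel c)"
definition "att_dd c = ref_att c ** (hat (ref_angvel c) ** hat (ref_angvel c) + hat (ref_angacc c))"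
definition "thr_att c = ref_thrust c *\<^sub>R ref_att c"
definition "thr_att_d c = ref_thrust_rate c *\<^sub>R ref_att c + ref_thrust c *\<^sub>R att_d c"
definition "thr_att_dd c = ref_thrust_acc c *\<^sub>R ref_att c + (2 * ref_thrust_rate c) *\<^sub>R att_d c
  + ref_thrust c *\<^sub>R att_dd c"

text \<open>The quantities of the feedback law as functions of the reference data and the error state
instead of the two trajectories. All of them are linear in the error state, which is what the
compactness bounds need.\<close>

definition "sym_err y = sym_part (err_att y)"
definition "skew_err y = skew_part (err_att y)"
definition "skew_vec y = vee (skew_err y)"

definition "sym_err_d ke c y =
  commutator (sym_err y) (hat (ref_angvel c)) - (2 * ke) *\<^sub>R sym_err y"
definition "skew_vec_d c y = cross3 (skew_vec y) (ref_angvel c) + err_angvel y"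
definition "acc_err c y =
  (err_thrust y *\<^sub>R ref_att c + thr_att c ** skew_err y + thr_att c ** sym_err y) *v e3"
definition "jerk_err ke c y =
  (err_thrust_rate y *\<^sub>R ref_att c + thr_att c ** hat (skew_vec_d c y)
   + err_thrust y *\<^sub>R att_d c + thr_att_d c ** (sym_err y + skew_err y)
   + thr_att c ** sym_err_d ke c y) *v e3"
definition "drift ke c y =
  (2 * err_thrust_rate y) *\<^sub>R att_d c
  + 2 *\<^sub>R (thr_att_d c ** (sym_err_d ke c y + hat (skew_vec_d c y)))
  + err_thrust y *\<^sub>R att_dd c
  + thr_att_dd c ** (sym_err y + skew_err y)
  + thr_att c ** (commutator (sym_err_d ke c y) (hat (ref_angvel c))
                  + commutator (sym_err y) (hat (ref_angacc c))
                  - (2 * ke) *\<^sub>R sym_err_d ke c y)"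

fun pos_law :: "gains \<Rightarrow> real \<Rightarrow> reference_data \<Rightarrow> error_state \<Rightarrow> real^3" where
  "pos_law (PD K0 K1 K2 K3 a0 a1) ke c y =
     - (K3 *v jerk_err ke c y) - K2 *v acc_err c y - K1 *v err_vel y - K0 *v err_pos y"
| "pos_law (PID K0 K1 K2 K3 KI a0 a1 aI) ke c y =
     - (K3 *v jerk_err ke c y) - K2 *v acc_err c y - K1 *v err_vel y - K0 *v err_pos y
     - KI *v int_pos y"

fun yaw_law :: "gains \<Rightarrow> reference_data \<Rightarrow> error_state \<Rightarrow> real" where
  "yaw_law (PD K0 K1 K2 K3 a0 a1) c y = - a1 * skew_vec_d c y $ 3 - a0 * skew_vec y $ 3"
| "yaw_law (PID K0 K1 K2 K3 KI a0 a1 aI) c y =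
     - a1 * skew_vec_d c y $ 3 - a0 * skew_vec y $ 3 - aI * int_yaw y"

text \<open>A PD law gets integral states too, with a stable equation of their own. In this way both laws
live on the same state space and the linearization is stable in both cases.\<close>

fun int_pos_rate :: "gains \<Rightarrow> error_state \<Rightarrow> real^3" where
  "int_pos_rate (PD K0 K1 K2 K3 a0 a1) y = - int_pos y"
| "int_pos_rate (PID K0 K1 K2 K3 KI a0 a1 aI) y = err_pos y"

fun int_yaw_rate :: "gains \<Rightarrow> error_state \<Rightarrow> real" where
  "int_yaw_rate (PD K0 K1 K2 K3 a0 a1) y = - int_yaw y"
| "int_yaw_rate (PID K0 K1 K2 K3 KI a0 a1 aI) y = skew_vec y $ 3"

text \<open>The desired input in the body frame of the reference. Division of its components by the
thrust replaces the inverse of \<open>B\<^sub>0\<close>.\<close>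

definition body_input :: "gains \<Rightarrow> real \<Rightarrow> reference_data \<Rightarrow> error_state \<Rightarrow> real^3" where
  "body_input G ke c y = transpose (ref_att c) *v (pos_law G ke c y - drift ke c y *v e3)"

definition thrust_input :: "gains \<Rightarrow> real \<Rightarrow> reference_data \<Rightarrow> error_state \<Rightarrow> real" where
  "thrust_input G ke c y = body_input G ke c y $ 3"

definition new_input :: "gains \<Rightarrow> real \<Rightarrow> reference_data \<Rightarrow> error_state \<Rightarrow> real^3" where
  "new_input G ke c y = vector [- (body_input G ke c y $ 2) / ref_thrust c,
     body_input G ke c y $ 1 / ref_thrust c, yaw_law G c y]"

definition angacc_input :: "gains \<Rightarrow> real \<Rightarrow> reference_data \<Rightarrow> error_state \<Rightarrow> real^3" where
  "angacc_input G ke c y =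
     - cross3 (skew_vec_d c y) (ref_angvel c) - cross3 (skew_vec y) (ref_angacc c)
     + new_input G ke c y"

text \<open>The right side of the error equations is \<open>linear_field + quadratic_field\<close>. The feedback is linear in
the error state, hence only the attitude kinematics and the thrust vector contribute products of
errors.\<close>

definition linear_field :: "gains \<Rightarrow> real \<Rightarrow> reference_data \<Rightarrow> error_state \<Rightarrow> error_state" where
  "linear_field G ke c y =
     (commutator (err_att y) (hat (ref_angvel c)) + hat (err_angvel y),
      angacc_input G ke c y,
      err_vel y,
      (err_thrust y *\<^sub>R ref_att c + thr_att c ** err_att y) *v e3,
      err_thrust_rate y,
      thrust_input G ke c y,
      int_pos_rate G y,
      int_yaw_rate G y)"

text \<open>Written as a bilinear map, so that the difference of its values at two states can be polarized.\<close>

definition quadratic_field :: "reference_data \<Rightarrow> error_state \<Rightarrow> error_state \<Rightarrow> error_state" where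
  "quadratic_field c y y' =
     (err_att y ** hat (err_angvel y'), 0, 0,
      (err_thrust y *\<^sub>R (ref_att c ** err_att y')) *v e3, 0, 0, 0, 0)"

type_synonym normal_state =
  "(real^3) \<times> (real^3) \<times> (real^3) \<times> (real^3) \<times> (real^3) \<times> real \<times> real \<times> real"

definition normal_coords :: "real \<Rightarrow> reference_data \<Rightarrow> error_state \<Rightarrow> normal_state" where
  "normal_coords ke c y =
     (int_pos y, err_pos y, err_vel y, acc_err c y, jerk_err ke c y,
      int_yaw y, skew_vec y $ 3, skew_vec_d c y $ 3)"

fun companion :: "gains \<Rightarrow> normal_state \<Rightarrow> normal_state" where
  "companion (PD K0 K1 K2 K3 a0 a1) = (\<lambda>(xI, x0, x1, x2, x3, zI, z0, z1).
     (- xI, x1, x2, x3, - (K3 *v x3) - K2 *v x2 - K1 *v x1 - K0 *v x0,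
      - zI, z1, - a1 * z1 - a0 * z0))"
| "companion (PID K0 K1 K2 K3 KI a0 a1 aI) = (\<lambda>(xI, x0, x1, x2, x3, zI, z0, z1).
     (x0, x1, x2, x3, - (K3 *v x3) - K2 *v x2 - K1 *v x1 - K0 *v x0 - KI *v xI,
      z0, z1, - a1 * z1 - a0 * z0 - aI * zI))"

text \<open>What the approximate derivatives in the feedback law miss. The three arguments stand for the
quantities in \<open>defect\<close>, all of second order; the residual itself is linear in them.\<close>

definition residual ::
    "real \<Rightarrow> reference_data \<Rightarrow> (real^3^3) \<times> (real^3^3) \<times> (real^3^3) \<Rightarrow> normal_state" where
  "residual ke c q = (case q of (P, S, Q) \<Rightarrow>
     let ek = skew_part P; es = sym_part P + (2 * ke) *\<^sub>R S in
     (0, 0, (ref_att c ** Q) *v e3, (thr_att c ** (ek + es)) *v e3,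
      (thr_att c ** hat (cross3 (vee ek) (ref_angvel c)) + thr_att_d c ** (es + ek)
       + thr_att c ** (commutator es (hat (ref_angvel c)) - (2 * ke) *\<^sub>R es)) *v e3,
      0, vee ek $ 3, cross3 (vee ek) (ref_angvel c) $ 3))"

lemma error_parts_linear: "linear sym_err" "linear skew_err" "linear skew_vec"
  by (intro linearI; simp add: sym_err_def skew_err_def skew_vec_def parts_linear_simps)+

lemmas error_parts_linear_simps = error_parts_linear[THEN linear_add] error_parts_linear[THEN linear_scale]

lemma error_rates_linear: "linear (sym_err_d ke c)" "linear (skew_vec_d c)" "linear (acc_err c)"
  by (intro linearI; simp add: sym_err_d_def skew_vec_d_def acc_err_def parts_linear_simps
      error_parts_linear_simps algebra_simps)+

lemmas error_rates_linear_simps = error_rates_linear[THEN linear_add] error_rates_linear[THEN linear_scale]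

lemma jerk_err_linear: "linear (jerk_err ke c)"
  by (intro linearI; simp add: jerk_err_def parts_linear_simps
      error_parts_linear_simps error_rates_linear_simps algebra_simps)

lemma drift_linear: "linear (drift ke c)"
  by (intro linearI; simp add: drift_def parts_linear_simps
      error_parts_linear_simps error_rates_linear_simps algebra_simps)

lemma laws_linear: "linear (pos_law G ke c)" "linear (yaw_law G c)" 
  "linear (int_pos_rate G)" "linear (int_yaw_rate G)"
  by (cases G; intro linearI; simp add: parts_linear_simps error_parts_linear_simps
      error_rates_linear_simps jerk_err_linear[THEN linear_add] jerk_err_linear[THEN linear_scale] algebra_simps)+

lemmas laws_linear_simps = laws_linear[THEN linear_add] laws_linear[THEN linear_scale]

lemma body_input_linear: "linear (body_input G ke c)"
  by (intro linearI; simp add: body_input_def parts_linear_simps laws_linear_simps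
      drift_linear[THEN linear_add] drift_linear[THEN linear_scale] algebra_simps)

lemma new_input_linear: "linear (new_input G ke c)"
  by (intro linearI; simp add: new_input_def laws_linear_simps body_input_linear[THEN linear_add]
      body_input_linear[THEN linear_scale] vec_eq_iff forall_3 add_divide_distrib diff_divide_distrib algebra_simps)

lemma linear_linear_field: "linear (linear_field G ke c)"
  by (intro linearI; simp add: linear_field_def angacc_input_def thrust_input_def
      parts_linear_simps error_rates_linear_simps error_parts_linear_simps laws_linear_simps
      body_input_linear[THEN linear_add] body_input_linear[THEN linear_scale]
      new_input_linear[THEN linear_add] new_input_linear[THEN linear_scale] algebra_simps)

lemma linear_normal_coords: "linear (normal_coords ke c)"
  by (intro linearI; simp add: normal_coords_def error_rates_linear_simps error_parts_linear_simps
      jerk_err_linear[THEN linear_add] jerk_err_linear[THEN linear_scale])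

lemma bilinear_quadratic_field: "bilinear (quadratic_field c)"
  unfolding bilinear_def
  by (intro conjI allI linearI; simp add: quadratic_field_def parts_linear_simps algebra_simps)

lemma linear_companion: "linear (companion G)"
  by (cases G; intro linearI; simp add: case_prod_unfold parts_linear_simps algebra_simps)

lemma residual_scaleR: "residual ke c (r *\<^sub>R q) = r *\<^sub>R residual ke c q"
  by (cases q rule: prod_cases3) (simp add: residual_def Let_def parts_linear_simps algebra_simps)

context
  fixes S :: "'s::topological_space set" and c :: "'s \<Rightarrow> reference_data" and y :: "'s \<Rightarrow> error_state"
  assumes cont_c: "continuous_on S c" and cont_y: "continuous_on S y"
begin

lemma continuous_on_error_parts:
  "continuous_on S (\<lambda>s. sym_err (y s))" "continuous_on S (\<lambda>s. skew_err (y s))"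
  "continuous_on S (\<lambda>s. skew_vec (y s))"
  unfolding sym_err_def skew_err_def skew_vec_def by (intro continuous_intros cont_y)+

lemma continuous_on_ref_parts:
  "continuous_on S (\<lambda>s. att_d (c s))" "continuous_on S (\<lambda>s. att_dd (c s))"
  "continuous_on S (\<lambda>s. thr_att (c s))" "continuous_on S (\<lambda>s. thr_att_d (c s))"
  "continuous_on S (\<lambda>s. thr_att_dd (c s))"
  unfolding att_d_def att_dd_def thr_att_def thr_att_d_def thr_att_dd_def
  by (intro continuous_intros cont_c)+

lemma continuous_on_error_rates:
  "continuous_on S (\<lambda>s. sym_err_d ke (c s) (y s))" "continuous_on S (\<lambda>s. skew_vec_d (c s) (y s))"
  "continuous_on S (\<lambda>s. acc_err (c s) (y s))"
  unfolding sym_err_d_def skew_vec_d_def acc_err_def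
  by (intro continuous_intros cont_y cont_c continuous_on_ref_parts continuous_on_error_parts)+

lemma continuous_on_jerk_err: "continuous_on S (\<lambda>s. jerk_err ke (c s) (y s))"
  unfolding jerk_err_def
  by (intro continuous_intros cont_y cont_c continuous_on_ref_parts continuous_on_error_parts
      continuous_on_error_rates)

lemma continuous_on_drift: "continuous_on S (\<lambda>s. drift ke (c s) (y s))"
  unfolding drift_def
  by (intro continuous_intros cont_y cont_c continuous_on_ref_parts continuous_on_error_parts
      continuous_on_error_rates)

lemma continuous_on_laws:
  "continuous_on S (\<lambda>s. pos_law G ke (c s) (y s))" "continuous_on S (\<lambda>s. yaw_law G (c s) (y s))"
  "continuous_on S (\<lambda>s. int_pos_rate G (y s))" "continuous_on S (\<lambda>s. int_yaw_rate G (y s))"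
  by (cases G; simp; intro continuous_intros cont_y cont_c continuous_on_error_parts
      continuous_on_error_rates continuous_on_jerk_err)+

lemma continuous_on_body_input: "continuous_on S (\<lambda>s. body_input G ke (c s) (y s))"
  unfolding body_input_def
  by (intro continuous_intros cont_c continuous_on_laws continuous_on_drift)

lemma continuous_on_new_input:
  assumes "\<And>s. s \<in> S \<Longrightarrow> ref_thrust (c s) \<noteq> 0"
  shows "continuous_on S (\<lambda>s. new_input G ke (c s) (y s))"
  unfolding new_input_def
  by (intro continuous_intros ballI cont_c continuous_on_body_input continuous_on_laws assms)

lemma continuous_on_linear_field:
  assumes "\<And>s. s \<in> S \<Longrightarrow> ref_thrust (c s) \<noteq> 0"
  shows "continuous_on S (\<lambda>s. linear_field G ke (c s) (y s))"
  unfolding linear_field_def angacc_input_def thrust_input_def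
  by (intro continuous_intros ballI cont_c cont_y continuous_on_body_input continuous_on_laws
      continuous_on_new_input continuous_on_error_parts continuous_on_error_rates
      continuous_on_ref_parts assms)

lemma continuous_on_normal_coords: "continuous_on S (\<lambda>s. normal_coords ke (c s) (y s))"
  unfolding normal_coords_def
  by (intro continuous_intros cont_y continuous_on_error_parts continuous_on_error_rates
      continuous_on_jerk_err)

lemma continuous_on_quadratic_field:
  assumes "continuous_on S y'"
  shows "continuous_on S (\<lambda>s. quadratic_field (c s) (y s) (y' s))"
  unfolding quadratic_field_def by (intro continuous_intros cont_c cont_y assms)

end

lemma continuous_on_residual:
  assumes "continuous_on S c" "continuous_on S q"
  shows "continuous_on S (\<lambda>s. residual ke (c s) (q s))"
  unfolding residual_def case_prod_unfold Let_def
  by (intro continuous_intros assms continuous_on_ref_parts[OF assms(1) continuous_on_const])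

section \<open>Stability of the linearized closed loop\<close>

definition annihilates :: "'a::comm_ring_1 poly \<Rightarrow> (nat \<Rightarrow> 'a) \<Rightarrow> bool" where
  "annihilates p a \<longleftrightarrow> (\<forall>n. shift_act p a n = 0)"

lemma annihilates_add: "annihilates p a \<Longrightarrow> annihilates p b \<Longrightarrow> annihilates p (\<lambda>n. a n + b n)"
  by (simp add: annihilates_def shift_act_seq_add)

lemma annihilates_mult_right: "annihilates p a \<Longrightarrow> annihilates p (\<lambda>n. a n * c)"
  using shift_act_seq_mult[of p c a] by (simp add: annihilates_def mult.commute)

lemma annihilates_shift: "annihilates p a \<Longrightarrow> (\<And>n. b n = a (Suc n)) \<Longrightarrow> annihilates p b"
proof -
  assume "annihilates p a" and "\<And>n. b n = a (Suc n)"
  then have "b = (\<lambda>n. a (Suc n))" "annihilates p a" by auto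
  then show ?thesis by (simp add: annihilates_def shift_act_seq_Suc)
qed

lemma annihilates_dvd: "annihilates p a \<Longrightarrow> p dvd q \<Longrightarrow> annihilates q a"
  by (auto simp: annihilates_def intro: shift_act_dvd_zero)

lemma annihilates_det:
  fixes P :: "'a::comm_ring_1 poly^3^3"
  assumes "\<And>j n. (\<Sum>l\<in>UNIV. shift_act (P$j$l) (a l) n) = 0"
  shows "annihilates (det P) (a k)"
  using shift_act_det[OF assms] by (simp add: annihilates_def)

lemma annihilates_inner_vec:
  fixes x :: "nat \<Rightarrow> real^3"
  assumes "\<And>l. annihilates p (\<lambda>n. x n $ l)"
  shows "annihilates p (\<lambda>n. x n \<bullet> b)"
  by (simp add: inner_vec_def sum_3 annihilates_add annihilates_mult_right assms)

text \<open>It suffices to annihilate every component of the orbits of the companion map by one common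
Hurwitz polynomial.\<close>

lemma companion_lyapunov_form:
  assumes "hurwitz p"
    and "\<And>v l. annihilates p (\<lambda>n. fst ((companion G ^^ n) v) $ l)"
      "\<And>v l. annihilates p (\<lambda>n. fst (snd ((companion G ^^ n) v)) $ l)"
      "\<And>v l. annihilates p (\<lambda>n. fst (snd (snd ((companion G ^^ n) v))) $ l)"
      "\<And>v l. annihilates p (\<lambda>n. fst (snd (snd (snd ((companion G ^^ n) v)))) $ l)"
      "\<And>v l. annihilates p (\<lambda>n. fst (snd (snd (snd (snd ((companion G ^^ n) v))))) $ l)"
      "\<And>v. annihilates p (\<lambda>n. fst (snd (snd (snd (snd (snd ((companion G ^^ n) v)))))))"
      "\<And>v. annihilates p (\<lambda>n. fst (snd (snd (snd (snd (snd (snd ((companion G ^^ n) v))))))))"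
      "\<And>v. annihilates p (\<lambda>n. snd (snd (snd (snd (snd (snd (snd ((companion G ^^ n) v))))))))"
  shows "\<exists>B \<alpha>. lyapunov_form (companion G) B \<alpha>"
proof (rule hurwitz_annihilator_imp_lyapunov_form[OF linear_companion assms(1)])
  fix v b :: normal_state
  have "annihilates p (\<lambda>n. (companion G ^^ n) v \<bullet> b)"
    unfolding inner_prod_def inner_real_def
    by (intro annihilates_add annihilates_inner_vec annihilates_mult_right assms)
  then show "shift_act p (\<lambda>n. (companion G ^^ n) v \<bullet> b) 0 = 0"
    by (simp add: annihilates_def)
qed

text \<open>The components of the position block are successive shifts of the first one, and the last
equation says that the matrix polynomial of the gains kills it. The two dummy integral states are
killed by \<open>\<lambda> + 1\<close>, the yaw states by a quadratic polynomial with positive coefficients.\<close>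

lemma companion_PD_lyapunov_form:
  assumes "admissible (PD K0 K1 K2 K3 a0 a1)"
  shows "\<exists>B \<alpha>. lyapunov_form (companion (PD K0 K1 K2 K3 a0 a1)) B \<alpha>"
proof -
  let ?G = "PD K0 K1 K2 K3 a0 a1"
  let ?P = "\<chi> i j. [:K0$i$j, K1$i$j, K2$i$j, K3$i$j, (mat 1 :: real^3^3)$i$j:]"
  let ?pz = "[:a0, a1, 1:]" and ?pI = "[:1, 1::real:]"
  let ?s = "\<lambda>v n. (companion ?G ^^ n) v"
  define xI where "xI v n = fst (?s v n)" for v n
  define x0 where "x0 v n = fst (snd (?s v n))" for v n
  define x1 where "x1 v n = fst (snd (snd (?s v n)))" for v n
  define x2 where "x2 v n = fst (snd (snd (snd (?s v n))))" for v n
  define x3 where "x3 v n = fst (snd (snd (snd (snd (?s v n)))))" for v n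
  define zI where "zI v n = fst (snd (snd (snd (snd (snd (?s v n))))))" for v n
  define z0 where "z0 v n = fst (snd (snd (snd (snd (snd (snd (?s v n)))))))" for v n
  define z1 where "z1 v n = snd (snd (snd (snd (snd (snd (snd (?s v n)))))))" for v n
  note components = xI_def x0_def x1_def x2_def x3_def zI_def z0_def z1_def
  have step: "xI v (Suc n) = - xI v n" "x0 v (Suc n) = x1 v n" "x1 v (Suc n) = x2 v n" "x2 v (Suc n) = x3 v n"
    "x3 v (Suc n) = - (K3 *v x3 v n) - K2 *v x2 v n - K1 *v x1 v n - K0 *v x0 v n"
    "zI v (Suc n) = - zI v n" "z0 v (Suc n) = z1 v n" "z1 v (Suc n) = - a1 * z1 v n - a0 * z0 v n" for v n
    by (simp_all add: components case_prod_unfold)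
  have x0_ann: "annihilates (det ?P) (\<lambda>n. x0 v n $ l)" for v l
  proof (rule annihilates_det[where a = "\<lambda>l n. x0 v n $ l"])
    show "(\<Sum>l\<in>UNIV. shift_act (?P$j$l) (\<lambda>n. x0 v n $ l) n) = 0" for j n
      using exhaust_3[of j]
      by (auto simp: shift_act_pCons step matrix_vector_mult_def sum_3 mat_def algebra_simps)
  qed
  have x1_ann: "annihilates (det ?P) (\<lambda>n. x1 v n $ l)" for v l
    by (rule annihilates_shift[OF x0_ann]) (simp add: step)
  have x2_ann: "annihilates (det ?P) (\<lambda>n. x2 v n $ l)" for v l
    by (rule annihilates_shift[OF x1_ann]) (simp add: step)
  have x3_ann: "annihilates (det ?P) (\<lambda>n. x3 v n $ l)" for v l
    by (rule annihilates_shift[OF x2_ann]) (simp add: step)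
  have integrals_ann: "annihilates ?pI (\<lambda>n. xI v n $ l)" "annihilates ?pI (zI v)" for v l
    by (simp_all add: annihilates_def shift_act_pCons step)
  have z0_ann: "annihilates ?pz (z0 v)" for v
    by (simp add: annihilates_def shift_act_pCons step)
  have z1_ann: "annihilates ?pz (z1 v)" for v
    by (rule annihilates_shift[OF z0_ann]) (simp add: step)
  let ?p = "det ?P * (?pI * ?pz)"
  have dvd: "det ?P dvd ?p" "?pI dvd ?p" "?pz dvd ?p"
    by (intro dvd_triv_left dvd_mult dvd_triv_right)+
  show ?thesis
  proof (rule companion_lyapunov_form)
    show "hurwitz ?p"
      using assms by (intro hurwitz_mult hurwitz_linear hurwitz_quadratic) auto
  qed (fold components, (rule annihilates_dvd[OF _ dvd(1)] annihilates_dvd[OF _ dvd(2)]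
      annihilates_dvd[OF _ dvd(3)],
      rule integrals_ann x0_ann x1_ann x2_ann x3_ann z0_ann z1_ann)+)
qed

text \<open>As in the case of a PD law, except that the chain of shifts now starts at the integral states.\<close>

lemma companion_PID_lyapunov_form:
  assumes "admissible (PID K0 K1 K2 K3 KI a0 a1 aI)"
  shows "\<exists>B \<alpha>. lyapunov_form (companion (PID K0 K1 K2 K3 KI a0 a1 aI)) B \<alpha>"
proof -
  let ?G = "PID K0 K1 K2 K3 KI a0 a1 aI"
  let ?P = "\<chi> i j. [:KI$i$j, K0$i$j, K1$i$j, K2$i$j, K3$i$j, (mat 1 :: real^3^3)$i$j:]"
  let ?pz = "[:aI, a0, a1, 1:]"
  let ?s = "\<lambda>v n. (companion ?G ^^ n) v"
  define xI where "xI v n = fst (?s v n)" for v n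
  define x0 where "x0 v n = fst (snd (?s v n))" for v n
  define x1 where "x1 v n = fst (snd (snd (?s v n)))" for v n
  define x2 where "x2 v n = fst (snd (snd (snd (?s v n))))" for v n
  define x3 where "x3 v n = fst (snd (snd (snd (snd (?s v n)))))" for v n
  define zI where "zI v n = fst (snd (snd (snd (snd (snd (?s v n))))))" for v n
  define z0 where "z0 v n = fst (snd (snd (snd (snd (snd (snd (?s v n)))))))" for v n
  define z1 where "z1 v n = snd (snd (snd (snd (snd (snd (snd (?s v n)))))))" for v n
  note components = xI_def x0_def x1_def x2_def x3_def zI_def z0_def z1_def
  have step: "xI v (Suc n) = x0 v n" "x0 v (Suc n) = x1 v n" "x1 v (Suc n) = x2 v n" "x2 v (Suc n) = x3 v n"
    "x3 v (Suc n) = - (K3 *v x3 v n) - K2 *v x2 v n - K1 *v x1 v n - K0 *v x0 v n - KI *v xI v n"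
    "zI v (Suc n) = z0 v n" "z0 v (Suc n) = z1 v n" "z1 v (Suc n) = - a1 * z1 v n - a0 * z0 v n - aI * zI v n" for v n
    by (simp_all add: components case_prod_unfold)
  have xI_ann: "annihilates (det ?P) (\<lambda>n. xI v n $ l)" for v l
  proof (rule annihilates_det[where a = "\<lambda>l n. xI v n $ l"])
    show "(\<Sum>l\<in>UNIV. shift_act (?P$j$l) (\<lambda>n. xI v n $ l) n) = 0" for j n
      using exhaust_3[of j]
      by (auto simp: shift_act_pCons step matrix_vector_mult_def sum_3 mat_def algebra_simps)
  qed
  have x0_ann: "annihilates (det ?P) (\<lambda>n. x0 v n $ l)" for v l
    by (rule annihilates_shift[OF xI_ann]) (simp add: step)
  have x1_ann: "annihilates (det ?P) (\<lambda>n. x1 v n $ l)" for v l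
    by (rule annihilates_shift[OF x0_ann]) (simp add: step)
  have x2_ann: "annihilates (det ?P) (\<lambda>n. x2 v n $ l)" for v l
    by (rule annihilates_shift[OF x1_ann]) (simp add: step)
  have x3_ann: "annihilates (det ?P) (\<lambda>n. x3 v n $ l)" for v l
    by (rule annihilates_shift[OF x2_ann]) (simp add: step)
  have zI_ann: "annihilates ?pz (zI v)" for v
    by (simp add: annihilates_def shift_act_pCons step)
  have z0_ann: "annihilates ?pz (z0 v)" for v
    by (rule annihilates_shift[OF zI_ann]) (simp add: step)
  have z1_ann: "annihilates ?pz (z1 v)" for v
    by (rule annihilates_shift[OF z0_ann]) (simp add: step)
  let ?p = "det ?P * ?pz"
  have dvd: "det ?P dvd ?p" "?pz dvd ?p"
    by (rule dvd_triv_left dvd_triv_right)+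
  show ?thesis
  proof (rule companion_lyapunov_form)
    show "hurwitz ?p"
      using assms by (intro hurwitz_mult) auto
  qed (fold components, (rule annihilates_dvd[OF _ dvd(1)] annihilates_dvd[OF _ dvd(2)],
      rule xI_ann x0_ann x1_ann x2_ann x3_ann zI_ann z0_ann z1_ann)+)
qed

lemma admissible_lyapunov_form:
  assumes "admissible G"
  shows "\<exists>B \<alpha>. lyapunov_form (companion G) B \<alpha>"
  using assms companion_PD_lyapunov_form companion_PID_lyapunov_form by (cases G) blast+

section \<open>The error in normal coordinates\<close>

text \<open>The bookkeeping behind \<open>jerk_err_deriv\<close>, for arbitrary matrices so that no definition is unfolded:
the left side is the term by term derivative, and the three groups on the right are the drift, the
contribution of the inputs, and the defects.\<close>

lemma jerk_deriv_algebra: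
  fixes A :: "real^3^3"
  shows "f' *\<^sub>R Rd + q *\<^sub>R R + (A ** hat (n + e) + Ad ** hat sd) + (f *\<^sub>R Rdd + f' *\<^sub>R Rd)
    + (Ad ** (Sd + es + (hat sd + ek)) + Add ** (Sy + Sk)) + (A ** (Sdd + X) + Ad ** Sd)
    = (2 * f') *\<^sub>R Rd + 2 *\<^sub>R (Ad ** (Sd + hat sd)) + f *\<^sub>R Rdd + Add ** (Sy + Sk) + A ** Sdd
      + (q *\<^sub>R R + A ** hat n) + (A ** hat e + Ad ** (es + ek) + A ** X)"
  unfolding double_scaleR scaleR_2 parts_linear_simps by simp

text \<open>The inputs are chosen to cancel the drift: \<open>f\<^sub>0 (u \<times> e\<^sub>3) + q e\<^sub>3\<close> is a bijective function of
\<open>(u\<^sub>2, u\<^sub>1, q)\<close> because \<open>f\<^sub>0\<close> does not vanish.\<close>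

lemma new_input_eq:
  assumes "orthogonal_matrix (ref_att c)" "ref_thrust c \<noteq> 0"
  shows "(thrust_input G ke c y *\<^sub>R ref_att c + thr_att c ** hat (new_input G ke c y)) *v e3
    = pos_law G ke c y - drift ke c y *v e3"
proof -
  let ?b = "body_input G ke c y"
  have "thrust_input G ke c y *\<^sub>R e3 + ref_thrust c *\<^sub>R (hat (new_input G ke c y) *v e3) = ?b"
    using assms(2)
    by (simp add: hat_mult_vec new_input_def thrust_input_def e3_def cross3_def vec_eq_iff forall_3)
  then have "(thrust_input G ke c y *\<^sub>R ref_att c + thr_att c ** hat (new_input G ke c y)) *v e3
      = ref_att c *v ?b"
    by (simp add: thr_att_def parts_linear_simps matrix_vector_mul_assoc[symmetric]
        matrix_vector_right_distrib[symmetric] flip: \<open>_ = ?b\<close>)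
  also have "\<dots> = pos_law G ke c y - drift ke c y *v e3"
    using assms(1) by (simp add: body_input_def matrix_vector_mul_assoc orthogonal_matrix_def
        del: transpose_matrix_vector)
  finally show ?thesis .
qed

text \<open>The amounts by which the true derivatives of the skew and symmetric parts of the attitude error
differ from the expressions used in the feedback law. The artificial damping with \<open>ke\<close> appears here as an
error that is linear in the symmetric part, which orthogonality makes quadratic.\<close>

definition "att_defect y = err_att y ** hat (err_angvel y)"
definition "skew_defect y = skew_part (att_defect y)"
definition "sym_defect ke y = sym_part (att_defect y) + (2 * ke) *\<^sub>R sym_err y"

definition defect :: "error_state \<Rightarrow> (real^3^3) \<times> (real^3^3) \<times> (real^3^3)" where
  "defect y = (att_defect y, sym_err y, err_thrust y *\<^sub>R err_att y)"

context
  fixes c :: "real \<Rightarrow> reference_data" and t :: real and S :: "real set"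
  assumes R: "((\<lambda>s. ref_att (c s)) has_vector_derivative att_d (c t)) (at t within S)"
    and W: "((\<lambda>s. ref_angvel (c s)) has_vector_derivative ref_angacc (c t)) (at t within S)"
    and Fr: "((\<lambda>s. ref_thrust (c s)) has_vector_derivative ref_thrust_rate (c t)) (at t within S)"
    and Fd: "((\<lambda>s. ref_thrust_rate (c s)) has_vector_derivative ref_thrust_acc (c t)) (at t within S)"
begin

lemma att_d_deriv: "((\<lambda>s. att_d (c s)) has_vector_derivative att_dd (c t)) (at t within S)"
  unfolding att_d_def
  by (rule has_vector_derivative_eq_rhs, (rule R W vector_derivative_rules)+)
    (simp add: att_dd_def att_d_def parts_linear_simps matrix_mul_assoc)

lemma thr_att_deriv: "((\<lambda>s. thr_att (c s)) has_vector_derivative thr_att_d (c t)) (at t within S)"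
  unfolding thr_att_def
  by (rule has_vector_derivative_eq_rhs, (rule R Fr vector_derivative_rules)+)
    (simp add: thr_att_d_def)

lemma thr_att_d_deriv: "((\<lambda>s. thr_att_d (c s)) has_vector_derivative thr_att_dd (c t)) (at t within S)"
  unfolding thr_att_d_def
  by (rule has_vector_derivative_eq_rhs, (rule R Fr Fd att_d_deriv vector_derivative_rules)+)
    (simp add: thr_att_dd_def double_scaleR)

lemmas ref_parts_deriv = att_d_deriv thr_att_deriv thr_att_d_deriv

end

lemma error_field_components:
  assumes y: "(y has_vector_derivative
    linear_field G ke (c t) (y t) + quadratic_field (c t) (y t) (y t)) (at t within S)"
  shows
  "((\<lambda>s. err_att (y s)) has_vector_derivative
    commutator (err_att (y t)) (hat (ref_angvel (c t))) + hat (err_angvel (y t)) + att_defect (y t)) (at t within S)"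
  "((\<lambda>s. err_angvel (y s)) has_vector_derivative angacc_input G ke (c t) (y t)) (at t within S)"
  "((\<lambda>s. err_pos (y s)) has_vector_derivative err_vel (y t)) (at t within S)"
  "((\<lambda>s. err_vel (y s)) has_vector_derivative
    (err_thrust (y t) *\<^sub>R ref_att (c t) + thr_att (c t) ** err_att (y t)) *v e3
    + (err_thrust (y t) *\<^sub>R (ref_att (c t) ** err_att (y t))) *v e3) (at t within S)"
  "((\<lambda>s. err_thrust (y s)) has_vector_derivative err_thrust_rate (y t)) (at t within S)"
  "((\<lambda>s. err_thrust_rate (y s)) has_vector_derivative thrust_input G ke (c t) (y t)) (at t within S)"
  "((\<lambda>s. int_pos (y s)) has_vector_derivative int_pos_rate G (y t)) (at t within S)"
  "((\<lambda>s. int_yaw (y s)) has_vector_derivative int_yaw_rate G (y t)) (at t within S)"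
proof -
  note fst' = bounded_linear.has_vector_derivative[OF bounded_linear_fst]
  note snd' = bounded_linear.has_vector_derivative[OF bounded_linear_snd]
  note defs = linear_field_def quadratic_field_def att_defect_def
  show "((\<lambda>s. err_att (y s)) has_vector_derivative
    commutator (err_att (y t)) (hat (ref_angvel (c t))) + hat (err_angvel (y t)) + att_defect (y t)) (at t within S)"
    using fst'[OF y] by (simp add: defs)
  note 1 = snd'[OF y]
  show "((\<lambda>s. err_angvel (y s)) has_vector_derivative angacc_input G ke (c t) (y t)) (at t within S)"
    using fst'[OF 1] by (simp add: defs)
  note 2 = snd'[OF 1]
  show "((\<lambda>s. err_pos (y s)) has_vector_derivative err_vel (y t)) (at t within S)"
    using fst'[OF 2] by (simp add: defs)
  note 3 = snd'[OF 2]
  show "((\<lambda>s. err_vel (y s)) has_vector_derivative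
    (err_thrust (y t) *\<^sub>R ref_att (c t) + thr_att (c t) ** err_att (y t)) *v e3
    + (err_thrust (y t) *\<^sub>R (ref_att (c t) ** err_att (y t))) *v e3) (at t within S)"
    using fst'[OF 3] by (simp add: defs)
  note 4 = snd'[OF 3]
  show "((\<lambda>s. err_thrust (y s)) has_vector_derivative err_thrust_rate (y t)) (at t within S)"
    using fst'[OF 4] by (simp add: defs)
  note 5 = snd'[OF 4]
  show "((\<lambda>s. err_thrust_rate (y s)) has_vector_derivative thrust_input G ke (c t) (y t)) (at t within S)"
    using fst'[OF 5] by (simp add: defs)
  note 6 = snd'[OF 5]
  show "((\<lambda>s. int_pos (y s)) has_vector_derivative int_pos_rate G (y t)) (at t within S)"
    using fst'[OF 6] by (simp add: defs)
  show "((\<lambda>s. int_yaw (y s)) has_vector_derivative int_yaw_rate G (y t)) (at t within S)"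
    using snd'[OF 6] by (simp add: defs)
qed

context
  fixes c :: "real \<Rightarrow> reference_data" and y :: "real \<Rightarrow> error_state" and t :: real and S :: "real set"
    and G :: gains and ke :: real
  assumes orth: "orthogonal_matrix (ref_att (c t))" and thrust: "ref_thrust (c t) \<noteq> 0"
    and R: "((\<lambda>s. ref_att (c s)) has_vector_derivative att_d (c t)) (at t within S)"
    and W: "((\<lambda>s. ref_angvel (c s)) has_vector_derivative ref_angacc (c t)) (at t within S)"
    and Fr: "((\<lambda>s. ref_thrust (c s)) has_vector_derivative ref_thrust_rate (c t)) (at t within S)"
    and Fd: "((\<lambda>s. ref_thrust_rate (c s)) has_vector_derivative ref_thrust_acc (c t)) (at t within S)"
    and y: "(y has_vector_derivative
      linear_field G ke (c t) (y t) + quadratic_field (c t) (y t) (y t)) (at t within S)"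
begin

lemmas err_deriv = error_field_components[where c = c and y = y and t = t, OF y]

lemmas ref_parts_deriv' = ref_parts_deriv[OF R W Fr Fd]

lemma sym_err_deriv:
  "((\<lambda>s. sym_err (y s)) has_vector_derivative sym_err_d ke (c t) (y t) + sym_defect ke (y t)) (at t within S)"
  unfolding sym_err_def
  by (rule has_vector_derivative_eq_rhs, (rule err_deriv vector_derivative_rules)+)
    (simp add: sym_err_d_def sym_defect_def parts_linear_simps sym_part_hat sym_part_commutator_hat sym_err_def)

lemma skew_err_deriv:
  "((\<lambda>s. skew_err (y s)) has_vector_derivative hat (skew_vec_d (c t) (y t)) + skew_defect (y t)) (at t within S)"
  unfolding skew_err_def
  by (rule has_vector_derivative_eq_rhs, (rule err_deriv vector_derivative_rules)+)
    (simp add: skew_vec_d_def skew_vec_def skew_err_def skew_defect_def parts_linear_simps skew_part_hat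
      skew_part_commutator_hat hat_cross3 hat_vee_skew_part)

lemma skew_vec_deriv:
  "((\<lambda>s. skew_vec (y s)) has_vector_derivative skew_vec_d (c t) (y t) + vee (skew_defect (y t))) (at t within S)"
  unfolding skew_vec_def
  by (rule has_vector_derivative_eq_rhs, (rule skew_err_deriv vector_derivative_rules)+)
    (simp add: parts_linear_simps vee_hat)

lemma skew_vec_d_deriv:
  "((\<lambda>s. skew_vec_d (c s) (y s)) has_vector_derivative
    new_input G ke (c t) (y t) + cross3 (vee (skew_defect (y t))) (ref_angvel (c t))) (at t within S)"
  unfolding skew_vec_d_def
  by (rule has_vector_derivative_eq_rhs, (rule skew_vec_deriv err_deriv W vector_derivative_rules)+)
    (simp add: angacc_input_def parts_linear_simps skew_vec_d_def algebra_simps)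

lemma sym_err_d_deriv:
  "((\<lambda>s. sym_err_d ke (c s) (y s)) has_vector_derivative
    commutator (sym_err_d ke (c t) (y t)) (hat (ref_angvel (c t)))
    + commutator (sym_err (y t)) (hat (ref_angacc (c t))) - (2 * ke) *\<^sub>R sym_err_d ke (c t) (y t)
    + (commutator (sym_defect ke (y t)) (hat (ref_angvel (c t))) - (2 * ke) *\<^sub>R sym_defect ke (y t))) (at t within S)"
  unfolding sym_err_d_def
  by (rule has_vector_derivative_eq_rhs, (rule sym_err_deriv W vector_derivative_rules)+)
    (simp add: parts_linear_simps sym_err_d_def algebra_simps)

lemma acc_err_deriv:
  "((\<lambda>s. acc_err (c s) (y s)) has_vector_derivative
    jerk_err ke (c t) (y t) + (thr_att (c t) ** (skew_defect (y t) + sym_defect ke (y t))) *v e3) (at t within S)"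
  unfolding acc_err_def
  by (rule has_vector_derivative_eq_rhs,
      (rule sym_err_deriv skew_err_deriv err_deriv R ref_parts_deriv' vector_derivative_rules)+)
    (simp add: parts_linear_simps jerk_err_def algebra_simps)

lemma jerk_err_deriv:
  "((\<lambda>s. jerk_err ke (c s) (y s)) has_vector_derivative
    pos_law G ke (c t) (y t)
    + (thr_att (c t) ** hat (cross3 (vee (skew_defect (y t))) (ref_angvel (c t)))
       + thr_att_d (c t) ** (sym_defect ke (y t) + skew_defect (y t))
       + thr_att (c t) ** (commutator (sym_defect ke (y t)) (hat (ref_angvel (c t))) - (2 * ke) *\<^sub>R sym_defect ke (y t))) *v e3)
    (at t within S)"
proof -
  have law: "pos_law G ke (c t) (y t) = drift ke (c t) (y t) *v e3
    + (thrust_input G ke (c t) (y t) *\<^sub>R ref_att (c t) + thr_att (c t) ** hat (new_input G ke (c t) (y t))) *v e3"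
    by (simp add: new_input_eq[OF orth thrust])
  show ?thesis
    unfolding jerk_err_def law
    by (rule has_vector_derivative_eq_rhs,
        (rule sym_err_deriv skew_err_deriv sym_err_d_deriv skew_vec_d_deriv err_deriv R
          ref_parts_deriv' vector_derivative_rules)+)
      (simp only: drift_def jerk_deriv_algebra matrix_zero_right add_0_left matrix_vector_mult_add_rdistrib)
qed

text \<open>In these coordinates the time-varying error equations have a constant linear part.\<close>

lemma normal_coords_deriv:
  "((\<lambda>s. normal_coords ke (c s) (y s)) has_vector_derivative
    companion G (normal_coords ke (c t) (y t))
    + residual ke (c t) (defect (y t))) (at t within S)"
proof -
  note comp = bounded_linear.has_vector_derivative[OF bounded_linear_vec_nth]
  have err: "err_att (y t) = skew_err (y t) + sym_err (y t)"
    using sym_part_plus_skew_part[of "err_att (y t)"] by (simp add: sym_err_def skew_err_def add.commute)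
  have vel: "err_thrust (y t) *\<^sub>R (ref_att (c t) *v e3) + thr_att (c t) ** err_att (y t) *v e3
      = acc_err (c t) (y t)"
    by (subst err) (simp add: acc_err_def parts_linear_simps)
  show ?thesis
    unfolding normal_coords_def
    by (rule has_vector_derivative_eq_rhs,
        (rule has_vector_derivative_Pair err_deriv acc_err_deriv jerk_err_deriv comp skew_vec_deriv
          skew_vec_d_deriv)+)
      (cases G; simp add: residual_def defect_def Let_def parts_linear_simps vel new_input_def
        skew_defect_def sym_defect_def)
qed

end

section \<open>Local exponential decay\<close>

lemma norm_fst_le_norm: "norm (fst p) \<le> norm p"
  and norm_snd_le_norm: "norm (snd p) \<le> norm p"
  for p :: "'a::real_normed_vector \<times> 'b::real_normed_vector"
  using dist_fst_le[of p 0] dist_snd_le[of p 0] by simp_all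

definition reference_set :: "real \<Rightarrow> real \<Rightarrow> reference_data set" where
  "reference_set \<delta> b =
     {R. orthogonal_matrix R} \<times> cball 0 b \<times> cball 0 b \<times> {\<delta>..b} \<times> cball 0 b \<times> cball 0 b"

lemma compact_reference_set: "compact (reference_set \<delta> b)"
  unfolding reference_set_def by (intro compact_Times compact_orthogonal_matrices compact_cball compact_Icc)

lemma reference_setD:
  assumes "c \<in> reference_set \<delta> b"
  shows "orthogonal_matrix (ref_att c)" "\<delta> \<le> ref_thrust c"
  using assms by (auto simp: reference_set_def)

text \<open>\<open>a e\<^sub>3\<close> is orthogonal to \<open>f (z \<times> e\<^sub>3)\<close>, which determines the first two components of \<open>z\<close>.\<close>

lemma thrust_direction_inj:
  assumes "orthogonal_matrix R" "f \<noteq> 0" and zero: "(a *\<^sub>R R + (f *\<^sub>R R) ** hat z) *v e3 = 0"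
  shows "a = 0" "z$1 = 0" "z$2 = 0"
proof -
  have "R *v (a *\<^sub>R e3 + f *\<^sub>R cross3 z e3) = 0"
    using zero by (simp add: parts_linear_simps matrix_vector_mul_assoc[symmetric] hat_mult_vec)
  then have "transpose R *v (R *v (a *\<^sub>R e3 + f *\<^sub>R cross3 z e3)) = 0" by simp
  then have "a *\<^sub>R e3 + f *\<^sub>R cross3 z e3 = 0"
    using assms(1) by (simp add: matrix_vector_mul_assoc orthogonal_matrix del: transpose_matrix_vector)
  then show "a = 0" "z$1 = 0" "z$2 = 0"
    using assms(2) by (simp_all add: e3_def cross3_def vec_eq_iff forall_3)
qed

text \<open>The symmetric part of the attitude error is added as a separate datum, because the normal
coordinates see it only in combination with other terms. Once it vanishes, \<open>acc_err\<close> determines the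
thrust error and two components of the skew part, \<open>jerk_err\<close> does the same for the rates, and
the third component of the skew part and of its rate are coordinates themselves.\<close>

lemma normal_coords_inj:
  assumes "orthogonal_matrix (ref_att c)" "ref_thrust c \<noteq> 0"
    and zero: "normal_coords ke c y = 0" "sym_err y = 0"
  shows "y = 0"
proof -
  have comps: "int_pos y = 0" "err_pos y = 0" "err_vel y = 0" "acc_err c y = 0" "jerk_err ke c y = 0"
    "int_yaw y = 0" "skew_vec y $ 3 = 0" "skew_vec_d c y $ 3 = 0"
    using zero(1) by (simp_all add: normal_coords_def prod_eq_iff)
  have hat_skew: "skew_err y = hat (skew_vec y)"
    by (simp add: skew_vec_def skew_err_def hat_vee_skew_part)
  have sd: "sym_err_d ke c y = 0" by (simp add: sym_err_d_def zero(2) parts_linear_simps)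
  have "(err_thrust y *\<^sub>R ref_att c + (ref_thrust c *\<^sub>R ref_att c) ** hat (skew_vec y)) *v e3 = 0"
    using comps(4) by (simp add: acc_err_def zero(2) thr_att_def hat_skew parts_linear_simps)
  from thrust_direction_inj[OF assms(1,2) this] comps(7)
  have 1: "err_thrust y = 0" "skew_vec y = 0" by (simp_all add: vec_eq_iff forall_3)
  then have skew: "skew_err y = 0" by (simp add: hat_skew parts_linear_simps)
  have "(err_thrust_rate y *\<^sub>R ref_att c + (ref_thrust c *\<^sub>R ref_att c) ** hat (skew_vec_d c y)) *v e3 = 0"
    using comps(5) by (simp add: jerk_err_def zero(2) thr_att_def 1 skew sd parts_linear_simps)
  from thrust_direction_inj[OF assms(1,2) this] comps(8)
  have 2: "err_thrust_rate y = 0" "skew_vec_d c y = 0" by (simp_all add: vec_eq_iff forall_3)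
  have "err_att y = 0"
    using sym_part_plus_skew_part[of "err_att y"] zero(2) skew by (simp add: sym_err_def skew_err_def)
  moreover have "err_angvel y = 0"
    using 2(2) 1(2) by (simp add: skew_vec_d_def)
  ultimately show ?thesis using comps 1 2 by (simp add: prod_eq_iff)
qed

text \<open>This is where the attitude being a rotation enters the stability proof.\<close>

lemma sym_err_orthogonal:
  assumes "orthogonal_matrix (mat 1 + err_att y)"
  shows "sym_err y = - (1/2) *\<^sub>R (transpose (err_att y) ** err_att y)"
proof -
  let ?Z = "err_att y"
  have "transpose (mat 1 + ?Z) ** (mat 1 + ?Z) = mat 1"
    using assms by (simp add: orthogonal_matrix)
  then have "?Z + transpose ?Z + transpose ?Z ** ?Z = 0"
    by (simp add: parts_linear_simps algebra_simps)
  then have "?Z + transpose ?Z = - (transpose ?Z ** ?Z)"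
    by (simp add: eq_neg_iff_add_eq_0)
  then show ?thesis by (simp add: sym_err_def sym_part_def)
qed

lemma norm_err_le:
  "norm (err_att y) \<le> norm y" "norm (err_angvel y) \<le> norm y" "norm (err_pos y) \<le> norm y"
  "norm (err_vel y) \<le> norm y" "norm (err_thrust y) \<le> norm y"
  by (((rule norm_fst_le_norm norm_snd_le_norm)
      | (rule order_trans[OF norm_fst_le_norm] order_trans[OF norm_snd_le_norm]))+)

lemma defect_quadratic_bound:
  "\<exists>C>0. \<forall>y. orthogonal_matrix (mat 1 + err_att y) \<longrightarrow> norm (defect y) \<le> C * (norm y)\<^sup>2"
proof -
  obtain Km where Km: "Km > 0" "\<And>(A :: real^3^3) (B :: real^3^3). norm (A ** B) \<le> norm A * norm B * Km"
    using bounded_bilinear.pos_bounded[OF bounded_bilinear_matrix_mult] by blast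
  obtain Kh where Kh: "Kh > 0" "\<And>w. norm (hat w) \<le> norm w * Kh"
    using bounded_linear.pos_bounded[OF linear_hat[unfolded linear_conv_bounded_linear]] by blast
  obtain Kt where Kt: "Kt > 0" "\<And>A :: real^3^3. norm (transpose A) \<le> norm A * Kt"
    using bounded_linear.pos_bounded[OF linear_transpose[unfolded linear_conv_bounded_linear]] by blast
  have "norm (defect y) \<le> (Kh * Km + Kt * Km + 1) * (norm y)\<^sup>2"
    if "orthogonal_matrix (mat 1 + err_att y)" for y
  proof -
    let ?n = "norm y"
    have "norm (hat (err_angvel y)) \<le> norm (err_angvel y) * Kh" by (rule Kh(2))
    also have "\<dots> \<le> ?n * Kh" using Kh(1) by (intro mult_right_mono norm_err_le) simp
    finally have hat: "norm (hat (err_angvel y)) \<le> ?n * Kh" .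
    have "norm (err_att y ** hat (err_angvel y)) \<le> norm (err_att y) * norm (hat (err_angvel y)) * Km"
      by (rule Km(2))
    also have "\<dots> \<le> ?n * (?n * Kh) * Km"
      using Km(1) by (intro mult_right_mono mult_mono norm_err_le hat) auto
    finally have 1: "norm (err_att y ** hat (err_angvel y)) \<le> ?n * (?n * Kh) * Km" .
    have "norm (transpose (err_att y)) \<le> norm (err_att y) * Kt" by (rule Kt(2))
    also have "\<dots> \<le> ?n * Kt" using Kt(1) by (intro mult_right_mono norm_err_le) simp
    finally have tr: "norm (transpose (err_att y)) \<le> ?n * Kt" .
    have "norm (sym_err y) \<le> norm (transpose (err_att y) ** err_att y)"
      by (simp add: sym_err_orthogonal[OF that])
    also have "\<dots> \<le> norm (transpose (err_att y)) * norm (err_att y) * Km"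
      by (rule Km(2))
    also have "\<dots> \<le> (?n * Kt) * ?n * Km"
      using Km(1) Kt(1) by (intro mult_right_mono mult_mono norm_err_le tr) auto
    finally have 2: "norm (sym_err y) \<le> (?n * Kt) * ?n * Km" .
    have 3: "norm (err_thrust y *\<^sub>R err_att y) \<le> ?n * ?n"
      unfolding norm_scaleR using norm_err_le(1,5)[of y] by (intro mult_mono) auto
    have "norm (defect y) \<le> norm (err_att y ** hat (err_angvel y)) +
        (norm (sym_err y) + norm (err_thrust y *\<^sub>R err_att y))"
      unfolding defect_def att_defect_def by (rule order_trans[OF norm_Pair_le add_left_mono[OF norm_Pair_le]])
    also have "\<dots> \<le> ?n * (?n * Kh) * Km + ((?n * Kt) * ?n * Km + ?n * ?n)"
      by (intro add_mono 1 2 3)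
    finally show ?thesis by (simp add: power2_eq_square algebra_simps)
  qed
  moreover have "Kh * Km + Kt * Km + 1 > 0" using Km(1) Kh(1) Kt(1) by (simp add: add_pos_pos)
  ultimately show ?thesis by blast
qed

text \<open>The angular acceleration and the second derivative of the thrust act as inputs of the reference, of
which only continuity in time is asked.\<close>

definition reference_motion :: "real \<Rightarrow> real \<Rightarrow> (real \<Rightarrow> reference_data) \<Rightarrow> bool" where
  "reference_motion \<delta> b c \<longleftrightarrow> continuous_on {0..} c \<and> (\<forall>t\<ge>0. c t \<in> reference_set \<delta> b \<and>
     ((\<lambda>s. ref_att (c s)) has_vector_derivative att_d (c t)) (at t within {0..}) \<and>
     ((\<lambda>s. ref_angvel (c s)) has_vector_derivative ref_angacc (c t)) (at t within {0..}) \<and>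
     ((\<lambda>s. ref_thrust (c s)) has_vector_derivative ref_thrust_rate (c t)) (at t within {0..}) \<and>
     ((\<lambda>s. ref_thrust_rate (c s)) has_vector_derivative ref_thrust_acc (c t)) (at t within {0..}))"

definition error_motion ::
    "gains \<Rightarrow> real \<Rightarrow> (real \<Rightarrow> reference_data) \<Rightarrow> (real \<Rightarrow> error_state) \<Rightarrow> real \<Rightarrow> bool" where
  "error_motion G ke c y t \<longleftrightarrow>
     (y has_vector_derivative linear_field G ke (c t) (y t) + quadratic_field (c t) (y t) (y t))
       (at t within {0..})"

lemma normal_coords_motion:
  assumes "reference_motion \<delta> b c" "\<delta> > 0" "t \<ge> 0" "error_motion G ke c y t"
  shows "((\<lambda>s. normal_coords ke (c s) (y s)) has_vector_derivative
    companion G (normal_coords ke (c t) (y t)) + residual ke (c t) (defect (y t))) (at t within {0..})"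
proof -
  have "ref_thrust (c t) \<noteq> 0" "orthogonal_matrix (ref_att (c t))"
    using assms reference_setD[of "c t"] by (force simp: reference_motion_def)+
  moreover have "((\<lambda>s. ref_att (c s)) has_vector_derivative att_d (c t)) (at t within {0..})"
    "((\<lambda>s. ref_angvel (c s)) has_vector_derivative ref_angacc (c t)) (at t within {0..})"
    "((\<lambda>s. ref_thrust (c s)) has_vector_derivative ref_thrust_rate (c t)) (at t within {0..})"
    "((\<lambda>s. ref_thrust_rate (c s)) has_vector_derivative ref_thrust_acc (c t)) (at t within {0..})"
    using assms(1,3) by (simp_all add: reference_motion_def)
  ultimately show ?thesis
    using assms(4) unfolding error_motion_def by (intro normal_coords_deriv)
qed

text \<open>Exponential decay that may be used only up to a time before which the error is known to be
small. It covers trajectories that are not yet known to stay small.\<close>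

definition decay_bound :: "gains \<Rightarrow> real \<Rightarrow> real \<Rightarrow> real \<Rightarrow> real \<Rightarrow> real \<Rightarrow> real \<Rightarrow> bool" where
  "decay_bound G ke \<delta> b \<rho> m \<alpha> \<longleftrightarrow> \<rho> > 0 \<and> m \<ge> 1 \<and> \<alpha> > 0 \<and>
     (\<forall>c y T. reference_motion \<delta> b c \<and> T \<ge> 0 \<and>
      (\<forall>t\<in>{0..T}. error_motion G ke c y t \<and> norm (y t) \<le> \<rho> \<and> orthogonal_matrix (mat 1 + err_att (y t)))
      \<longrightarrow> norm (y T) \<le> m * exp (- \<alpha> * T) * norm (y 0))"

text \<open>Inside a small ball the error is bounded by a multiple of its normal coordinates \<open>Y\<close>, since
the symmetric part of the attitude error is quadratic. The residual is then at most a small multiple of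
\<open>|Y|\<close>, and the Lyapunov form still decays with half of its rate.\<close>

lemma local_decay:
  assumes "admissible G" "\<delta> > 0"
  shows "\<exists>\<rho> m \<alpha>. decay_bound G ke \<delta> b \<rho> m \<alpha>"
proof -
  let ?K = "reference_set \<delta> b"
  obtain B \<alpha> where "lyapunov_form (companion G) B \<alpha>"
    using admissible_lyapunov_form[OF assms(1)] by blast
  then have B: "bounded_bilinear B" "\<alpha> > 0" "\<And>u v. B u v = B v u" "\<And>v. (norm v)\<^sup>2 \<le> B v v"
    "\<And>v. B v (companion G v) \<le> - \<alpha> * B v v"
    by (auto simp: lyapunov_form_def)
  obtain Kb where Kb: "Kb > 0" "\<And>u v. norm (B u v) \<le> norm u * norm v * Kb"
    using bounded_bilinear.pos_bounded[OF B(1)] by blast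
  obtain C1 where C1: "C1 > 0" "\<And>c q. c \<in> ?K \<Longrightarrow> norm (residual ke c q) \<le> C1 * norm q"
  proof -
    have "\<exists>C>0. \<forall>c\<in>?K. \<forall>q. norm (residual ke c q) \<le> C * norm q"
      by (rule uniform_bound_homogeneous[OF compact_reference_set])
        (intro continuous_on_residual continuous_on_fst continuous_on_snd continuous_on_id
          residual_scaleR)+
    then show ?thesis using that by blast
  qed
  obtain C2 where C2: "C2 > 0"
    "\<And>y. orthogonal_matrix (mat 1 + err_att y) \<Longrightarrow> norm (defect y) \<le> C2 * (norm y)\<^sup>2"
    using defect_quadratic_bound by blast
  obtain C3 where C3: "C3 > 0"
    "\<And>c y. c \<in> ?K \<Longrightarrow> norm y \<le> C3 * norm (normal_coords ke c y, sym_err y)"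
  proof -
    have "\<exists>C>0. \<forall>c\<in>?K. \<forall>y. norm y \<le> C * norm (normal_coords ke c y, sym_err y)"
    proof (rule uniform_lower_bound_homogeneous[OF compact_reference_set])
      show "continuous_on (?K \<times> UNIV) (\<lambda>p. (normal_coords ke (fst p) (snd p), sym_err (snd p)))"
        by (intro continuous_on_Pair continuous_on_normal_coords continuous_on_error_parts(1)[of _ fst]
            continuous_on_fst continuous_on_snd continuous_on_id)
      show "(normal_coords ke c (s *\<^sub>R x), sym_err (s *\<^sub>R x)) = s *\<^sub>R (normal_coords ke c x, sym_err x)"
        for c s x
        by (simp add: linear_normal_coords[THEN linear_scale] error_parts_linear_simps)
      show "x = 0" if "c \<in> ?K" "(normal_coords ke c x, sym_err x) = 0" for c x
        using that reference_setD[OF that(1)] assms(2)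
        by (intro normal_coords_inj[of c ke x]) (auto simp: zero_prod_def)
    qed
    then show ?thesis using that by blast
  qed
  obtain C4 where C4: "C4 > 0" "\<And>c y. c \<in> ?K \<Longrightarrow> norm (normal_coords ke c y) \<le> C4 * norm y"
  proof -
    have "\<exists>C>0. \<forall>c\<in>?K. \<forall>y. norm (normal_coords ke c y) \<le> C * norm y"
      by (rule uniform_bound_homogeneous[OF compact_reference_set])
        (intro continuous_on_normal_coords continuous_on_fst continuous_on_snd continuous_on_id
          linear_normal_coords[THEN linear_scale])+
    then show ?thesis using that by blast
  qed
  (* The first bound lets the error be estimated by the normal coordinates, the second one lets the
     Lyapunov form absorb the residual. *)
  define \<rho> where "\<rho> = min (1 / (2 * C3 * C2)) (\<alpha> / (4 * Kb * C1 * C2 * C3))"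
  (* At least 1, and an upper bound for 2 C3 C4 sqrt Kb that avoids the square root. *)
  define m where "m = 1 + 2 * C3 * C4 * (1 + Kb)"
  have "\<rho> > 0" using B(2) Kb(1) C1(1) C2(1) C3(1) by (simp add: \<rho>_def)
  have \<rho>: "C3 * C2 * \<rho> \<le> 1 / 2" "4 * Kb * C1 * C2 * C3 * \<rho> \<le> \<alpha>"
  proof -
    have "\<rho> \<le> 1 / (2 * C3 * C2)" "\<rho> \<le> \<alpha> / (4 * Kb * C1 * C2 * C3)" by (simp_all add: \<rho>_def)
    then show "C3 * C2 * \<rho> \<le> 1 / 2" "4 * Kb * C1 * C2 * C3 * \<rho> \<le> \<alpha>"
      using Kb(1) C1(1) C2(1) C3(1) by (simp_all add: field_simps)
  qed
  have "m \<ge> 1" using Kb(1) C3(1) C4(1) by (simp add: m_def)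
  have main: "norm (y T) \<le> m * exp (- (\<alpha> / 2) * T) * norm (y 0)"
    if c: "reference_motion \<delta> b c" and "T \<ge> 0"
      and y: "\<And>t. t \<in> {0..T} \<Longrightarrow> error_motion G ke c y t \<and> norm (y t) \<le> \<rho> \<and>
        orthogonal_matrix (mat 1 + err_att (y t))" for c y T
  proof -
    define Y where "Y t = normal_coords ke (c t) (y t)" for t
    define N where "N t = residual ke (c t) (defect (y t))" for t
    have cK: "c t \<in> ?K" if "t \<in> {0..T}" for t
      using c that by (auto simp: reference_motion_def)
    have sq: "C2 * (norm (y t))\<^sup>2 \<le> C2 * \<rho> * norm (y t)" if "t \<in> {0..T}" for t
      using y[OF that] C2(1) by (simp add: power2_eq_square mult_right_mono)
    have yY: "norm (y t) \<le> 2 * C3 * norm (Y t)" if t: "t \<in> {0..T}" for t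
    proof -
      have "norm (sym_err (y t)) \<le> norm (defect (y t))"
        unfolding defect_def by (rule order_trans[OF norm_fst_le norm_snd_le])
      also have "\<dots> \<le> C2 * \<rho> * norm (y t)"
        using order_trans[OF C2(2) sq[OF t]] y[OF t] by blast
      finally have sym: "norm (sym_err (y t)) \<le> C2 * \<rho> * norm (y t)" .
      have "norm (y t) \<le> C3 * norm (Y t, sym_err (y t))"
        unfolding Y_def by (rule C3(2)[OF cK[OF t]])
      also have "\<dots> \<le> C3 * (norm (Y t) + C2 * \<rho> * norm (y t))"
        using C3(1) sym by (intro mult_left_mono order_trans[OF norm_Pair_le] add_mono) auto
      also have "\<dots> = C3 * norm (Y t) + (C3 * C2 * \<rho>) * norm (y t)" by (simp add: algebra_simps)
      also have "\<dots> \<le> C3 * norm (Y t) + 1 / 2 * norm (y t)"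
        using \<rho>(1) by (intro add_mono mult_right_mono) auto
      finally show ?thesis by simp
    qed
    have N: "norm (N t) \<le> (2 * C1 * C2 * C3 * \<rho>) * norm (Y t)" if t: "t \<in> {0..T}" for t
    proof -
      have "norm (N t) \<le> C1 * norm (defect (y t))" unfolding N_def by (rule C1(2)[OF cK[OF t]])
      also have "\<dots> \<le> C1 * (C2 * \<rho> * norm (y t))"
        using order_trans[OF C2(2) sq[OF t]] y[OF t] C1(1) by (intro mult_left_mono) auto
      also have "\<dots> \<le> C1 * (C2 * \<rho> * (2 * C3 * norm (Y t)))"
        using yY[OF t] C1(1) C2(1) \<open>\<rho> > 0\<close> by (intro mult_left_mono) auto
      finally show ?thesis by (simp add: algebra_simps)
    qed
    have Y': "(Y has_vector_derivative companion G (Y t) + N t) (at t within {0..})" if "t \<in> {0..T}" for t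
      unfolding Y_def N_def using normal_coords_motion[OF c assms(2)] y[OF that] that by auto
    define V where "V t = B (Y t) (Y t)" for t
    have V': "(V has_vector_derivative 2 * B (Y t) (companion G (Y t)) + 2 * B (Y t) (N t)) (at t within {0..})"
      if "t \<in> {0..T}" for t
      unfolding V_def
      by (rule has_vector_derivative_eq_rhs[OF bounded_bilinear.has_vector_derivative[OF B(1) Y'[OF that] Y'[OF that]]])
        (simp add: bounded_bilinear.add_right[OF B(1)] bounded_bilinear.add_left[OF B(1)] B(3)[of "companion G (Y t)"] B(3)[of "N t"])
    (* The form loses 2 alpha V to the linear part, and the residual gives back at most alpha V. *)
    have dec: "2 * B (Y t) (companion G (Y t)) + 2 * B (Y t) (N t) \<le> - \<alpha> * V t" if t: "t \<in> {0..T}" for t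
    proof -
      have "B (Y t) (N t) \<le> norm (Y t) * norm (N t) * Kb"
        using Kb(2)[of "Y t" "N t"] by simp
      also have "\<dots> \<le> norm (Y t) * ((2 * C1 * C2 * C3 * \<rho>) * norm (Y t)) * Kb"
        using N[OF t] Kb(1) by (intro mult_right_mono mult_left_mono) auto
      also have "\<dots> = (4 * Kb * C1 * C2 * C3 * \<rho>) * (norm (Y t))\<^sup>2 / 2"
        by (simp add: power2_eq_square algebra_simps)
      also have "\<dots> \<le> \<alpha> * V t / 2"
        unfolding V_def using \<rho>(2) B(2,4) by (intro divide_right_mono mult_mono) auto
      finally show ?thesis using B(5)[of "Y t"] by (simp add: V_def)
    qed
    have "(norm (Y T))\<^sup>2 \<le> V T" unfolding V_def by (rule B(4))
    also have "V T \<le> exp (- \<alpha> * T) * V 0"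
      using \<open>T \<ge> 0\<close> V' dec by (intro exponential_decay) auto
    also have "V 0 \<le> (C4 * norm (y 0))\<^sup>2 * Kb"
    proof -
      have "V 0 \<le> norm (Y 0) * norm (Y 0) * Kb" using Kb(2)[of "Y 0" "Y 0"] by (simp add: V_def)
      also have "\<dots> \<le> (C4 * norm (y 0)) * (C4 * norm (y 0)) * Kb"
        unfolding Y_def using C4 cK[of 0] \<open>T \<ge> 0\<close> Kb(1) by (intro mult_mono) auto
      finally show ?thesis by (simp add: power2_eq_square)
    qed
    finally have YT: "(norm (Y T))\<^sup>2 \<le> exp (- \<alpha> * T) * ((C4 * norm (y 0))\<^sup>2 * Kb)"
      by simp
    have "(norm (y T))\<^sup>2 \<le> (2 * C3 * norm (Y T))\<^sup>2"
      using yY[of T] \<open>T \<ge> 0\<close> by (intro power_mono) auto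
    also have "\<dots> \<le> (2 * C3)\<^sup>2 * (exp (- \<alpha> * T) * ((C4 * norm (y 0))\<^sup>2 * Kb))"
      using YT by (simp add: power_mult_distrib mult_left_mono)
    also have "\<dots> = ((2 * C3 * C4)\<^sup>2 * Kb) * (exp (- (\<alpha> / 2) * T) * norm (y 0))\<^sup>2"
    proof -
      have "exp (- \<alpha> * T) = (exp (- (\<alpha> / 2) * T))\<^sup>2"
        by (simp flip: exp_add add: power2_eq_square)
      then show ?thesis by (simp add: power_mult_distrib)
    qed
    also have "\<dots> \<le> m\<^sup>2 * (exp (- (\<alpha> / 2) * T) * norm (y 0))\<^sup>2"
    proof (rule mult_right_mono)
      have "(2 * C3 * C4)\<^sup>2 * Kb \<le> (2 * C3 * C4)\<^sup>2 * (1 + Kb)\<^sup>2"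
      proof (rule mult_left_mono)
        show "Kb \<le> (1 + Kb)\<^sup>2" using Kb(1) by (simp add: power2_eq_square algebra_simps)
      qed simp
      also have "\<dots> = (2 * C3 * C4 * (1 + Kb))\<^sup>2" by (simp add: power_mult_distrib)
      also have "\<dots> \<le> m\<^sup>2" using Kb(1) C3(1) C4(1) unfolding m_def by (intro power_mono) auto
      finally show "(2 * C3 * C4)\<^sup>2 * Kb \<le> m\<^sup>2" .
    qed simp
    also have "\<dots> = (m * exp (- (\<alpha> / 2) * T) * norm (y 0))\<^sup>2"
      unfolding power_mult_distrib by (rule mult.assoc[symmetric])
    finally have "(norm (y T))\<^sup>2 \<le> (m * exp (- (\<alpha> / 2) * T) * norm (y 0))\<^sup>2" .
    then show ?thesis
    proof (rule power2_le_imp_le)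
      show "0 \<le> m * exp (- (\<alpha> / 2) * T) * norm (y 0)" using \<open>m \<ge> 1\<close> by simp
    qed
  qed
  have "\<alpha> / 2 > 0" using B(2) by simp
  have "decay_bound G ke \<delta> b \<rho> m (\<alpha> / 2)"
    unfolding decay_bound_def
  proof (intro conjI allI impI)
    fix c y T
    assume "reference_motion \<delta> b c \<and> T \<ge> 0 \<and> (\<forall>t\<in>{0..T}. error_motion G ke c y t \<and>
      norm (y t) \<le> \<rho> \<and> orthogonal_matrix (mat 1 + err_att (y t)))"
    then show "norm (y T) \<le> m * exp (- (\<alpha> / 2) * T) * norm (y 0)"
      by (intro main[of c]) simp_all
  qed fact+
  then show ?thesis by blast
qed

section \<open>Solutions near the reference\<close>

text \<open>Passing from the error equation back to the attitude; together with
\<open>orthogonal_matrix_preserved\<close> it shows that the error equation stays on the rotation group.\<close>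

lemma attitude_error_deriv:
  assumes R0: "(R0 has_vector_derivative R0 t ** hat (w0 t)) (at t within S)"
    and E: "(E has_vector_derivative
      commutator (E t) (hat (w0 t)) + hat w + E t ** hat w) (at t within S)"
  shows "((\<lambda>s. R0 s + R0 s ** E s) has_vector_derivative (R0 t + R0 t ** E t) ** hat (w0 t + w)) (at t within S)"
  by (rule has_vector_derivative_eq_rhs, (rule R0 E vector_derivative_rules)+)
    (simp add: commutator_def parts_linear_simps matrix_mul_assoc)

lemma error_attitude_deriv:
  assumes R0: "(R0 has_vector_derivative R0 t ** hat (w0 t)) (at t within S)"
    and R: "(R has_vector_derivative R t ** hat (w0 t + w)) (at t within S)"
    and orth: "orthogonal_matrix (R0 t)"
  shows "((\<lambda>s. transpose (R0 s) ** (R s - R0 s)) has_vector_derivative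
    commutator (transpose (R0 t) ** (R t - R0 t)) (hat (w0 t)) + hat w
      + (transpose (R0 t) ** (R t - R0 t)) ** hat w) (at t within S)"
proof -
  have "transpose (R0 t) ** R0 t = mat 1" "hat (w0 t) ** transpose (R0 t) ** R0 t = hat (w0 t)"
    using orth by (simp_all add: orthogonal_matrix flip: matrix_mul_assoc)
  then show ?thesis
    by (intro has_vector_derivative_eq_rhs[OF bounded_bilinear.has_vector_derivative[OF bounded_bilinear_matrix_mult
          bounded_linear.has_vector_derivative[OF linear_transpose[unfolded linear_conv_bounded_linear] R0]
          has_vector_derivative_diff[OF R R0]]])
      (simp add: commutator_def parts_linear_simps matrix_mul_assoc matrix_transpose_mul transpose_hat)
qed

text \<open>An error that starts below \<open>\<rho> / m\<close> cannot reach \<open>\<rho>\<close>, because the decay estimate holds up to any time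
before which it has not left the ball.\<close>

lemma decay_bound_global:
  assumes bound: "decay_bound G ke \<delta> b \<rho> m \<alpha>" and c: "reference_motion \<delta> b c"
    and cont: "continuous_on {0..} y" and init: "norm (y 0) < \<rho> / m"
    and motion: "\<And>T. T \<ge> 0 \<Longrightarrow> (\<And>t. 0 \<le> t \<Longrightarrow> t \<le> T \<Longrightarrow> norm (y t) \<le> \<rho>) \<Longrightarrow>
      \<forall>t\<in>{0..T}. error_motion G ke c y t \<and> orthogonal_matrix (mat 1 + err_att (y t))"
    and "t \<ge> 0"
  shows "norm (y t) < \<rho>" "norm (y t) \<le> m * exp (- \<alpha> * t) * norm (y 0)"
proof -
  have m: "m \<ge> 1" and \<rho>: "\<rho> > 0" and \<alpha>: "\<alpha> > 0" using bound by (auto simp: decay_bound_def)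
  have decay: "norm (y T) \<le> m * exp (- \<alpha> * T) * norm (y 0)"
    if "T \<ge> 0" and small: "\<And>t. 0 \<le> t \<Longrightarrow> t \<le> T \<Longrightarrow> norm (y t) \<le> \<rho>" for T
  proof -
    have "\<forall>t\<in>{0..T}. error_motion G ke c y t \<and> norm (y t) \<le> \<rho> \<and> orthogonal_matrix (mat 1 + err_att (y t))"
      using motion[OF that] small by simp
    then show ?thesis using bound c \<open>T \<ge> 0\<close> unfolding decay_bound_def by blast
  qed
  have m0: "m * norm (y 0) < \<rho>"
    using init m by (simp add: pos_less_divide_eq mult.commute)
  have small: "norm (y t) < \<rho>" if "t \<ge> 0" for t
  proof (rule continuity_bootstrap[where \<phi> = "\<lambda>t. norm (y t)", OF _ _ _ that])
    show "continuous_on {0..} (\<lambda>t. norm (y t))" by (intro continuous_intros cont)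
    have "1 * norm (y 0) \<le> m * norm (y 0)" using m by (intro mult_right_mono) auto
    then show "norm (y 0) < \<rho>" using m0 by simp
    fix T :: real assume T: "T \<ge> 0" "\<And>t. 0 \<le> t \<Longrightarrow> t \<le> T \<Longrightarrow> norm (y t) \<le> \<rho>"
    have "norm (y T) \<le> m * exp (- \<alpha> * T) * norm (y 0)" by (rule decay[OF T])
    also have "\<dots> \<le> m * 1 * norm (y 0)"
      using m \<alpha> T(1) by (intro mult_right_mono mult_left_mono) auto
    finally show "norm (y T) < \<rho>" using m0 by simp
  qed
  show "norm (y t) < \<rho>" by (rule small) fact
  show "norm (y t) \<le> m * exp (- \<alpha> * t) * norm (y 0)"
    using small by (intro decay \<open>t \<ge> 0\<close>) (auto intro: less_imp_le)
qed

text \<open>The metric projection to the ball is nonexpansive and is inserted into the quadratic part only. The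
truncated equation is globally Lipschitz, uniformly in time, and coincides with the true one inside the
ball.\<close>

lemma exists_truncated_error_motion:
  assumes c: "reference_motion \<delta> b c" and \<delta>: "\<delta> > 0" and \<rho>: "\<rho> > 0"
  shows "\<exists>y. y 0 = y0 \<and> continuous_on {0..} y \<and>
    (\<forall>t\<ge>0. norm (y t) \<le> \<rho> \<longrightarrow> error_motion G ke c y t)"
proof -
  let ?K = "reference_set \<delta> b"
  define P where "P = closest_point (cball (0::error_state) \<rho>)"
  have cball: "convex (cball (0::error_state) \<rho>)" "closed (cball (0::error_state) \<rho>)"
    "cball (0::error_state) \<rho> \<noteq> {}" using \<rho> by auto
  have P_in: "P x \<in> cball 0 \<rho>" for x
    unfolding P_def by (rule closest_point_in_set[OF cball(2,3)])
  have P_lip: "norm (P x - P y) \<le> norm (x - y)" for x y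
    unfolding P_def using closest_point_lipschitz[OF cball, of x y] by (simp add: dist_norm)
  have P_id: "P x = x" if "norm x \<le> \<rho>" for x
    unfolding P_def using that by (intro closest_point_self) auto
  have P_cont: "continuous_on X P" for X
    unfolding P_def by (rule continuous_on_closest_point[OF cball])
  have thrust: "ref_thrust c \<noteq> 0" if "c \<in> ?K" for c
    using reference_setD(2)[OF that] \<delta> by auto
  have "\<exists>C>0. \<forall>c\<in>?K. \<forall>y. norm (linear_field G ke c y) \<le> C * norm y"
    by (rule uniform_bound_homogeneous[OF compact_reference_set])
      (intro continuous_on_linear_field continuous_on_fst continuous_on_snd continuous_on_id
        linear_linear_field[THEN linear_scale]; simp add: thrust mem_Times_iff)+
  then obtain C1 where C1: "\<And>c y. c \<in> ?K \<Longrightarrow> norm (linear_field G ke c y) \<le> C1 * norm y" by blast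
  let ?KB = "?K \<times> cball (0::error_state) \<rho>"
  have KB: "compact ?KB" by (intro compact_Times compact_reference_set compact_cball)
  note Q = bilinear_quadratic_field[unfolded bilinear_conv_bounded_bilinear]
  have "\<exists>C>0. \<forall>p\<in>?KB. \<forall>v. norm (quadratic_field (fst p) (snd p) v) \<le> C * norm v"
    by (rule uniform_bound_homogeneous[OF KB])
      (intro continuous_on_quadratic_field continuous_on_fst continuous_on_snd continuous_on_id
        bounded_bilinear.scaleR_right[OF Q])+
  then obtain C2 where C2': "\<And>p v. p \<in> ?KB \<Longrightarrow> norm (quadratic_field (fst p) (snd p) v) \<le> C2 * norm v" by blast
  have C2: "norm (quadratic_field c x v) \<le> C2 * norm v" if "c \<in> ?K" "x \<in> cball 0 \<rho>" for c x v
    using C2'[of "(c, x)" v] that by simp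
  have "\<exists>C>0. \<forall>p\<in>?KB. \<forall>v. norm (quadratic_field (fst p) v (snd p)) \<le> C * norm v"
    by (rule uniform_bound_homogeneous[OF KB])
      (intro continuous_on_quadratic_field continuous_on_fst continuous_on_snd continuous_on_id
        bounded_bilinear.scaleR_left[OF Q])+
  then obtain C3 where C3': "\<And>p v. p \<in> ?KB \<Longrightarrow> norm (quadratic_field (fst p) v (snd p)) \<le> C3 * norm v" by blast
  have C3: "norm (quadratic_field c v x) \<le> C3 * norm v" if "c \<in> ?K" "x \<in> cball 0 \<rho>" for c x v
    using C3'[of "(c, x)" v] that by simp
  have pos: "0 \<le> \<bar>C2\<bar>" "0 \<le> \<bar>C3\<bar>" by simp_all
  define F where "F t x = linear_field G ke (c t) x + quadratic_field (c t) (P x) (P x)" for t x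
  have cK: "c t \<in> ?K" if "t \<ge> 0" for t using c that by (simp add: reference_motion_def)
  have cont_c: "continuous_on {0..} c" using c by (simp add: reference_motion_def)
  have "\<exists>y. y 0 = y0 \<and> (\<forall>t\<ge>0. (y has_vector_derivative F t (y t)) (at t within {0..}))"
  proof (rule global_picard[where K = "C1 + (\<bar>C2\<bar> + \<bar>C3\<bar>)"])
    fix y :: "real \<Rightarrow> error_state" assume y: "continuous_on {0..} y"
    have Py: "continuous_on {0..} (\<lambda>t. P (y t))"
      using continuous_on_compose2[OF P_cont[of UNIV] y] by simp
    show "continuous_on {0..} (\<lambda>t. F t (y t))"
      unfolding F_def
      by (intro continuous_on_add continuous_on_linear_field continuous_on_quadratic_field cont_c y Py)
        (use cK thrust in auto)
  next
    fix t :: real assume "t \<ge> 0"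
    then have ct: "c t \<in> ?K" by (rule cK)
    show "F t 0 = 0"
      by (simp add: F_def P_id less_imp_le[OF \<rho>] linear_linear_field[THEN linear_0]
          bounded_bilinear.zero_left[OF Q])
    fix x y
    have "F t x - F t y = linear_field G ke (c t) (x - y)
        + (quadratic_field (c t) (P x) (P x - P y) + quadratic_field (c t) (P x - P y) (P y))"
      by (simp add: F_def linear_linear_field[THEN linear_diff] bounded_bilinear.diff_left[OF Q]
          bounded_bilinear.diff_right[OF Q])
    also have "norm \<dots> \<le> C1 * norm (x - y) + (C2 * norm (P x - P y) + C3 * norm (P x - P y))"
      by (intro order_trans[OF norm_triangle_ineq] add_mono C1[OF ct] C2[OF ct] C3[OF ct] P_in)
    also have "\<dots> \<le> C1 * norm (x - y) + (\<bar>C2\<bar> * norm (x - y) + \<bar>C3\<bar> * norm (x - y))"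
      by (intro add_left_mono add_mono mult_mono P_lip abs_ge_self pos norm_ge_zero)
    finally show "norm (F t x - F t y) \<le> (C1 + (\<bar>C2\<bar> + \<bar>C3\<bar>)) * norm (x - y)"
      by (simp add: distrib_right)
  qed
  then obtain y where y: "y 0 = y0"
    "\<And>t. t \<ge> 0 \<Longrightarrow> (y has_vector_derivative F t (y t)) (at t within {0..})" by blast
  have "continuous_on {0..} y"
    using y(2) by (rule has_vector_derivative_half_line_continuous_on)
  moreover have "error_motion G ke c y t" if "t \<ge> 0" "norm (y t) \<le> \<rho>" for t
    using y(2)[OF that(1)] that(2) by (simp add: error_motion_def F_def P_id)
  ultimately show ?thesis using y(1) by blast
qed

lemmas error_motion_components =
  error_field_components[where S = "{0..}", folded error_motion_def, unfolded att_defect_def]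

lemma exists_small_error_motion:
  assumes bound: "decay_bound G ke \<delta> b \<rho> m \<alpha>" and c: "reference_motion \<delta> b c" and \<delta>: "\<delta> > 0"
    and init: "norm y0 < \<rho> / m" "orthogonal_matrix (mat 1 + err_att y0)"
  shows "\<exists>y. y 0 = y0 \<and> (\<forall>t\<ge>0. error_motion G ke c y t \<and> orthogonal_matrix (mat 1 + err_att (y t)))"
proof -
  have \<rho>: "\<rho> > 0" using bound by (simp add: decay_bound_def)
  obtain y where y: "y 0 = y0" "continuous_on {0..} y"
    "\<And>t. t \<ge> 0 \<Longrightarrow> norm (y t) \<le> \<rho> \<Longrightarrow> error_motion G ke c y t"
    using exists_truncated_error_motion[OF c \<delta> \<rho>, of y0 G ke] by blast
  have orth_ref: "orthogonal_matrix (ref_att (c t))" if "t \<ge> 0" for t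
    using c that by (auto simp: reference_motion_def dest: reference_setD)
  have att: "ref_att (c t) + ref_att (c t) ** err_att (y t) = ref_att (c t) ** (mat 1 + err_att (y t))" for t
    by (simp add: parts_linear_simps)
  have motion: "\<forall>t\<in>{0..T}. error_motion G ke c y t \<and> orthogonal_matrix (mat 1 + err_att (y t))"
    if small: "\<And>t. 0 \<le> t \<Longrightarrow> t \<le> T \<Longrightarrow> norm (y t) \<le> \<rho>" for T
  proof
    fix t assume t: "t \<in> {0..T}"
    have em: "error_motion G ke c y s" if "s \<in> {0..T}" for s
      using that small by (intro y(3)) auto
    have "orthogonal_matrix (ref_att (c t) + ref_att (c t) ** err_att (y t))"
    proof (rule orthogonal_matrix_preserved[OF _ _ t])
      show "((\<lambda>s. ref_att (c s) + ref_att (c s) ** err_att (y s)) has_vector_derivative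
          (ref_att (c s) + ref_att (c s) ** err_att (y s)) ** hat (ref_angvel (c s) + err_angvel (y s)))
          (at s within {0..})" if "s \<in> {0..T}" for s
        using c that error_motion_components(1)[OF em[OF that]]
        by (intro attitude_error_deriv) (auto simp: reference_motion_def att_d_def)
      show "orthogonal_matrix (ref_att (c 0) + ref_att (c 0) ** err_att (y 0))"
        unfolding att by (intro orthogonal_matrix_mul) (simp_all add: orth_ref y(1) init(2))
    qed
    then have "orthogonal_matrix (mat 1 + err_att (y t))"
      unfolding att using orth_ref[of t] t by (auto intro: orthogonal_matrix_mul_cancel[of "ref_att (c t)"])
    with em[OF t] show "error_motion G ke c y t \<and> orthogonal_matrix (mat 1 + err_att (y t))" by blast
  qed
  have small: "norm (y t) < \<rho>" if "t \<ge> 0" for t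
    using init(1) by (intro decay_bound_global(1)[OF bound c y(2) _ motion that]) (simp_all add: y(1))
  have "error_motion G ke c y t \<and> orthogonal_matrix (mat 1 + err_att (y t))" if "t \<ge> 0" for t
  proof -
    have "\<forall>s\<in>{0..t}. error_motion G ke c y s \<and> orthogonal_matrix (mat 1 + err_att (y s))"
      by (rule motion) (simp add: small less_imp_le)
    then show ?thesis using that by simp
  qed
  then show ?thesis using y(1) by blast
qed

section \<open>The feedback law in terms of the error state\<close>

lemma ddt_eq:
  assumes "(F has_vector_derivative D) (at t within {0..})" "t \<ge> 0"
  shows "ddt F t = D"
  unfolding ddt_def
proof (rule vector_derivative_within[OF _ assms(1)])
  have "t islimpt {t..t + 1}" by (simp add: islimpt_Icc)
  then have "t islimpt {0..}" by (rule islimpt_subset) (use assms(2) in auto)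
  then show "at t within {0..} \<noteq> bot" by (simp add: trivial_limit_within)
qed

lemma smooth_continuous_on: "smooth F \<Longrightarrow> continuous_on {0..} F"
  by (auto simp: smooth_def continuous_on_eq_continuous_within intro!: differentiable_imp_continuous_within
      dest: spec[of _ 0])

definition ref_data :: "(real \<Rightarrow> qstate) \<Rightarrow> (real \<Rightarrow> real^3) \<Rightarrow> (real \<Rightarrow> real) \<Rightarrow> real \<Rightarrow> reference_data" where
  "ref_data r u0 q0 t =
     (att (r t), angvel (r t), u0 t, thrust (r t), thrust_rate (r t), q0 t)"

lemma has_vector_derivative_error_state:
  assumes "((\<lambda>s. err_att (y s)) has_vector_derivative d1) (at t within S)" "((\<lambda>s. err_angvel (y s)) has_vector_derivative d2) (at t within S)"
    "((\<lambda>s. err_pos (y s)) has_vector_derivative d3) (at t within S)" "((\<lambda>s. err_vel (y s)) has_vector_derivative d4) (at t within S)"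
    "((\<lambda>s. err_thrust (y s)) has_vector_derivative d5) (at t within S)" "((\<lambda>s. err_thrust_rate (y s)) has_vector_derivative d6) (at t within S)"
    "((\<lambda>s. int_pos (y s)) has_vector_derivative d7) (at t within S)" "((\<lambda>s. int_yaw (y s)) has_vector_derivative d8) (at t within S)"
  shows "(y has_vector_derivative (d1, d2, d3, d4, d5, d6, d7, d8)) (at t within S)"
proof -
  have "((\<lambda>s. (err_att (y s), err_angvel (y s), err_pos (y s), err_vel (y s), err_thrust (y s),
      err_thrust_rate (y s), int_pos (y s), int_yaw (y s))) has_vector_derivative
      (d1, d2, d3, d4, d5, d6, d7, d8)) (at t within S)"
    by (intro has_vector_derivative_Pair assms)
  then show ?thesis by simp
qed

lemma matrix_inv_B0:
  assumes "thrust (r t) \<noteq> 0"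
  shows "matrix_inv (B0 r t) *v b = vector [b$1 / thrust (r t), - (b$2) / thrust (r t), b$3]"
proof -
  let ?w = "vector [b$1 / thrust (r t), - (b$2) / thrust (r t), b$3] :: real^3"
  have "B0 r t *v ?w = b"
    using assms by (simp add: B0_def matrix_vector_mult_def vec_eq_iff forall_3 sum_3)
  moreover have "invertible (B0 r t)"
    using assms by (simp add: invertible_det_nz det_3 B0_def)
  then have "matrix_inv (B0 r t) ** B0 r t = mat 1"
    unfolding invertible_def matrix_inv_def by (metis (mono_tags, lifting) someI_ex)
  ultimately show ?thesis
    by (metis matrix_vector_mul_assoc matrix_vector_mul_lid)
qed

text \<open>The integral states are left unspecified for a PD law, whose feedback does not read them.\<close>

definition represents_error :: "(real \<Rightarrow> qstate) \<Rightarrow> gains \<Rightarrow> (real \<Rightarrow> qstate) \<Rightarrow> (real \<Rightarrow> error_state) \<Rightarrow> real \<Rightarrow> bool" where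
  "represents_error r G S y t \<longleftrightarrow>
     err_att (y t) = Z r S t \<and> err_angvel (y t) = angvel (S t) - angvel (r t) \<and>
     err_pos (y t) = pos (S t) - pos (r t) \<and> err_vel (y t) = vel (S t) - vel (r t) \<and>
     err_thrust (y t) = thrust (S t) - thrust (r t) \<and>
     err_thrust_rate (y t) = thrust_rate (S t) - thrust_rate (r t) \<and>
     (case G of PD _ _ _ _ _ _ \<Rightarrow> True | PID _ _ _ _ _ _ _ _ \<Rightarrow>
       int_pos (y t) = integral {0..t} (\<lambda>s. pos (S s) - pos (r s)) \<and>
       int_yaw (y t) = integral {0..t} (\<lambda>s. zk r S s $ 3))"

text \<open>For a PD law zero is a solution of the equation of the integral states.\<close>

definition closed_loop_error :: "(real \<Rightarrow> qstate) \<Rightarrow> gains \<Rightarrow> (real \<Rightarrow> qstate) \<Rightarrow> real \<Rightarrow> error_state" where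
  "closed_loop_error r G S t =
     (Z r S t, angvel (S t) - angvel (r t), pos (S t) - pos (r t), vel (S t) - vel (r t),
      thrust (S t) - thrust (r t), thrust_rate (S t) - thrust_rate (r t),
      (case G of PD _ _ _ _ _ _ \<Rightarrow> 0
        | PID _ _ _ _ _ _ _ _ \<Rightarrow> integral {0..t} (\<lambda>s. pos (S s) - pos (r s))),
      (case G of PD _ _ _ _ _ _ \<Rightarrow> 0
        | PID _ _ _ _ _ _ _ _ \<Rightarrow> integral {0..t} (\<lambda>s. zk r S s $ 3)))"

context
  fixes g :: real and r :: "real \<Rightarrow> qstate" and u0 :: "real \<Rightarrow> real^3" and q0 :: "real \<Rightarrow> real"
  assumes reference: "reference g r u0 q0"
begin

abbreviation "ref_path \<equiv> ref_data r u0 q0"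

lemma reference_derivs:
  assumes "t \<ge> 0"
  shows "((\<lambda>s. ref_att (ref_path s)) has_vector_derivative att_d (ref_path t)) (at t within {0..})"
    "((\<lambda>s. ref_angvel (ref_path s)) has_vector_derivative ref_angacc (ref_path t)) (at t within {0..})"
    "((\<lambda>s. ref_thrust (ref_path s)) has_vector_derivative ref_thrust_rate (ref_path t)) (at t within {0..})"
    "((\<lambda>s. ref_thrust_rate (ref_path s)) has_vector_derivative ref_thrust_acc (ref_path t)) (at t within {0..})"
  using reference assms by (simp_all add: reference_def ref_data_def att_d_def)

lemma reference_pos_vel:
  assumes "t \<ge> 0"
  shows "((\<lambda>s. pos (r s)) has_vector_derivative vel (r t)) (at t within {0..})"
    "((\<lambda>s. vel (r s)) has_vector_derivative - (g *\<^sub>R e3) + thr_att (ref_path t) *v e3) (at t within {0..})"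
    "rotation_matrix (att (r t))" "orthogonal_matrix (att (r t))"
  using reference assms
  by (simp_all add: reference_def thr_att_def ref_data_def parts_linear_simps rotation_matrix_def)

lemma ddt_reference:
  assumes "t \<ge> 0"
  shows "ddt (\<lambda>s. att (r s)) t = att_d (ref_path t)" "ddt (\<lambda>s. angvel (r s)) t = u0 t"
    "ddt (\<lambda>s. thrust (r s)) t = thrust_rate (r t)"
    "ddt (ddt (\<lambda>s. thrust (r s))) t = q0 t"
    "ddt (A0 r) t = thr_att_d (ref_path t)" "ddt (ddt (\<lambda>s. att (r s))) t = att_dd (ref_path t)"
    "ddt (ddt (A0 r)) t = thr_att_dd (ref_path t)"
proof -
  have comps: "ref_att (ref_path t) = att (r t)" "ref_angvel (ref_path t) = angvel (r t)" "ref_angacc (ref_path t) = u0 t"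
    "ref_thrust (ref_path t) = thrust (r t)" "ref_thrust_rate (ref_path t) = thrust_rate (r t)"
    "ref_thrust_acc (ref_path t) = q0 t" for t
    by (simp_all add: ref_data_def)
  have A0: "A0 r = (\<lambda>s. thr_att (ref_path s))" by (simp add: fun_eq_iff A0_def thr_att_def comps)
  note d = reference_derivs[unfolded comps]
  have 1: "ddt (\<lambda>s. att (r s)) t = att_d (ref_path t)" "ddt (\<lambda>s. angvel (r s)) t = u0 t"
    "ddt (\<lambda>s. thrust (r s)) t = thrust_rate (r t)" "ddt (A0 r) t = thr_att_d (ref_path t)" if "t \<ge> 0" for t
    using d[OF that] that thr_att_deriv[where c = ref_path, OF reference_derivs[OF that]] unfolding A0
    by (auto intro: ddt_eq)
  show "ddt (\<lambda>s. att (r s)) t = att_d (ref_path t)" "ddt (\<lambda>s. angvel (r s)) t = u0 t"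
    "ddt (\<lambda>s. thrust (r s)) t = thrust_rate (r t)" "ddt (A0 r) t = thr_att_d (ref_path t)"
    by (rule 1[OF assms])+
  show "ddt (ddt (\<lambda>s. thrust (r s))) t = q0 t"
    by (rule ddt_eq[OF has_vector_derivative_transform[OF _ _
          d(4)[OF assms]] assms]) (use assms 1 in auto)
  show "ddt (ddt (\<lambda>s. att (r s))) t = att_dd (ref_path t)"
    by (rule ddt_eq[OF has_vector_derivative_transform[OF _ _
          att_d_deriv[where c = ref_path, OF reference_derivs[OF assms]]] assms]) (use assms 1 in auto)
  show "ddt (ddt (A0 r)) t = thr_att_dd (ref_path t)"
    by (rule ddt_eq[OF has_vector_derivative_transform[OF _ _
          thr_att_d_deriv[where c = ref_path, OF reference_derivs[OF assms]]] assms]) (use assms 1 in auto)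
qed

lemma reference_motion_ref_data:
  assumes "bounded ((\<lambda>t. angvel (r t)) ` {0..})" "bounded (ddt (\<lambda>t. angvel (r t)) ` {0..})"
    "bounded ((\<lambda>t. thrust (r t)) ` {0..})" "bounded (ddt (\<lambda>t. thrust (r t)) ` {0..})"
    "bounded (ddt (ddt (\<lambda>t. thrust (r t))) ` {0..})" "\<forall>t\<ge>0. thrust (r t) \<ge> \<delta>"
  shows "\<exists>b. reference_motion \<delta> b ref_path"
proof -
  have "bounded (u0 ` {0..})" "bounded ((\<lambda>t. thrust_rate (r t)) ` {0..})" "bounded (q0 ` {0..})"
    using assms(2,4,5) ddt_reference(2-4) by (auto simp: image_def cong: conj_cong bex_cong)
  with assms(1,3) obtain b1 b2 b3 b4 b5 where b: "\<And>t. t \<ge> 0 \<Longrightarrow> norm (angvel (r t)) \<le> b1"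
    "\<And>t. t \<ge> 0 \<Longrightarrow> norm (thrust (r t)) \<le> b2" "\<And>t. t \<ge> 0 \<Longrightarrow> norm (u0 t) \<le> b3"
    "\<And>t. t \<ge> 0 \<Longrightarrow> norm (thrust_rate (r t)) \<le> b4" "\<And>t. t \<ge> 0 \<Longrightarrow> norm (q0 t) \<le> b5"
    unfolding bounded_iff ball_simps(9) by (metis atLeast_iff)
  define b where "b = max b1 (max b2 (max b3 (max b4 b5)))"
  have le: "x \<le> b" if "x \<le> b1 \<or> x \<le> b2 \<or> x \<le> b3 \<or> x \<le> b4 \<or> x \<le> b5" for x
    using that by (auto simp: b_def le_max_iff_disj)
  have "ref_path t \<in> reference_set \<delta> b" if "t \<ge> 0" for t
    using assms(6) that reference_pos_vel(4)[OF that] b[OF that]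
    by (auto simp: reference_set_def ref_data_def intro!: le)
  moreover have "continuous_on {0..} ref_path"
    using reference unfolding ref_data_def reference_def
    by (intro continuous_on_Pair smooth_continuous_on) auto
  ultimately show ?thesis
    unfolding reference_motion_def using reference_derivs by blast
qed

text \<open>The feedback law was formulated with derivatives along the reference trajectory; by the
differential equations of the reference these are functions of the current reference data.\<close>

lemma controller_eq:
  assumes y: "represents_error r G S y t" and t: "t \<ge> 0" and thrust: "thrust (r t) \<noteq> 0"
  shows "delta_u G ke r S t = angacc_input G ke (ref_path t) (y t)"
    "delta_q G ke r S t = thrust_input G ke (ref_path t) (y t)"
proof -
  have ref: "att (r t) = ref_att (ref_path t)" "angvel (r t) = ref_angvel (ref_path t)" "u0 t = ref_angacc (ref_path t)"
    "thrust (r t) = ref_thrust (ref_path t)" "thrust_rate (r t) = ref_thrust_rate (ref_path t)" 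
    by (simp_all add: ref_data_def)
  have A0: "A0 r t = thr_att (ref_path t)" by (simp add: A0_def thr_att_def ref_data_def)
  have err: "Z r S t = err_att (y t)" "angvel (S t) - angvel (r t) = err_angvel (y t)"
    "pos (S t) - pos (r t) = err_pos (y t)" "vel (S t) - vel (r t) = err_vel (y t)"
    "thrust (S t) - thrust (r t) = err_thrust (y t)"
    "thrust_rate (S t) - thrust_rate (r t) = err_thrust_rate (y t)"
    using y by (simp_all add: represents_error_def)
  have parts: "Zs r S t = sym_err (y t)" "Zk r S t = skew_err (y t)" "zk r S t = skew_vec (y t)"
    by (simp_all add: Zs_def Zk_def zk_def err sym_err_def skew_err_def skew_vec_def)
  have rates: "Zs_dot ke r S t = sym_err_d ke (ref_path t) (y t)" "zk_dot r S t = skew_vec_d (ref_path t) (y t)"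
    "pos_err_2 r S t = acc_err (ref_path t) (y t)"
    unfolding Zs_dot_def zk_dot_def pos_err_2_def sym_err_d_def skew_vec_d_def acc_err_def
      parts err A0 by (simp_all only: ref)
  have Zk_dot: "Zk_dot r S t = hat (skew_vec_d (ref_path t) (y t))" by (simp only: Zk_dot_def rates)
  have jerk: "pos_err_3 ke r S t = jerk_err ke (ref_path t) (y t)"
    unfolding pos_err_3_def jerk_err_def parts rates Zk_dot err A0 ddt_reference[OF t] by (simp only: ref)
  have drift: "C_mat ke r S t = drift ke (ref_path t) (y t)"
    unfolding C_mat_def drift_def parts rates Zk_dot err A0 ddt_reference[OF t] by (simp only: ref)
  have v: "v_feedback G ke r S t = pos_law G ke (ref_path t) (y t)"
    using y by (cases G) (simp_all add: jerk rates err represents_error_def)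
  have w: "w_feedback G r S t = yaw_law G (ref_path t) (y t)"
    using y by (cases G) (simp_all add: rates parts represents_error_def)
  have dec: "decoupled_input G ke r S t = vector [body_input G ke (ref_path t) (y t) $ 1 / thrust (r t),
      - (body_input G ke (ref_path t) (y t) $ 2) / thrust (r t), body_input G ke (ref_path t) (y t) $ 3]"
    unfolding decoupled_input_def matrix_inv_B0[where r = r, OF thrust] v drift body_input_def ref ..
  show "delta_q G ke r S t = thrust_input G ke (ref_path t) (y t)"
    by (simp add: delta_q_def dec thrust_input_def)
  have "u_tilde G ke r S t = new_input G ke (ref_path t) (y t)"
    by (simp add: u_tilde_def dec new_input_def w ref)
  then show "delta_u G ke r S t = angacc_input G ke (ref_path t) (y t)"
    unfolding delta_u_def angacc_input_def skew_vec_d_def parts ddt_reference[OF t] err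
    by (simp only: ref)
qed

lemma represents_closed_loop_error: "represents_error r G S (closed_loop_error r G S) t"
  by (cases G) (simp_all add: represents_error_def closed_loop_error_def)

text \<open>The torque cancels the gyroscopic term, and the inertia matrix is injective because it is positive
definite, so the angular acceleration is \<open>u\<^sub>0 + \<Delta>u\<close>.\<close>

lemma closed_loop_error_motion:
  assumes J: "sym_pos_def J" and S: "closed_loop g J G ke r u0 q0 S"
    and thrust: "\<And>t. t \<ge> 0 \<Longrightarrow> thrust (r t) \<noteq> 0" and t: "t \<ge> 0"
  shows "error_motion G ke ref_path (closed_loop_error r G S) t"
proof -
  let ?y = "closed_loop_error r G S"
  note ctrl = controller_eq[OF represents_closed_loop_error[of G S t] t thrust[OF t]]
  have att: "((\<lambda>s. att (S s)) has_vector_derivative att (S t) ** hat (angvel (S t))) (at t within {0..})"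
    and pos: "((\<lambda>s. pos (S s)) has_vector_derivative vel (S t)) (at t within {0..})"
    and vel: "((\<lambda>s. vel (S s)) has_vector_derivative
      - (g *\<^sub>R e3) + thrust (S t) *\<^sub>R (att (S t) *v e3)) (at t within {0..})"
    and thr: "((\<lambda>s. thrust (S s)) has_vector_derivative thrust_rate (S t)) (at t within {0..})"
    and thr_rate: "((\<lambda>s. thrust_rate (S s)) has_vector_derivative q0 t + delta_q G ke r S t) (at t within {0..})"
    if "t \<ge> 0" for t
    using S that by (simp_all add: closed_loop_def)
  obtain W where W: "((\<lambda>s. angvel (S s)) has_vector_derivative W) (at t within {0..})"
    "J *v W = cross3 (J *v angvel (S t)) (angvel (S t)) + torque J G ke r u0 S t"
    using S t by (auto simp: closed_loop_def)
  have "J *v (W - (u0 t + delta_u G ke r S t)) = 0"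
    using W(2) by (simp add: torque_def matrix_vector_mult_diff_distrib)
  then have "W - (u0 t + delta_u G ke r S t) = 0"
    using J unfolding sym_pos_def_def by (metis inner_zero_right less_irrefl)
  then have W_eq: "W = u0 t + delta_u G ke r S t" by simp
  note d = reference_derivs[OF t, unfolded ref_data_def, simplified, folded ref_data_def]
  have err: "err_att (?y s) = Z r S s" "err_angvel (?y s) = angvel (S s) - angvel (r s)"
    "err_pos (?y s) = pos (S s) - pos (r s)" "err_vel (?y s) = vel (S s) - vel (r s)"
    "err_thrust (?y s) = thrust (S s) - thrust (r s)"
    "err_thrust_rate (?y s) = thrust_rate (S s) - thrust_rate (r s)" for s
    by (simp_all add: closed_loop_error_def)
  have ref: "ref_att (ref_path t) = att (r t)" "ref_angvel (ref_path t) = angvel (r t)" "ref_thrust (ref_path t) = thrust (r t)"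
    by (simp_all add: ref_data_def)
  have "((\<lambda>s. err_att (?y s)) has_vector_derivative
      commutator (err_att (?y t)) (hat (ref_angvel (ref_path t))) + hat (err_angvel (?y t))
        + err_att (?y t) ** hat (err_angvel (?y t))) (at t within {0..})"
    unfolding err Z_def ref using att[OF t] d(1) reference_pos_vel(4)[OF t]
    by (intro error_attitude_deriv) (simp_all add: att_d_def ref)
  moreover have "((\<lambda>s. err_angvel (?y s)) has_vector_derivative angacc_input G ke (ref_path t) (?y t))
      (at t within {0..})"
    unfolding err using has_vector_derivative_diff[OF W(1) d(2)] by (simp add: W_eq ctrl)
  moreover have "((\<lambda>s. err_pos (?y s)) has_vector_derivative err_vel (?y t)) (at t within {0..})"
    unfolding err by (intro has_vector_derivative_diff pos reference_pos_vel t)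
  moreover have "((\<lambda>s. err_vel (?y s)) has_vector_derivative
      (err_thrust (?y t) *\<^sub>R ref_att (ref_path t) + thr_att (ref_path t) ** err_att (?y t)) *v e3
      + (err_thrust (?y t) *\<^sub>R (ref_att (ref_path t) ** err_att (?y t))) *v e3) (at t within {0..})"
  proof -
    have att_err: "att (S t) = att (r t) + att (r t) ** Z r S t"
      using reference_pos_vel(4)[OF t] by (simp add: Z_def matrix_mul_assoc orthogonal_matrix_def)
    show ?thesis
      unfolding err ref thr_att_def
      by (rule has_vector_derivative_eq_rhs[OF has_vector_derivative_diff[OF vel[OF t] reference_pos_vel(2)[OF t]]])
        (simp add: ref thr_att_def parts_linear_simps att_err scaleR_diff_left scaleR_add_right)
  qed
  moreover have "((\<lambda>s. err_thrust (?y s)) has_vector_derivative err_thrust_rate (?y t)) (at t within {0..})"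
    unfolding err by (intro has_vector_derivative_diff thr t d)
  moreover have "((\<lambda>s. err_thrust_rate (?y s)) has_vector_derivative
      thrust_input G ke (ref_path t) (?y t)) (at t within {0..})"
    unfolding err using has_vector_derivative_diff[OF thr_rate[OF t] d(4)] by (simp add: ctrl)
  moreover have "((\<lambda>s. int_pos (?y s)) has_vector_derivative int_pos_rate G (?y t)) (at t within {0..})"
  proof (cases G)
    case (PID K0 K1 K2 K3 KI a0 a1 aI)
    have "continuous_on {0..} (\<lambda>s. pos (S s) - pos (r s))"
      by (intro continuous_on_diff has_vector_derivative_half_line_continuous_on[OF pos]
          has_vector_derivative_half_line_continuous_on[OF reference_pos_vel(1)])
    from integral_has_vector_derivative_half_line[OF this t] show ?thesis
      by (simp add: PID closed_loop_error_def)
  qed (simp add: closed_loop_error_def)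
  moreover have "((\<lambda>s. int_yaw (?y s)) has_vector_derivative int_yaw_rate G (?y t)) (at t within {0..})"
  proof (cases G)
    case (PID K0 K1 K2 K3 KI a0 a1 aI)
    have "continuous_on {0..} (\<lambda>s. att (S s))" "continuous_on {0..} (\<lambda>s. att (r s))"
      using att reference_derivs(1)
      by (auto intro!: has_vector_derivative_half_line_continuous_on simp: ref_data_def)
    then have "continuous_on {0..} (\<lambda>s. zk r S s $ 3)"
      unfolding zk_def Zk_def Z_def by (intro continuous_intros)
    from integral_has_vector_derivative_half_line[OF this t] show ?thesis
      by (simp add: PID closed_loop_error_def skew_vec_def skew_err_def zk_def Zk_def)
  qed (simp add: closed_loop_error_def)
  ultimately show ?thesis
    unfolding error_motion_def
    by (rule has_vector_derivative_eq_rhs[OF has_vector_derivative_error_state])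
      (simp add: linear_field_def quadratic_field_def)
qed

text \<open>Conversely, adding a solution of the error equations to the reference gives a solution of
the controlled system; the integral states that start at zero are the integrals of the feedback law.\<close>

lemma error_motion_closed_loop:
  assumes S: "\<And>t. t \<ge> 0 \<Longrightarrow> S t = \<lparr>att = att (r t) + att (r t) ** err_att (y t),
      angvel = angvel (r t) + err_angvel (y t), pos = pos (r t) + err_pos (y t),
      vel = vel (r t) + err_vel (y t), thrust = thrust (r t) + err_thrust (y t),
      thrust_rate = thrust_rate (r t) + err_thrust_rate (y t)\<rparr>"
    and y: "\<And>t. t \<ge> 0 \<Longrightarrow> error_motion G ke ref_path y t" "int_pos (y 0) = 0" "int_yaw (y 0) = 0"
    and rot: "\<And>t. t \<ge> 0 \<Longrightarrow> orthogonal_matrix (mat 1 + err_att (y t))" "rotation_matrix (att (S 0))"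
    and thrust: "\<And>t. t \<ge> 0 \<Longrightarrow> thrust (r t) \<noteq> 0"
  shows "closed_loop g J G ke r u0 q0 S"
proof -
  have ref: "ref_att (ref_path t) = att (r t)" "ref_angvel (ref_path t) = angvel (r t)" "ref_thrust (ref_path t) = thrust (r t)"
    "ref_angacc (ref_path t) = u0 t" "ref_thrust_rate (ref_path t) = thrust_rate (r t)" "ref_thrust_acc (ref_path t) = q0 t" for t
    by (simp_all add: ref_data_def)
  note comps = error_motion_components[OF y(1)]
  note d = reference_derivs[unfolded ref]
  have Z: "Z r S t = err_att (y t)" if "t \<ge> 0" for t
    using reference_pos_vel(4)[OF that] that
    by (simp add: Z_def S matrix_mul_assoc orthogonal_matrix)
  have rep: "represents_error r G S y t" if t: "t \<ge> 0" for t
  proof (cases G)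
    case (PID K0 K1 K2 K3 KI a0 a1 aI)
    have "((\<lambda>s. err_pos (y s)) has_integral int_pos (y t) - int_pos (y 0)) {0..t}"
    proof (rule fundamental_theorem_of_calculus[OF t])
      fix s assume "s \<in> {0..t}"
      then show "((\<lambda>s. int_pos (y s)) has_vector_derivative err_pos (y s)) (at s within {0..t})"
        using has_vector_derivative_within_subset[OF comps(7)[of s], of "{0..t}"] by (simp add: PID)
    qed
    then have "int_pos (y t) = integral {0..t} (\<lambda>s. err_pos (y s))"
      by (simp add: y(2) integral_unique)
    also have "\<dots> = integral {0..t} (\<lambda>s. pos (S s) - pos (r s))"
      by (rule integral_cong) (simp add: S)
    finally have 1: "int_pos (y t) = integral {0..t} (\<lambda>s. pos (S s) - pos (r s))" .
    have "((\<lambda>s. skew_vec (y s) $ 3) has_integral int_yaw (y t) - int_yaw (y 0)) {0..t}"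
    proof (rule fundamental_theorem_of_calculus[OF t])
      fix s assume "s \<in> {0..t}"
      then show "((\<lambda>s. int_yaw (y s)) has_vector_derivative skew_vec (y s) $ 3) (at s within {0..t})"
        using has_vector_derivative_within_subset[OF comps(8)[of s], of "{0..t}"] by (simp add: PID)
    qed
    then have "int_yaw (y t) = integral {0..t} (\<lambda>s. skew_vec (y s) $ 3)"
      by (simp add: y(3) integral_unique)
    also have "\<dots> = integral {0..t} (\<lambda>s. zk r S s $ 3)"
      by (rule integral_cong) (simp add: zk_def Zk_def Z skew_vec_def skew_err_def)
    finally have 2: "int_yaw (y t) = integral {0..t} (\<lambda>s. zk r S s $ 3)" .
    show ?thesis using t by (simp add: represents_error_def Z S PID 1 2)
  qed (use t in \<open>simp add: represents_error_def Z S\<close>)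
  note ctrl = controller_eq[OF rep _ thrust]
  have att: "((\<lambda>s. att (S s)) has_vector_derivative att (S t) ** hat (angvel (S t))) (at t within {0..})"
    if "t \<ge> 0" for t
  proof -
    have "((\<lambda>s. att (r s) + att (r s) ** err_att (y s)) has_vector_derivative
        (att (r t) + att (r t) ** err_att (y t)) ** hat (angvel (r t) + err_angvel (y t))) (at t within {0..})"
      using d(1)[OF that] comps(1)[OF that] unfolding att_d_def ref by (rule attitude_error_deriv)
    then show ?thesis
      by (intro has_vector_derivative_transform[of _ _ "\<lambda>s. att (S s)" "\<lambda>s. att (r s) + att (r s) ** err_att (y s)"])
        (use that in \<open>simp_all add: S\<close>)
  qed
  have rotation: "rotation_matrix (att (S t))" if "t \<ge> 0" for t
  proof (rule rotation_matrix_preserved[of "\<lambda>s. att (S s)", OF _ _ rot(2) that])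
    show "continuous_on {0..} (\<lambda>s. att (S s))"
      by (rule has_vector_derivative_half_line_continuous_on[OF att])
    fix s :: real assume s: "s \<ge> 0"
    have "att (S s) = att (r s) ** (mat 1 + err_att (y s))" using s by (simp add: S parts_linear_simps)
    then show "orthogonal_matrix (att (S s))"
      using orthogonal_matrix_mul[OF reference_pos_vel(4)[OF s] rot(1)[OF s]] by simp
  qed
  have "\<exists>W. ((\<lambda>s. angvel (S s)) has_vector_derivative W) (at t within {0..}) \<and>
      J *v W = cross3 (J *v angvel (S t)) (angvel (S t)) + torque J G ke r u0 S t" if t: "t \<ge> 0" for t
  proof (intro exI conjI)
    show "((\<lambda>s. angvel (S s)) has_vector_derivative u0 t + delta_u G ke r S t) (at t within {0..})"
      unfolding ctrl(1)[OF t t t]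
      by (rule has_vector_derivative_transform[OF _ _ has_vector_derivative_add[OF d(2)[OF t] comps(2)[OF t]]])
        (use t in \<open>simp_all add: S\<close>)
  qed (simp add: torque_def)
  moreover have "((\<lambda>s. pos (S s)) has_vector_derivative vel (S t)) (at t within {0..})" if t: "t \<ge> 0" for t
  proof -
    have "((\<lambda>s. pos (S s)) has_vector_derivative vel (r t) + err_vel (y t)) (at t within {0..})"
      by (rule has_vector_derivative_transform[OF _ _ has_vector_derivative_add[OF reference_pos_vel(1)[OF t] comps(3)[OF t]]])
        (use t in \<open>simp_all add: S\<close>)
    then show ?thesis using t by (simp add: S)
  qed
  moreover have "((\<lambda>s. vel (S s)) has_vector_derivative
      - (g *\<^sub>R e3) + thrust (S t) *\<^sub>R (att (S t) *v e3)) (at t within {0..})" if t: "t \<ge> 0" for t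
  proof (rule has_vector_derivative_eq_rhs)
    show "((\<lambda>s. vel (S s)) has_vector_derivative
      (- (g *\<^sub>R e3) + thr_att (ref_path t) *v e3) + ((err_thrust (y t) *\<^sub>R ref_att (ref_path t) + thr_att (ref_path t) ** err_att (y t)) *v e3
      + (err_thrust (y t) *\<^sub>R (ref_att (ref_path t) ** err_att (y t))) *v e3)) (at t within {0..})"
      by (rule has_vector_derivative_transform[OF _ _ has_vector_derivative_add[OF reference_pos_vel(2)[OF t] comps(4)[OF t]]])
        (use t in \<open>simp_all add: S\<close>)
  qed (use t in \<open>simp add: S ref thr_att_def parts_linear_simps algebra_simps\<close>)
  moreover have "((\<lambda>s. thrust (S s)) has_vector_derivative thrust_rate (S t)) (at t within {0..})" if t: "t \<ge> 0" for t
  proof -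
    have "((\<lambda>s. thrust (S s)) has_vector_derivative thrust_rate (r t) + err_thrust_rate (y t)) (at t within {0..})"
      by (rule has_vector_derivative_transform[OF _ _ has_vector_derivative_add[OF d(3)[OF t] comps(5)[OF t]]])
        (use t in \<open>simp_all add: S\<close>)
    then show ?thesis using t by (simp add: S)
  qed
  moreover have "((\<lambda>s. thrust_rate (S s)) has_vector_derivative q0 t + delta_q G ke r S t) (at t within {0..})"
    if t: "t \<ge> 0" for t
    unfolding ctrl(2)[OF t t t]
    by (rule has_vector_derivative_transform[OF _ _ has_vector_derivative_add[OF d(4)[OF t] comps(6)[OF t]]])
      (use t in \<open>simp_all add: S\<close>)
  ultimately show ?thesis
    unfolding closed_loop_def using att rotation by blast
qed

end

section \<open>Exponential tracking\<close>

lemma norm_error_state_le: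
  "norm (y :: error_state) \<le> norm (err_att y) + norm (err_angvel y) + norm (err_pos y) + norm (err_vel y)
    + \<bar>err_thrust y\<bar> + \<bar>err_thrust_rate y\<bar> + norm (int_pos y) + \<bar>int_yaw y\<bar>"
proof -
  have split: "norm p \<le> norm (fst p) + norm (snd p)" for p :: "'a::real_normed_vector \<times> 'b::real_normed_vector"
    using norm_Pair_le[of "fst p" "snd p"] by simp
  show ?thesis
    using split[of y] split[of "snd y"] split[of "snd (snd y)"] split[of "snd (snd (snd y))"]
      split[of "snd (snd (snd (snd y)))"] split[of "snd (snd (snd (snd (snd y))))"]
      split[of "snd (snd (snd (snd (snd (snd y)))))"]
    by simp
qed

theorem theorem7:
  fixes g ke \<delta> :: real
    and J :: "real^3^3"
    and r :: "real \<Rightarrow> qstate"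
    and u0 :: "real \<Rightarrow> real^3"
    and q0 :: "real \<Rightarrow> real"
    and G :: gains
  assumes "g > 0"
    and "sym_pos_def J"
    and "reference g r u0 q0"
    and "bounded ((\<lambda>t. angvel (r t)) ` {0..})"
    and "bounded (ddt (\<lambda>t. angvel (r t)) ` {0..})"
    and "bounded ((\<lambda>t. thrust (r t)) ` {0..})"
    and "bounded (ddt (\<lambda>t. thrust (r t)) ` {0..})"
    and "bounded (ddt (ddt (\<lambda>t. thrust (r t))) ` {0..})"
    and "\<delta> > 0"
    and "\<forall>t\<ge>0. thrust (r t) \<ge> \<delta>"
    and "ke > 0"
    and "admissible G"
  shows "exponentially_tracks (closed_loop g J G ke r u0 q0) r"
proof -
  let ?c = "ref_data r u0 q0"
  obtain b where c: "reference_motion \<delta> b ?c"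
    using reference_motion_ref_data[OF assms(3-8,10)] by blast
  obtain \<rho> m \<alpha> where bound: "decay_bound G ke \<delta> b \<rho> m \<alpha>"
    using local_decay[OF assms(12,9)] by blast
  then have pos: "\<rho> > 0" "m \<ge> 1" "\<alpha> > 0" by (simp_all add: decay_bound_def)
  obtain K where K: "K \<ge> 1" "\<And>R A :: real^3^3. orthogonal_matrix R \<Longrightarrow> norm (R ** A) \<le> K * norm A"
    using orthogonal_mult_bound by blast
  have thrust: "thrust (r t) \<noteq> 0" if "t \<ge> 0" for t using assms(9,10) that by force
  have orth: "orthogonal_matrix (att (r t))" "orthogonal_matrix (transpose (att (r t)))" if "t \<ge> 0" for t
    using reference_pos_vel(4)[OF assms(3) that] by simp_all
  define init where "init s = (transpose (att (r 0)) ** (att s - att (r 0)), angvel s - angvel (r 0),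
    pos s - pos (r 0), vel s - vel (r 0), thrust s - thrust (r 0), thrust_rate s - thrust_rate (r 0),
    0 :: real^3, 0 :: real)" for s :: qstate
  have init_norm: "norm (init s) \<le> K * full_error s (r 0)" for s
  proof -
    have "norm (init s) \<le> K * norm (att s - att (r 0)) + norm (angvel s - angvel (r 0))
        + norm (pos s - pos (r 0)) + norm (vel s - vel (r 0)) + \<bar>thrust s - thrust (r 0)\<bar>
        + \<bar>thrust_rate s - thrust_rate (r 0)\<bar>"
      using norm_error_state_le[of "init s"] K(2)[OF orth(2)[of 0], of "att s - att (r 0)"]
      by (simp add: init_def)
    also have "\<dots> \<le> K * norm (att s - att (r 0)) + K * norm (angvel s - angvel (r 0))
        + K * norm (pos s - pos (r 0)) + K * norm (vel s - vel (r 0)) + K * \<bar>thrust s - thrust (r 0)\<bar>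
        + K * \<bar>thrust_rate s - thrust_rate (r 0)\<bar>"
    proof -
      have "x \<le> K * x" if "x \<ge> 0" for x using mult_right_mono[OF K(1) that] by simp
      then show ?thesis by (intro add_mono order_refl) auto
    qed
    finally show ?thesis by (simp add: full_error_def tracking_error_def algebra_simps)
  qed
  have small: "norm (init s) < \<rho> / m" if "full_error s (r 0) < \<rho> / (m * K)" for s
  proof -
    have "K * full_error s (r 0) < \<rho> / m" using that pos K(1) by (simp add: field_simps)
    then show ?thesis using init_norm[of s] by simp
  qed
  have exists: "\<exists>S. closed_loop g J G ke r u0 q0 S \<and> S 0 = s"
    if rot: "rotation_matrix (att s)" and close: "full_error s (r 0) < \<rho> / (m * K)" for s
  proof -
    have "mat 1 + err_att (init s) = transpose (att (r 0)) ** att s"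
      using orth(1)[of 0] by (simp add: init_def orthogonal_matrix parts_linear_simps)
    then have "orthogonal_matrix (mat 1 + err_att (init s))"
      using orthogonal_matrix_mul[OF orth(2)[of 0], of "att s"] rot by (simp add: rotation_matrix_def)
    from exists_small_error_motion[OF bound c assms(9) small[OF close] this]
    obtain y where y: "y 0 = init s" "\<And>t. t \<ge> 0 \<Longrightarrow> error_motion G ke ?c y t"
      "\<And>t. t \<ge> 0 \<Longrightarrow> orthogonal_matrix (mat 1 + err_att (y t))" by blast
    define S where "S t = \<lparr>att = att (r t) + att (r t) ** err_att (y t),
      angvel = angvel (r t) + err_angvel (y t), pos = pos (r t) + err_pos (y t),
      vel = vel (r t) + err_vel (y t), thrust = thrust (r t) + err_thrust (y t),
      thrust_rate = thrust_rate (r t) + err_thrust_rate (y t)\<rparr>" for t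
    have "att (r 0) ** (transpose (att (r 0)) ** (att s - att (r 0))) = att s - att (r 0)"
      using orth(1)[of 0] by (simp add: matrix_mul_assoc orthogonal_matrix_def)
    then have "S 0 = s" by (simp add: S_def y(1) init_def)
    moreover have "closed_loop g J G ke r u0 q0 S"
      using rot \<open>S 0 = s\<close>
      by (intro error_motion_closed_loop[OF assms(3) S_def y(2) _ _ y(3) _ thrust])
        (simp_all add: y(1) init_def)
    ultimately show ?thesis by blast
  qed
  have decay: "tracking_error (S t) (r t) \<le> (4 * K * m * K) * exp (- \<alpha> * t) * full_error s (r 0)"
    if close: "full_error s (r 0) < \<rho> / (m * K)"
      and S: "closed_loop g J G ke r u0 q0 S" "S 0 = s" and t: "t \<ge> 0" for s S t
  proof -
    define y where "y = closed_loop_error r G S"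
    have motion: "error_motion G ke ?c y t" if "t \<ge> 0" for t
      unfolding y_def by (rule closed_loop_error_motion[OF assms(3,2) S(1) thrust that])
    have err: "err_att (y t) = Z r S t" "err_angvel (y t) = angvel (S t) - angvel (r t)"
      "err_pos (y t) = pos (S t) - pos (r t)" "err_vel (y t) = vel (S t) - vel (r t)" for t
      by (simp_all add: y_def closed_loop_error_def)
    have orth_err: "orthogonal_matrix (mat 1 + err_att (y t))" if "t \<ge> 0" for t
    proof -
      have "mat 1 + err_att (y t) = transpose (att (r t)) ** att (S t)"
        using orth(1)[OF that] by (simp add: err Z_def orthogonal_matrix parts_linear_simps)
      moreover have "orthogonal_matrix (att (S t))"
        using S(1) that by (simp add: closed_loop_def rotation_matrix_def)
      ultimately show ?thesis using orthogonal_matrix_mul[OF orth(2)[OF that]] by simp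
    qed
    have "continuous_on {0..} y"
      using motion unfolding error_motion_def by (rule has_vector_derivative_half_line_continuous_on)
    moreover have y0: "y 0 = init s"
      by (cases G) (simp_all add: y_def closed_loop_error_def init_def Z_def S(2))
    ultimately have y_decay: "norm (y t) \<le> m * exp (- \<alpha> * t) * norm (init s)"
      using decay_bound_global(2)[OF bound c _ _ _ t, of y] motion orth_err small[OF close] by simp
    have "att (S t) - att (r t) = att (r t) ** err_att (y t)"
      using orth(1)[OF t] by (simp add: err Z_def matrix_mul_assoc orthogonal_matrix_def)
    then have "norm (att (S t) - att (r t)) \<le> K * norm (y t)"
      using order_trans[OF K(2)[OF orth(1)[OF t], of "err_att (y t)"] mult_left_mono[OF norm_err_le(1)]] K(1)
      by simp
    moreover have "norm (y t) \<le> K * norm (y t)" using mult_right_mono[OF K(1), of "norm (y t)"] by simp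
    ultimately have "tracking_error (S t) (r t) \<le> 4 * K * norm (y t)"
      using norm_err_le(2-4)[of "y t"] by (simp add: tracking_error_def err)
    also have "\<dots> \<le> 4 * K * (m * exp (- \<alpha> * t) * norm (init s))"
      using K(1) by (intro mult_left_mono y_decay) simp
    also have "\<dots> \<le> 4 * K * (m * exp (- \<alpha> * t) * (K * full_error s (r 0)))"
      using K(1) pos by (intro mult_left_mono init_norm) simp_all
    finally show ?thesis by (simp add: mult_ac)
  qed
  have "\<forall>s. rotation_matrix (att s) \<and> full_error s (r 0) < \<rho> / (m * K) \<longrightarrow>
      (\<exists>S. closed_loop g J G ke r u0 q0 S \<and> S 0 = s) \<and>
      (\<forall>S. closed_loop g J G ke r u0 q0 S \<and> S 0 = s \<longrightarrow> (\<forall>t\<ge>0.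
        tracking_error (S t) (r t) \<le> (4 * K * m * K) * exp (- \<alpha> * t) * full_error s (r 0)))"
    using exists decay by simp
  moreover have "\<rho> / (m * K) > 0" "4 * K * m * K > 0" using pos K(1) by simp_all
  ultimately show ?thesis
    unfolding exponentially_tracks_def using pos(3) by (intro exI conjI) assumption+
qed

end
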